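(* The weakening and projection monad $P$ on $[\mathcal H^{\mathrm{op}},\mathbf{Set}]$, i.e. the monad induced by the free-forgetful adjunction $\{w,p\}\text{-}\mathbf{GAT}\leftrightarrows[\mathcal H^{\mathrm{op}},\mathbf{Set}]$, is strongly cartesian.
   Context: \textbf{Categorical notions.} A functor $F\colon\mathcal C\to\mathcal D$ is local right adjoint if for each $X\in\mathcal C$ the induced functor on slices $F/X\colon\mathcal C/X\to\mathcal D/FX$ is a right adjoint; a monad is local right adjoint if its underlying endofunctor is. A natural transformation is cartesian if all its naturality squares are pullbacks. A monad is cartesian if its underlying endofunctor preserves pullbacks and its unit and multiplication are cartesian; it is strongly cartesian if it is cartesian and local right adjoint. \textbf{Expressions and judgements.} Fix a denumerable set $\mathrm{Var}$ of variables. Given an alphabet $\Xi$, the expressions over $\Xi$ are generated as follows: each $x\in\mathrm{Var}$ is an expression; if $n\geq 0$, $e_1,\dots,e_n$ are expressions and $w\in\Xi$, then $w(e_1,\dots,e_n)$ is an expression (written $w$ when $n=0$). $\mathsf{fv}$ denotes free variables and $e'[e/x]$ substitution of $e$ for $x$ in $e'$. A context is a (possibly empty) list $x_1:T_1,\dots,x_n:T_n$ of distinct variables $x_i$ and expressions $T_i$; $\mathsf{fv}(\Gamma)$ is the set of variables occurring in $\Gamma$. A judgement is a string $\Gamma\vdash T\ \mathsf{type}$ (type judgement), $\Gamma\vdash t:T$ (term judgement), $\Gamma\vdash T=T'\ \mathsf{type}$ (type equality) or $\Gamma\vdash t=t':T$ (term equality), with $\Gamma$ a context and $t,t',T,T'$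 expressions; its degree is one more than the length of $\Gamma$. The boundary of a judgement is a list of judgements: $\partial(\vdash T\ \mathsf{type})=()$; $\partial(\Gamma,x:T\vdash T'\ \mathsf{type})=(\Gamma\vdash T\ \mathsf{type})$; $\partial(\Gamma\vdash t:T)=(\Gamma\vdash T\ \mathsf{type})$; $\partial(\Gamma\vdash T=T'\ \mathsf{type})=(\Gamma\vdash T\ \mathsf{type},\ \Gamma\vdash T'\ \mathsf{type})$; $\partial(\Gamma\vdash t=t':T)=(\Gamma\vdash t:T,\ \Gamma\vdash t':T)$. \textbf{Deduction rules} (premises $\Longrightarrow$ conclusion; $\mathcal J$ stands for the right-hand side of any of the four judgement forms). \emph{Equality and $\alpha$ rules}: $\Gamma\vdash t:T\Longrightarrow\Gamma\vdash t=t:T$; $\Gamma\vdash t_1=t_2:T\Longrightarrow\Gamma\vdash t_2=t_1:T$; $\Gamma\vdash t_1=t_2:T$ and $\Gamma\vdash t_2=t_3:T\Longrightarrow\Gamma\vdash t_1=t_3:T$; $\Gamma\vdash T\ \mathsf{type}\Longrightarrow\Gamma\vdash T=T\ \mathsf{type}$; $\Gamma\vdash T_1=T_2\ \mathsf{type}\Longrightarrow\Gamma\vdash T_2=T_1\ \mathsf{type}$; $\Gamma\vdash T_1=T_2\ \mathsf{type}$ and $\Gamma\vdash T_2=T_3\ \mathsf{type}\Longrightarrow\Gamma\vdash T_1=T_3\ \mathsf{type}$; $\Gamma\vdash T_1=T_2\ \mathsf{type}$ and $\Gamma\vdash t:T_1\Longrightarrow\Gamma\vdash t:T_2$; $\Gamma\vdash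 T_1=T_2\ \mathsf{type}$ and $\Gamma\vdash t_1=t_2:T_1\Longrightarrow\Gamma\vdash t_1=t_2:T_2$; $\Gamma\vdash\mathcal J\Longrightarrow\sigma\cdot\Gamma\vdash\sigma\cdot\mathcal J$ for any permutation $\sigma\in\mathrm{Sym}(\mathrm{Var})$ acting on variables. \emph{Weakening} ($w$): $\Gamma\vdash T\ \mathsf{type}$ and $\Gamma,\Delta\vdash\mathcal J\Longrightarrow\Gamma,y:T,\Delta\vdash\mathcal J$, for $y\notin\mathsf{fv}(\Gamma)\cup\mathsf{fv}(\Delta)$. \emph{Projection} ($p$): $\Gamma\vdash T\ \mathsf{type}\Longrightarrow\Gamma,y:T\vdash y:T$, for $y\notin\mathsf{fv}(\Gamma)$. \textbf{$\{w,p\}$-GATs.} A $\{w,p\}$-GAT $\mathbb T$ consists of a collection $\Omega$ of type-constants, a collection $\Sigma$ of term-constants and a collection $\Lambda$ of basic judgements over $\Omega\amalg\Sigma$ such that: for each $A\in\Omega$ there is a unique judgement in $\Lambda$ of the form $x_1:T_1,\dots,x_{n-1}:T_{n-1}\vdash A(x_1,\dots,x_{n-1})\ \mathsf{type}$; for each $f\in\Sigma$ there is a unique judgement in $\Lambda$ of the form $x_1:T_1,\dots,x_{n-1}:T_{n-1}\vdash f(x_1,\dots,x_{n-1}):T$; all other elements of $\Lambda$ are type or term equality judgements; each element of $\Lambda$ lies in $\mathbb T^*$. Here $\mathbb T^*$, the collection of derived judgements, is the smallest collection closed under all the rules listed above and containing $\mathcal J\in\Lambda$ whenever it contains each judgement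 in $\partial(\mathcal J)$. An interpretation $\phi\colon\mathbb T\to\mathbb U$ is a function $\phi\colon\mathbb T^*\to\mathbb U^*$ preserving boundaries and preserving deduction: viewing each rule with $n$ premises (for each choice of parameters such as $y$ or $\sigma$) as an $n$-ary partial function $r$ on judgements, $\phi(r(\mathcal J_1,\dots,\mathcal J_n))=r(\phi(\mathcal J_1),\dots,\phi(\mathcal J_n))$ whenever both sides are defined. On derived type judgements, $(x_1:S_1,\dots,x_{n-1}:S_{n-1}\vdash S_n\ \mathsf{type})\equiv(y_1:T_1,\dots,y_{m-1}:T_{m-1}\vdash T_m\ \mathsf{type})$ iff $n=m$ and for $1\le i\le n$ the judgement $x_1:S_1,\dots,x_{i-1}:S_{i-1}\vdash S_i=T_i[x_1/y_1,\dots,x_{i-1}/y_{i-1}]\ \mathsf{type}$ is derived. On derived term judgements, $(x_1:S_1,\dots,x_{n-1}:S_{n-1}\vdash s:S_n)\equiv(y_1:T_1,\dots,y_{m-1}:T_{m-1}\vdash t:T_m)$ iff their boundaries are $\equiv$ and $x_1:S_1,\dots,x_{n-1}:S_{n-1}\vdash s=t[x_1/y_1,\dots,x_{n-1}/y_{n-1}]:S_n$ is derived. $\{w,p\}\text{-}\mathbf{GAT}$ has $\{w,p\}$-GATs as objects and, as morphisms, interpretations modulo: $\phi\sim\phi'$ iff $\phi(\mathcal J)\equiv\phi'(\mathcal J)$ for each derived type or term judgement $\mathcal J$. \textbf{Type-and-term structures and the monad.} $\mathcal H$ is the category freely generated by the graph with objects $n$ and $n_t$ ($n\ge1$) and arrows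 $n\to n+1$ and $n\to n_t$. For $X\in[\mathcal H^{\mathrm{op}},\mathbf{Set}]$ the maps $X(n+1)\to X(n)$, $X(n_t)\to X(n)$ are written $\partial$. The forgetful functor $V\colon\{w,p\}\text{-}\mathbf{GAT}\to[\mathcal H^{\mathrm{op}},\mathbf{Set}]$ has $V\mathbb T(n)$ (resp. $V\mathbb T(n_t)$) the set of derived type (resp. term) judgements of degree $n$ modulo $\equiv$, boundaries induced by $\partial$, and $V\phi([\mathcal J])=[\phi(\mathcal J)]$. It has a left adjoint $G$, where $GX$ is the $\{w,p\}$-GAT whose type- and term-constants are the elements of the sets $X(n)$ and $X(n_t)$ and whose basic judgements are $\mathcal J_A=(x_1:A_1,x_2:A_2(x_1),\dots,x_{n-1}:A_{n-1}(x_1,\dots,x_{n-2})\vdash A(x_1,\dots,x_{n-1})\ \mathsf{type})$ for $A\in X(n)$, where $A_i=\partial^{n-i}A$, and, in the same context, $\mathcal J_a=(\dots\vdash a(x_1,\dots,x_{n-1}):A(x_1,\dots,x_{n-1}))$ for $a\in X(n_t)$ with $\partial a=A$. The adjunction unit is $A\mapsto[\mathcal J_A]$, $a\mapsto[\mathcal J_a]$, and the counit $\epsilon_{\mathbb T}\colon GV\mathbb T\to\mathbb T$ is given on basic judgements by $\mathcal J_{[\mathcal J]}\mapsto\mathcal J$. $P=VG$ is the induced monad. *)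

theory Defs
  imports "HOL-Library.FuncSet" "HOL-Library.Infinite_Typeclass"
begin

section \<open>Categories\<close>

record ('o, 'm) cat =
  Obj :: "'o set"
  Arr :: "'m set"
  Dom :: "'m \<Rightarrow> 'o"
  Cod :: "'m \<Rightarrow> 'o"
  Id :: "'o \<Rightarrow> 'm"
  Comp :: "'m \<Rightarrow> 'm \<Rightarrow> 'm"

definition hom :: "('o, 'm) cat \<Rightarrow> 'o \<Rightarrow> 'o \<Rightarrow> 'm set" where
  "hom C a b = {f \<in> Arr C. Dom C f = a \<and> Cod C f = b}"

definition category :: "('o, 'm) cat \<Rightarrow> bool" where
  "category C \<longleftrightarrow>
     (\<forall>f \<in> Arr C. Dom C f \<in> Obj C \<and> Cod C f \<in> Obj C) \<and>
     (\<forall>a \<in> Obj C. Id C a \<in> hom C a a) \<and>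
     (\<forall>f \<in> Arr C. \<forall>g \<in> Arr C. Cod C f = Dom C g \<longrightarrow> Comp C g f \<in> hom C (Dom C f) (Cod C g)) \<and>
     (\<forall>f \<in> Arr C. Comp C f (Id C (Dom C f)) = f \<and> Comp C (Id C (Cod C f)) f = f) \<and>
     (\<forall>f \<in> Arr C. \<forall>g \<in> Arr C. \<forall>h \<in> Arr C. Cod C f = Dom C g \<and> Cod C g = Dom C h \<longrightarrow>
        Comp C h (Comp C g f) = Comp C (Comp C h g) f)"

definition op_cat :: "('o, 'm) cat \<Rightarrow> ('o, 'm) cat" where
  "op_cat C = \<lparr>Obj = Obj C, Arr = Arr C, Dom = Cod C, Cod = Dom C, Id = Id C,
               Comp = (\<lambda>g f. Comp C f g)\<rparr>"

text \<open>Object and arrow maps of functors, and families of components of natural transformations,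
  are required to be extensional, so that equality of functors and of natural transformations
  is the HOL equality.\<close>

record ('o, 'm, 'p, 'n) fctr =
  omap :: "'o \<Rightarrow> 'p"
  amap :: "'m \<Rightarrow> 'n"

definition is_functor :: "('o, 'm) cat \<Rightarrow> ('p, 'n) cat \<Rightarrow> ('o, 'm, 'p, 'n) fctr \<Rightarrow> bool" where
  "is_functor C D F \<longleftrightarrow> category C \<and> category D \<and>
     omap F \<in> Obj C \<rightarrow>\<^sub>E Obj D \<and> amap F \<in> Arr C \<rightarrow>\<^sub>E Arr D \<and>
     (\<forall>f \<in> Arr C. amap F f \<in> hom D (omap F (Dom C f)) (omap F (Cod C f))) \<and>
     (\<forall>a \<in> Obj C. amap F (Id C a) = Id D (omap F a)) \<and>
     (\<forall>f \<in> Arr C. \<forall>g \<in> Arr C. Cod C f = Dom C g \<longrightarrow>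
        amap F (Comp C g f) = Comp D (amap F g) (amap F f))"

definition id_fctr :: "('o, 'm) cat \<Rightarrow> ('o, 'm, 'o, 'm) fctr" where
  "id_fctr C = \<lparr>omap = (\<lambda>a \<in> Obj C. a), amap = (\<lambda>f \<in> Arr C. f)\<rparr>"

definition comp_fctr ::
  "('o, 'm) cat \<Rightarrow> ('p, 'n, 'q, 'k) fctr \<Rightarrow> ('o, 'm, 'p, 'n) fctr \<Rightarrow> ('o, 'm, 'q, 'k) fctr" where
  "comp_fctr C G F = \<lparr>omap = compose (Obj C) (omap G) (omap F),
                      amap = compose (Arr C) (amap G) (amap F)\<rparr>"

definition nat_trans :: "('o, 'm) cat \<Rightarrow> ('p, 'n) cat \<Rightarrow> ('o, 'm, 'p, 'n) fctr \<Rightarrow>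
    ('o, 'm, 'p, 'n) fctr \<Rightarrow> ('o \<Rightarrow> 'n) \<Rightarrow> bool" where
  "nat_trans C D F G \<tau> \<longleftrightarrow> is_functor C D F \<and> is_functor C D G \<and>
     \<tau> \<in> extensional (Obj C) \<and>
     (\<forall>a \<in> Obj C. \<tau> a \<in> hom D (omap F a) (omap G a)) \<and>
     (\<forall>f \<in> Arr C. Comp D (amap G f) (\<tau> (Dom C f)) = Comp D (\<tau> (Cod C f)) (amap F f))"

text \<open>\<open>is_pullback C p q f g\<close>: the square \<open>f \<circ> p = g \<circ> q\<close> is a pullback.\<close>

definition is_pullback :: "('o, 'm) cat \<Rightarrow> 'm \<Rightarrow> 'm \<Rightarrow> 'm \<Rightarrow> 'm \<Rightarrow> bool" where
  "is_pullback C p q f g \<longleftrightarrow>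
     {p, q, f, g} \<subseteq> Arr C \<and> Dom C p = Dom C q \<and> Cod C p = Dom C f \<and> Cod C q = Dom C g \<and>
     Cod C f = Cod C g \<and> Comp C f p = Comp C g q \<and>
     (\<forall>p' \<in> Arr C. \<forall>q' \<in> Arr C. Dom C p' = Dom C q' \<and> Cod C p' = Dom C f \<and> Cod C q' = Dom C g \<and>
        Comp C f p' = Comp C g q' \<longrightarrow>
        (\<exists>!u. u \<in> hom C (Dom C p') (Dom C p) \<and> Comp C p u = p' \<and> Comp C q u = q'))"

definition preserves_pullbacks ::
  "('o, 'm) cat \<Rightarrow> ('p, 'n) cat \<Rightarrow> ('o, 'm, 'p, 'n) fctr \<Rightarrow> bool" where
  "preserves_pullbacks C D F \<longleftrightarrow>
     (\<forall>p q f g. is_pullback C p q f g \<longrightarrow>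
        is_pullback D (amap F p) (amap F q) (amap F f) (amap F g))"

definition cartesian_nat_trans :: "('o, 'm) cat \<Rightarrow> ('p, 'n) cat \<Rightarrow> ('o, 'm, 'p, 'n) fctr \<Rightarrow>
    ('o, 'm, 'p, 'n) fctr \<Rightarrow> ('o \<Rightarrow> 'n) \<Rightarrow> bool" where
  "cartesian_nat_trans C D F G \<tau> \<longleftrightarrow> nat_trans C D F G \<tau> \<and>
     (\<forall>f \<in> Arr C. is_pullback D (\<tau> (Dom C f)) (amap F f) (amap G f) (\<tau> (Cod C f)))"

definition adjunction :: "('o, 'm) cat \<Rightarrow> ('p, 'n) cat \<Rightarrow> ('o, 'm, 'p, 'n) fctr \<Rightarrow>
    ('p, 'n, 'o, 'm) fctr \<Rightarrow> ('o \<Rightarrow> 'm) \<Rightarrow> ('p \<Rightarrow> 'n) \<Rightarrow> bool" where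
  "adjunction C D L R \<eta> \<epsilon> \<longleftrightarrow> is_functor C D L \<and> is_functor D C R \<and>
     nat_trans C C (id_fctr C) (comp_fctr C R L) \<eta> \<and>
     nat_trans D D (comp_fctr D L R) (id_fctr D) \<epsilon> \<and>
     (\<forall>a \<in> Obj C. Comp D (\<epsilon> (omap L a)) (amap L (\<eta> a)) = Id D (omap L a)) \<and>
     (\<forall>b \<in> Obj D. Comp C (amap R (\<epsilon> b)) (\<eta> (omap R b)) = Id C (omap R b))"

definition is_right_adjoint ::
  "('p, 'n) cat \<Rightarrow> ('o, 'm) cat \<Rightarrow> ('p, 'n, 'o, 'm) fctr \<Rightarrow> bool" where
  "is_right_adjoint D C R \<longleftrightarrow> (\<exists>L \<eta> \<epsilon>. adjunction C D L R \<eta> \<epsilon>)"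

definition slice_cat :: "('o, 'm) cat \<Rightarrow> 'o \<Rightarrow> ('m, 'm \<times> 'm \<times> 'm) cat" where
  "slice_cat C X =
     \<lparr>Obj = {f \<in> Arr C. Cod C f = X},
      Arr = {(f, h, g). f \<in> Arr C \<and> g \<in> Arr C \<and> Cod C f = X \<and> Cod C g = X \<and>
                        h \<in> hom C (Dom C f) (Dom C g) \<and> Comp C g h = f},
      Dom = (\<lambda>(f, h, g). f),
      Cod = (\<lambda>(f, h, g). g),
      Id = (\<lambda>f. (f, Id C (Dom C f), f)),
      Comp = (\<lambda>(f', h', g') (f, h, g). (f, Comp C h' h, g'))\<rparr>"

definition slice_fctr :: "('o, 'm) cat \<Rightarrow> ('o, 'm, 'p, 'n) fctr \<Rightarrow> 'o \<Rightarrow>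
    ('m, 'm \<times> 'm \<times> 'm, 'n, 'n \<times> 'n \<times> 'n) fctr" where
  "slice_fctr C F X =
     \<lparr>omap = (\<lambda>f \<in> Obj (slice_cat C X). amap F f),
      amap = (\<lambda>(f, h, g) \<in> Arr (slice_cat C X). (amap F f, amap F h, amap F g))\<rparr>"

definition local_right_adjoint ::
  "('o, 'm) cat \<Rightarrow> ('p, 'n) cat \<Rightarrow> ('o, 'm, 'p, 'n) fctr \<Rightarrow> bool" where
  "local_right_adjoint C D F \<longleftrightarrow> is_functor C D F \<and>
     (\<forall>X \<in> Obj C.
        is_right_adjoint (slice_cat C X) (slice_cat D (omap F X)) (slice_fctr C F X))"

text \<open>A monad is given as a triple of endofunctor, unit and multiplication.\<close>

type_synonym ('o, 'm) monad_data = "('o, 'm, 'o, 'm) fctr \<times> ('o \<Rightarrow> 'm) \<times> ('o \<Rightarrow> 'm)"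

definition is_monad :: "('o, 'm) cat \<Rightarrow> ('o, 'm) monad_data \<Rightarrow> bool" where
  "is_monad C = (\<lambda>(P, \<eta>, \<mu>). is_functor C C P \<and>
     nat_trans C C (id_fctr C) P \<eta> \<and>
     nat_trans C C (comp_fctr C P P) P \<mu> \<and>
     (\<forall>a \<in> Obj C. Comp C (\<mu> a) (\<eta> (omap P a)) = Id C (omap P a) \<and>
                  Comp C (\<mu> a) (amap P (\<eta> a)) = Id C (omap P a) \<and>
                  Comp C (\<mu> a) (\<mu> (omap P a)) = Comp C (\<mu> a) (amap P (\<mu> a))))"

definition cartesian_monad :: "('o, 'm) cat \<Rightarrow> ('o, 'm) monad_data \<Rightarrow> bool" where
  "cartesian_monad C = (\<lambda>(P, \<eta>, \<mu>). is_monad C (P, \<eta>, \<mu>) \<and>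
     preserves_pullbacks C C P \<and>
     cartesian_nat_trans C C (id_fctr C) P \<eta> \<and>
     cartesian_nat_trans C C (comp_fctr C P P) P \<mu>)"

definition strongly_cartesian_monad :: "('o, 'm) cat \<Rightarrow> ('o, 'm) monad_data \<Rightarrow> bool" where
  "strongly_cartesian_monad C = (\<lambda>(P, \<eta>, \<mu>). cartesian_monad C (P, \<eta>, \<mu>) \<and>
     local_right_adjoint C C P)"

definition induced_monad :: "('o, 'm) cat \<Rightarrow> ('o, 'm, 'p, 'n) fctr \<Rightarrow> ('p, 'n, 'o, 'm) fctr \<Rightarrow>
    ('o \<Rightarrow> 'm) \<Rightarrow> ('p \<Rightarrow> 'n) \<Rightarrow> ('o, 'm) monad_data" where
  "induced_monad C L R \<eta> \<epsilon> =
     (comp_fctr C R L, \<eta>, \<lambda>a \<in> Obj C. amap R (\<epsilon> (omap L a)))"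


subsection \<open>Sets, functor categories, free categories\<close>

text \<open>Arrows of the following categories are triples (domain, underlying map, codomain).\<close>

abbreviation mid :: "'a \<times> 'b \<times> 'c \<Rightarrow> 'b" where
  "mid f \<equiv> fst (snd f)"

text \<open>The category of sets relative to a type \<open>'u\<close> playing the role of the universe: the
  objects are the subsets of \<open>'u\<close>, i.e. up to isomorphism all sets of at most the cardinality
  of \<open>'u\<close>.\<close>

definition set_cat :: "('u set, 'u set \<times> ('u \<Rightarrow> 'u) \<times> 'u set) cat" where
  "set_cat =
     \<lparr>Obj = UNIV,
      Arr = {(A, f, B). f \<in> A \<rightarrow>\<^sub>E B},
      Dom = (\<lambda>(A, f, B). A),
      Cod = (\<lambda>(A, f, B). B),
      Id = (\<lambda>A. (A, \<lambda>x \<in> A. x, A)),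
      Comp = (\<lambda>(B', g, C) (A, f, B). (A, compose A g f, C))\<rparr>"

definition functor_cat :: "('o, 'm) cat \<Rightarrow> ('p, 'n) cat \<Rightarrow>
    (('o, 'm, 'p, 'n) fctr, ('o, 'm, 'p, 'n) fctr \<times> ('o \<Rightarrow> 'n) \<times> ('o, 'm, 'p, 'n) fctr) cat" where
  "functor_cat C D =
     \<lparr>Obj = {F. is_functor C D F},
      Arr = {(F, \<tau>, G). nat_trans C D F G \<tau>},
      Dom = (\<lambda>(F, \<tau>, G). F),
      Cod = (\<lambda>(F, \<tau>, G). G),
      Id = (\<lambda>F. (F, \<lambda>a \<in> Obj C. Id D (omap F a), F)),
      Comp = (\<lambda>(F', \<sigma>, H) (F, \<tau>, G). (F, \<lambda>a \<in> Obj C. Comp D (\<sigma> a) (\<tau> a), H))\<rparr>"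

primrec is_path :: "'e set \<Rightarrow> ('e \<Rightarrow> 'v) \<Rightarrow> ('e \<Rightarrow> 'v) \<Rightarrow> 'v \<Rightarrow> 'e list \<Rightarrow> 'v \<Rightarrow> bool" where
  "is_path E s t a [] b \<longleftrightarrow> a = b"
| "is_path E s t a (e # es) b \<longleftrightarrow> e \<in> E \<and> s e = a \<and> is_path E s t (t e) es b"

definition free_cat :: "'v set \<Rightarrow> 'e set \<Rightarrow> ('e \<Rightarrow> 'v) \<Rightarrow> ('e \<Rightarrow> 'v) \<Rightarrow>
    ('v, 'v \<times> 'e list \<times> 'v) cat" where
  "free_cat V E s t =
     \<lparr>Obj = V,
      Arr = {(a, es, b). a \<in> V \<and> b \<in> V \<and> is_path E s t a es b},
      Dom = (\<lambda>(a, es, b). a),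
      Cod = (\<lambda>(a, es, b). b),
      Id = (\<lambda>a. (a, [], a)),
      Comp = (\<lambda>(b', fs, c) (a, es, b). (a, es @ fs, c))\<rparr>"


subsection \<open>The category of type-and-term structures\<close>

datatype hob = Ty nat | Tm nat

datatype hedge = Next nat  \<comment> \<open>\<open>n \<rightarrow> n + 1\<close>\<close>
  | Term nat  \<comment> \<open>\<open>n \<rightarrow> n\<^sub>t\<close>\<close>

primrec hsrc :: "hedge \<Rightarrow> hob" where
  "hsrc (Next n) = Ty n"
| "hsrc (Term n) = Ty n"

primrec htgt :: "hedge \<Rightarrow> hob" where
  "htgt (Next n) = Ty (n + 1)"
| "htgt (Term n) = Tm n"

type_synonym harr = "hob \<times> hedge list \<times> hob"

definition H_cat :: "(hob, harr) cat" where
  "H_cat = free_cat (Ty ` {1..} \<union> Tm ` {1..}) (Next ` {1..} \<union> Term ` {1..}) hsrc htgt"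

type_synonym 'u psh = "(hob, harr, 'u set, 'u set \<times> ('u \<Rightarrow> 'u) \<times> 'u set) fctr"

type_synonym 'u psh_arr =
  "'u psh \<times> (hob \<Rightarrow> 'u set \<times> ('u \<Rightarrow> 'u) \<times> 'u set) \<times> 'u psh"

definition psh_cat :: "('u psh, 'u psh_arr) cat" where
  "psh_cat = functor_cat (op_cat H_cat) set_cat"

text \<open>The iterated boundary \<open>X(n) \<rightarrow> X(i)\<close> for \<open>i \<le> n\<close>, and the boundary \<open>X(n\<^sub>t) \<rightarrow> X(n)\<close>.\<close>

definition ty_bd :: "'u psh \<Rightarrow> nat \<Rightarrow> nat \<Rightarrow> 'u \<Rightarrow> 'u" where
  "ty_bd X i n = mid (amap X (Ty i, map Next [i..<n], Ty n))"

definition tm_bd :: "'u psh \<Rightarrow> nat \<Rightarrow> 'u \<Rightarrow> 'u" where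
  "tm_bd X n = mid (amap X (Ty n, [Term n], Tm n))"


section \<open>Expressions and judgements\<close>

text \<open>The variables are the natural numbers; \<open>'w\<close> is the type of symbols.\<close>

datatype 'w expr = Var nat | App 'w "'w expr list"

type_synonym 'w ctx = "(nat \<times> 'w expr) list"

datatype 'w rhs =
    IsType "'w expr"
  | HasType "'w expr" "'w expr"  \<comment> \<open>\<open>HasType t T\<close> is \<open>t : T\<close>\<close>
  | TypeEq "'w expr" "'w expr"
  | TermEq "'w expr" "'w expr" "'w expr"  \<comment> \<open>\<open>TermEq t t' T\<close> is \<open>t = t' : T\<close>\<close>

datatype 'w jdg = Jdg (ctx: "'w ctx") (rhs: "'w rhs")  (infix "\<turnstile>" 55)

primrec fv :: "'w expr \<Rightarrow> nat set" where
  "fv (Var x) = {x}"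
| "fv (App w es) = \<Union> (set (map fv es))"

definition fv_ctx :: "'w ctx \<Rightarrow> nat set" where
  "fv_ctx \<Gamma> = (\<Union>(x, T) \<in> set \<Gamma>. insert x (fv T))"

primrec subst :: "(nat \<Rightarrow> 'w expr) \<Rightarrow> 'w expr \<Rightarrow> 'w expr" where
  "subst \<theta> (Var x) = \<theta> x"
| "subst \<theta> (App w es) = App w (map (subst \<theta>) es)"

text \<open>\<open>var_subst xs ys\<close> is the simultaneous substitution \<open>[x\<^sub>1/y\<^sub>1, \<dots>, x\<^sub>k/y\<^sub>k]\<close>, replacing \<open>y\<^sub>i\<close>
  by \<open>x\<^sub>i\<close>.\<close>

definition var_subst :: "nat list \<Rightarrow> nat list \<Rightarrow> 'w expr \<Rightarrow> 'w expr" where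
  "var_subst xs ys =
     subst (\<lambda>v. case map_of (zip ys xs) v of Some x \<Rightarrow> Var x | None \<Rightarrow> Var v)"

primrec perm_rhs :: "(nat \<Rightarrow> nat) \<Rightarrow> 'w rhs \<Rightarrow> 'w rhs" where
  "perm_rhs \<sigma> (IsType T) = IsType (subst (Var \<circ> \<sigma>) T)"
| "perm_rhs \<sigma> (HasType t T) = HasType (subst (Var \<circ> \<sigma>) t) (subst (Var \<circ> \<sigma>) T)"
| "perm_rhs \<sigma> (TypeEq T T') = TypeEq (subst (Var \<circ> \<sigma>) T) (subst (Var \<circ> \<sigma>) T')"
| "perm_rhs \<sigma> (TermEq t t' T) =
     TermEq (subst (Var \<circ> \<sigma>) t) (subst (Var \<circ> \<sigma>) t') (subst (Var \<circ> \<sigma>) T)"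

definition perm_jdg :: "(nat \<Rightarrow> nat) \<Rightarrow> 'w jdg \<Rightarrow> 'w jdg" where
  "perm_jdg \<sigma> J = (map (\<lambda>(x, T). (\<sigma> x, subst (Var \<circ> \<sigma>) T)) (ctx J) \<turnstile> perm_rhs \<sigma> (rhs J))"

definition is_type_jdg :: "'w jdg \<Rightarrow> bool" where
  "is_type_jdg J \<longleftrightarrow> (\<exists>\<Gamma> T. J = (\<Gamma> \<turnstile> IsType T))"

definition is_term_jdg :: "'w jdg \<Rightarrow> bool" where
  "is_term_jdg J \<longleftrightarrow> (\<exists>\<Gamma> t T. J = (\<Gamma> \<turnstile> HasType t T))"

definition degree :: "'w jdg \<Rightarrow> nat" where
  "degree J = length (ctx J) + 1"

fun boundary :: "'w jdg \<Rightarrow> 'w jdg list" where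
  "boundary (\<Gamma> \<turnstile> IsType T) =
     (if \<Gamma> = [] then [] else [butlast \<Gamma> \<turnstile> IsType (snd (last \<Gamma>))])"
| "boundary (\<Gamma> \<turnstile> HasType t T) = [\<Gamma> \<turnstile> IsType T]"
| "boundary (\<Gamma> \<turnstile> TypeEq T T') = [\<Gamma> \<turnstile> IsType T, \<Gamma> \<turnstile> IsType T']"
| "boundary (\<Gamma> \<turnstile> TermEq t t' T) = [\<Gamma> \<turnstile> HasType t T, \<Gamma> \<turnstile> HasType t' T]"


section \<open>Deduction rules\<close>

text \<open>Names of the rules, including the parameters that make each of them a partial function.\<close>

datatype rule_name =
    TermRefl | TermSym | TermTrans | TypeRefl | TypeSym | TypeTrans | TermConv | TermEqConv
  | Perm "nat \<Rightarrow> nat" | Weaken nat | Project nat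

text \<open>\<open>deduction r Js J\<close>: the partial function named \<open>r\<close> is defined at the premises \<open>Js\<close>, with
  value \<open>J\<close>.\<close>

inductive deduction :: "rule_name \<Rightarrow> 'w jdg list \<Rightarrow> 'w jdg \<Rightarrow> bool" where
  "deduction TermRefl [\<Gamma> \<turnstile> HasType t T] (\<Gamma> \<turnstile> TermEq t t T)"
| "deduction TermSym [\<Gamma> \<turnstile> TermEq t1 t2 T] (\<Gamma> \<turnstile> TermEq t2 t1 T)"
| "deduction TermTrans [\<Gamma> \<turnstile> TermEq t1 t2 T, \<Gamma> \<turnstile> TermEq t2 t3 T] (\<Gamma> \<turnstile> TermEq t1 t3 T)"
| "deduction TypeRefl [\<Gamma> \<turnstile> IsType T] (\<Gamma> \<turnstile> TypeEq T T)"
| "deduction TypeSym [\<Gamma> \<turnstile> TypeEq T1 T2] (\<Gamma> \<turnstile> TypeEq T2 T1)"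
| "deduction TypeTrans [\<Gamma> \<turnstile> TypeEq T1 T2, \<Gamma> \<turnstile> TypeEq T2 T3] (\<Gamma> \<turnstile> TypeEq T1 T3)"
| "deduction TermConv [\<Gamma> \<turnstile> TypeEq T1 T2, \<Gamma> \<turnstile> HasType t T1] (\<Gamma> \<turnstile> HasType t T2)"
| "deduction TermEqConv [\<Gamma> \<turnstile> TypeEq T1 T2, \<Gamma> \<turnstile> TermEq t1 t2 T1] (\<Gamma> \<turnstile> TermEq t1 t2 T2)"
| "bij \<sigma> \<Longrightarrow> deduction (Perm \<sigma>) [J] (perm_jdg \<sigma> J)"
| "y \<notin> fv_ctx \<Gamma> \<union> fv_ctx \<Delta> \<Longrightarrow>
     deduction (Weaken y) [\<Gamma> \<turnstile> IsType T, \<Gamma> @ \<Delta> \<turnstile> R] (\<Gamma> @ (y, T) # \<Delta> \<turnstile> R)"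
| "y \<notin> fv_ctx \<Gamma> \<Longrightarrow>
     deduction (Project y) [\<Gamma> \<turnstile> IsType T] (\<Gamma> @ [(y, T)] \<turnstile> HasType (Var y) T)"

inductive_set derived_from :: "'w jdg set \<Rightarrow> 'w jdg set" for \<Lambda> :: "'w jdg set" where
  "deduction r Js J \<Longrightarrow> \<forall>K \<in> set Js. K \<in> derived_from \<Lambda> \<Longrightarrow> J \<in> derived_from \<Lambda>"
| "J \<in> \<Lambda> \<Longrightarrow> \<forall>K \<in> set (boundary J). K \<in> derived_from \<Lambda> \<Longrightarrow> J \<in> derived_from \<Lambda>"


section \<open>Generalised algebraic theories with weakening and projection\<close>

text \<open>The alphabet is the disjoint union of the type-constants (\<open>Inl\<close>) and the term-constants
  (\<open>Inr\<close>).\<close>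

record 'k gat =
  tyconsts :: "'k set"
  tmconsts :: "'k set"
  basic :: "('k + 'k) jdg set"

definition derived :: "'k gat \<Rightarrow> ('k + 'k) jdg set" where
  "derived T = derived_from (basic T)"

definition introduces_type :: "'k \<Rightarrow> ('k + 'k) jdg \<Rightarrow> bool" where
  "introduces_type A J \<longleftrightarrow> (\<exists>\<Gamma>. J = (\<Gamma> \<turnstile> IsType (App (Inl A) (map (Var \<circ> fst) \<Gamma>))))"

definition introduces_term :: "'k \<Rightarrow> ('k + 'k) jdg \<Rightarrow> bool" where
  "introduces_term f J \<longleftrightarrow> (\<exists>\<Gamma> T. J = (\<Gamma> \<turnstile> HasType (App (Inr f) (map (Var \<circ> fst) \<Gamma>)) T))"

definition is_gat :: "'k gat \<Rightarrow> bool" where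
  "is_gat T \<longleftrightarrow>
     (\<forall>J \<in> basic T. distinct (map fst (ctx J)) \<and>
        set_jdg J \<subseteq> Inl ` tyconsts T \<union> Inr ` tmconsts T) \<and>
     (\<forall>A \<in> tyconsts T. \<exists>!J. J \<in> basic T \<and> introduces_type A J) \<and>
     (\<forall>f \<in> tmconsts T. \<exists>!J. J \<in> basic T \<and> introduces_term f J) \<and>
     (\<forall>J \<in> basic T. (\<exists>A \<in> tyconsts T. introduces_type A J) \<or>
        (\<exists>f \<in> tmconsts T. introduces_term f J) \<or>
        \<not> is_type_jdg J \<and> \<not> is_term_jdg J) \<and>
     basic T \<subseteq> derived T"

definition interpretation_of ::
  "'k gat \<Rightarrow> 'k gat \<Rightarrow> (('k + 'k) jdg \<Rightarrow> ('k + 'k) jdg) \<Rightarrow> bool" where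
  "interpretation_of T U \<phi> \<longleftrightarrow>
     \<phi> \<in> derived T \<rightarrow>\<^sub>E derived U \<and>
     (\<forall>J \<in> derived T. boundary (\<phi> J) = map \<phi> (boundary J)) \<and>
     (\<forall>r Js J J'. set Js \<subseteq> derived T \<and> deduction r Js J \<and> deduction r (map \<phi> Js) J' \<longrightarrow>
        \<phi> J = J')"

inductive jdg_equiv :: "'k gat \<Rightarrow> ('k + 'k) jdg \<Rightarrow> ('k + 'k) jdg \<Rightarrow> bool" for T :: "'k gat" where
  equiv_type:
  "\<lbrakk>(\<Gamma> \<turnstile> IsType S) \<in> derived T; (\<Gamma>' \<turnstile> IsType S') \<in> derived T; length \<Gamma> = length \<Gamma>';
    \<forall>i \<le> length \<Gamma>.
      (take i \<Gamma> \<turnstile> TypeEq ((map snd \<Gamma> @ [S]) ! i)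
        (var_subst (map fst (take i \<Gamma>)) (map fst (take i \<Gamma>')) ((map snd \<Gamma>' @ [S']) ! i)))
      \<in> derived T\<rbrakk>
   \<Longrightarrow> jdg_equiv T (\<Gamma> \<turnstile> IsType S) (\<Gamma>' \<turnstile> IsType S')"
| equiv_term:
  "\<lbrakk>(\<Gamma> \<turnstile> HasType s S) \<in> derived T; (\<Gamma>' \<turnstile> HasType t S') \<in> derived T;
    jdg_equiv T (\<Gamma> \<turnstile> IsType S) (\<Gamma>' \<turnstile> IsType S');
    (\<Gamma> \<turnstile> TermEq s (var_subst (map fst \<Gamma>) (map fst \<Gamma>') t) S) \<in> derived T\<rbrakk>
   \<Longrightarrow> jdg_equiv T (\<Gamma> \<turnstile> HasType s S) (\<Gamma>' \<turnstile> HasType t S')"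

text \<open>In the presence of arbitrary equality axioms, and without a substitution rule, symmetry and
  transitivity of \<^const>\<open>jdg_equiv\<close> are not evident, so quotients are taken by the equivalence
  relation it generates.\<close>

definition same_class :: "'k gat \<Rightarrow> ('k + 'k) jdg \<Rightarrow> ('k + 'k) jdg \<Rightarrow> bool" where
  "same_class T = equivclp (jdg_equiv T)"

text \<open>\<open>gat_arrow T U \<phi>\<close> is the morphism \<open>T \<rightarrow> U\<close> represented by the interpretation \<open>\<phi>\<close>.\<close>

type_synonym 'k gat_arr = "'k gat \<times> (('k + 'k) jdg \<Rightarrow> ('k + 'k) jdg) set \<times> 'k gat"

definition gat_arrow ::
  "'k gat \<Rightarrow> 'k gat \<Rightarrow> (('k + 'k) jdg \<Rightarrow> ('k + 'k) jdg) \<Rightarrow> 'k gat_arr" where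
  "gat_arrow T U \<phi> =
     (T, {\<psi>. interpretation_of T U \<psi> \<and>
             (\<forall>J \<in> derived T. is_type_jdg J \<or> is_term_jdg J \<longrightarrow> same_class U (\<phi> J) (\<psi> J))}, U)"

definition representative :: "'k gat_arr \<Rightarrow> ('k + 'k) jdg \<Rightarrow> ('k + 'k) jdg" where
  "representative f = (SOME \<phi>. \<phi> \<in> mid f)"

definition gat_cat :: "('k gat, 'k gat_arr) cat" where
  "gat_cat =
     \<lparr>Obj = {T. is_gat T},
      Arr = {gat_arrow T U \<phi> | T U \<phi>. is_gat T \<and> is_gat U \<and> interpretation_of T U \<phi>},
      Dom = (\<lambda>(T, \<Phi>, U). T),
      Cod = (\<lambda>(T, \<Phi>, U). U),
      Id = (\<lambda>T. gat_arrow T T (\<lambda>J \<in> derived T. J)),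
      Comp = (\<lambda>g f. gat_arrow (fst f) (snd (snd g))
                (compose (derived (fst f)) (representative g) (representative f)))\<rparr>"


section \<open>The free-forgetful adjunction\<close>

text \<open>The constants of a theory over the universe \<open>'u\<close> are drawn from \<open>nat \<times> 'u\<close>, so that the
  disjoint unions of the sets \<open>X(n)\<close> and of the sets \<open>X(n\<^sub>t)\<close> can serve as sets of constants.\<close>

type_synonym 'u ugat = "(nat \<times> 'u) gat"
type_synonym 'u ujdg = "((nat \<times> 'u) + (nat \<times> 'u)) jdg"

text \<open>As \<open>'u\<close> is infinite there are no more judgements than elements of \<open>'u\<close>.  Fix an injection;
  an equivalence class of judgements is then represented in \<open>'u\<close> by the code of a chosen member.\<close>

definition code :: "'u ujdg \<Rightarrow> 'u" where
  "code = (SOME c. inj c)"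

text \<open>The next three functions serve only to show that such an injection exists.\<close>

primrec list_code :: "('u \<times> 'u \<Rightarrow> 'u) \<Rightarrow> (nat \<Rightarrow> 'u) \<Rightarrow> 'u list \<Rightarrow> 'u" where
  "list_code p c [] = p (c 0, c 0)"
| "list_code p c (u # us) = p (c 1, p (u, list_code p c us))"

primrec expr_code ::
  "('u \<times> 'u \<Rightarrow> 'u) \<Rightarrow> (nat \<Rightarrow> 'u) \<Rightarrow> ('w \<Rightarrow> 'u) \<Rightarrow> 'w expr \<Rightarrow> 'u" where
  "expr_code p c s (Var x) = p (c 0, c x)"
| "expr_code p c s (App w es) = p (c 1, p (s w, list_code p c (map (expr_code p c s) es)))"

primrec rhs_code :: "('u \<times> 'u \<Rightarrow> 'u) \<Rightarrow> (nat \<Rightarrow> 'u) \<Rightarrow> ('w expr \<Rightarrow> 'u) \<Rightarrow> 'w rhs \<Rightarrow> 'u" where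
  "rhs_code p c e (IsType T) = p (c 0, e T)"
| "rhs_code p c e (HasType t T) = p (c 1, p (e t, e T))"
| "rhs_code p c e (TypeEq T T') = p (c 2, p (e T, e T'))"
| "rhs_code p c e (TermEq t t' T) = p (c 3, p (e t, p (e t', e T)))"

lemma inj_code: "inj (code :: 'u::infinite ujdg \<Rightarrow> 'u)"
proof -
  obtain p :: "'u \<times> 'u \<Rightarrow> 'u" where p: "inj p"
  proof -
    have "\<exists>p. bij_betw p ((UNIV :: 'u set) \<times> (UNIV :: 'u set)) (UNIV :: 'u set)"
      unfolding card_of_ordIso by (rule card_of_Times_same_infinite) (rule infinite_UNIV)
    then show ?thesis
      using that by (auto simp: bij_betw_def)
  qed
  obtain c :: "nat \<Rightarrow> 'u" where c: "inj c"
    using infinite_UNIV infinite_countable_subset by blast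
  have pp: "p x = p y \<longleftrightarrow> x = y" for x y using p by (auto dest: injD)
  have cc: "c x = c y \<longleftrightarrow> x = y" for x y using c by (auto dest: injD)
  have inj_list: "list_code p c us = list_code p c vs \<longleftrightarrow> us = vs" for us vs
  proof (induction us arbitrary: vs)
    case Nil then show ?case by (cases vs) (auto simp: pp cc)
  next
    case (Cons u us) then show ?case by (cases vs) (auto simp: pp cc)
  qed
  define s :: "(nat \<times> 'u) + (nat \<times> 'u) \<Rightarrow> 'u" where
    "s = case_sum (\<lambda>(n, u). p (c 0, p (c n, u))) (\<lambda>(n, u). p (c 1, p (c n, u)))"
  have ss: "s x = s y \<longleftrightarrow> x = y" for x y
    by (auto simp: s_def pp cc split: sum.splits)
  define e where "e = expr_code p c s"
  have ee: "e t = e t' \<longleftrightarrow> t = t'" for t t'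
  proof (induction t arbitrary: t')
    case (Var x) then show ?case by (cases t') (auto simp: e_def pp cc)
  next
    case (App w es)
    have "map e es = map e es' \<longleftrightarrow> es = es'" for es'
    proof
      assume "map e es = map e es'"
      then show "es = es'"
        using App by (auto simp: list_eq_iff_nth_eq map_eq_conv dest: nth_mem)
    qed simp
    then show ?case by (cases t') (auto simp: e_def pp cc ss inj_list)
  qed
  define r where "r = rhs_code p c e"
  have rr: "r t = r t' \<longleftrightarrow> t = t'" for t t'
    by (cases t; cases t') (auto simp: r_def pp cc ee)
  define b where "b = (\<lambda>(x, T). p (c x, e T))"
  have "inj b" by (auto simp: inj_def b_def pp cc ee)
  then have bb: "map b \<Gamma> = map b \<Gamma>' \<longleftrightarrow> \<Gamma> = \<Gamma>'" for \<Gamma> \<Gamma>'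
    by (simp add: inj_map_eq_map)
  have "inj (\<lambda>J. p (list_code p c (map b (ctx J)), r (rhs J)))"
    by (auto simp: inj_def pp inj_list bb rr jdg.expand)
  then show ?thesis unfolding code_def by (rule someI[of inj])
qed

definition class_of :: "'u ugat \<Rightarrow> 'u ujdg \<Rightarrow> 'u" where
  "class_of T J = code (SOME K. same_class T J K)"

definition member :: "'u ugat \<Rightarrow> 'u \<Rightarrow> 'u ujdg" where
  "member T u =
     (SOME J. J \<in> derived T \<and> (is_type_jdg J \<or> is_term_jdg J) \<and> class_of T J = u)"

primrec jdgs_at :: "'k gat \<Rightarrow> hob \<Rightarrow> ('k + 'k) jdg set" where
  "jdgs_at T (Ty n) = {J \<in> derived T. is_type_jdg J \<and> degree J = n}"
| "jdgs_at T (Tm n) = {J \<in> derived T. is_term_jdg J \<and> degree J = n}"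

text \<open>An arrow \<open>a \<rightarrow> b\<close> of \<^const>\<open>H_cat\<close> acts contravariantly, by as many boundaries as it has
  edges.\<close>

definition forget_obj :: "'u ugat \<Rightarrow> 'u psh" where
  "forget_obj T =
     \<lparr>omap = (\<lambda>x \<in> Obj H_cat. class_of T ` jdgs_at T x),
      amap = (\<lambda>(a, es, b) \<in> Arr H_cat.
        (class_of T ` jdgs_at T b,
         \<lambda>u \<in> class_of T ` jdgs_at T b.
           class_of T (((\<lambda>J. hd (boundary J)) ^^ length es) (member T u)),
         class_of T ` jdgs_at T a))\<rparr>"

definition forget_arr :: "(nat \<times> 'u) gat_arr \<Rightarrow> 'u psh_arr" where
  "forget_arr f = (let T = fst f; U = snd (snd f) in
     (forget_obj T,
      \<lambda>x \<in> Obj H_cat.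
        (class_of T ` jdgs_at T x,
         \<lambda>u \<in> class_of T ` jdgs_at T x. class_of U (representative f (member T u)),
         class_of U ` jdgs_at U x),
      forget_obj U))"

definition forget :: "('u ugat, (nat \<times> 'u) gat_arr, 'u psh, 'u psh_arr) fctr" where
  "forget = \<lparr>omap = (\<lambda>T \<in> Obj gat_cat. forget_obj T), amap = (\<lambda>f \<in> Arr gat_cat. forget_arr f)\<rparr>"

text \<open>The context of \<open>J\<^sub>A\<close> for \<open>A \<in> X(n)\<close>, which is also that of \<open>J\<^sub>a\<close> for \<open>\<partial> a = A\<close>; the
  variable \<open>x\<^sub>i\<close> is \<open>i\<close>.\<close>

definition basic_ctx :: "'u psh \<Rightarrow> nat \<Rightarrow> 'u \<Rightarrow> ((nat \<times> 'u) + (nat \<times> 'u)) ctx" where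
  "basic_ctx X n A = map (\<lambda>i. (i, App (Inl (i, ty_bd X i n A)) (map Var [1..<i]))) [1..<n]"

primrec basic_jdg :: "'u psh \<Rightarrow> hob \<Rightarrow> 'u \<Rightarrow> 'u ujdg" where
  "basic_jdg X (Ty n) A = (basic_ctx X n A \<turnstile> IsType (App (Inl (n, A)) (map Var [1..<n])))"
| "basic_jdg X (Tm n) a =
     (basic_ctx X n (tm_bd X n a) \<turnstile>
        HasType (App (Inr (n, a)) (map Var [1..<n]))
                (App (Inl (n, tm_bd X n a)) (map Var [1..<n])))"

definition free_obj :: "'u psh \<Rightarrow> 'u ugat" where
  "free_obj X =
     \<lparr>tyconsts = {(n, A). n \<ge> 1 \<and> A \<in> omap X (Ty n)},
      tmconsts = {(n, a). n \<ge> 1 \<and> a \<in> omap X (Tm n)},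
      basic = {basic_jdg X x u | x u. x \<in> Obj H_cat \<and> u \<in> omap X x}\<rparr>"

text \<open>On arrows, the free functor relabels the constants.\<close>

definition free_arr :: "'u psh_arr \<Rightarrow> (nat \<times> 'u) gat_arr" where
  "free_arr = (\<lambda>(X, \<tau>, Y). gat_arrow (free_obj X) (free_obj Y)
     (\<lambda>J \<in> derived (free_obj X).
        map_jdg (map_sum (\<lambda>(n, A). (n, mid (\<tau> (Ty n)) A)) (\<lambda>(n, a). (n, mid (\<tau> (Tm n)) a))) J))"

definition free :: "('u psh, 'u psh_arr, 'u ugat, (nat \<times> 'u) gat_arr) fctr" where
  "free = \<lparr>omap = (\<lambda>X \<in> Obj psh_cat. free_obj X), amap = (\<lambda>f \<in> Arr psh_cat. free_arr f)\<rparr>"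

definition wp_unit :: "'u psh \<Rightarrow> 'u psh_arr" where
  "wp_unit = (\<lambda>X \<in> Obj psh_cat.
     (X,
      \<lambda>x \<in> Obj H_cat.
        (omap X x, \<lambda>u \<in> omap X x. class_of (free_obj X) (basic_jdg X x u),
         omap (forget_obj (free_obj X)) x),
      forget_obj (free_obj X)))"

text \<open>The counit sends the basic judgement of the class of \<open>J\<close> to \<open>J\<close>, up to the choice of a
  member of the class (which fixes, in particular, the names of the variables).\<close>

definition wp_counit :: "'u ugat \<Rightarrow> (nat \<times> 'u) gat_arr" where
  "wp_counit = (\<lambda>T \<in> Obj gat_cat.
     gat_arrow (free_obj (forget_obj T)) T
       (SOME \<phi>. interpretation_of (free_obj (forget_obj T)) T \<phi> \<and>
          (\<forall>x \<in> Obj H_cat. \<forall>J \<in> jdgs_at T x.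
             same_class T (\<phi> (basic_jdg (forget_obj T) x (class_of T J))) J)))"

definition wp_monad :: "('u psh, 'u psh_arr) monad_data" where
  "wp_monad = induced_monad psh_cat free forget wp_unit wp_counit"

end

theory Submission
  imports Defs
begin

text \<open>Why \<open>P\<close> is strongly cartesian: it is a sum of representables.  In a free theory every derivable
equality is reflexive, so two judgements are equivalent exactly if they differ by a renaming of
variables (\<open>jdg_equiv_iff_alpha\<close>), and an element of \<open>P X\<close> is a judgement in normal form, with
variables \<open>1, 2, \<dots>\<close> (\<open>norm_jdg\<close>).  Weakening and projection give neither exchange nor
contraction.  The arguments of a type \<open>A(ys)\<close> are therefore declared in its context in the order and
with the types prescribed by the basic judgement of \<open>A\<close> (\<open>filter_ok_ctx\<close>), and derivability is a
local syntactic condition (\<open>derived_iff_ok\<close>).  A type judgement of degree \<open>n\<close> amounts to a forest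
on \<open>n\<close> nodes, in which the parent of a node is the last argument of its type, together with a label
in \<open>X(d)\<close> at each node of depth \<open>d\<close>, compatible with boundaries.  A term judgement is such a forest
with, in addition, either an element of \<open>X(d\<^sub>t)\<close> over the label of the last node, or an earlier
node with the same parent and label as the last one.  So \<open>P X\<close> is a sum over shapes, each summand
being the set of maps into \<open>X\<close> from the structure formed by the nodes of the shape; a variable
identifies two nodes.

A map \<open>\<alpha>: Z \<rightarrow> P X\<close> assigns a labelled shape to each element of \<open>Z\<close>.  Gluing the shapes along
the boundaries in \<open>Z\<close> gives a structure \<open>L\<close>, the original labels give a map \<open>L \<rightarrow> X\<close>, and labelling
each node by itself gives \<open>Z \<rightarrow> P L\<close>.  This factorisation of \<open>\<alpha>\<close> is initial
(\<open>generic_factorisation_exists\<close>).  Such factorisations are universal arrows for the slice functors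
of \<open>P\<close>, which makes \<open>P\<close> a local right adjoint, and they also yield the preservation of pullbacks.

The naturality squares of the unit and the multiplication are pullbacks because maps of structures
change labels only and leave shapes alone.  The unit has the basic judgements as its values, and these
are recognised by their shape (\<open>ok_full_context\<close>).  The multiplication replaces each label by the
expression that it stands for; given the shape, the labels can be read off from the result
(\<open>relift_unique\<close>), and they can be lifted along \<open>P f\<close> whenever the result lifts along \<open>f\<close>
(\<open>relift_ctx\<close>, \<open>relift_rhs\<close>).

The forgetful functor works with chosen representatives of morphisms, and the counit is a chosen
interpretation.  The choices are immaterial since an interpretation is determined by its values on the
basic judgements (\<open>interpretation_unique\<close>).  Hence \<open>P f\<close> and the multiplication are given by
translations of expressions, and naturality and the monad laws become identities between
translations.\<close>


section \<open>Universal arrows and generic factorisations\<close>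

lemma homI: "f \<in> Arr C \<Longrightarrow> Dom C f = a \<Longrightarrow> Cod C f = b \<Longrightarrow> f \<in> hom C a b"
  by (simp add: hom_def)

lemma homD: "f \<in> hom C a b \<Longrightarrow> f \<in> Arr C \<and> Dom C f = a \<and> Cod C f = b"
  by (simp add: hom_def)

lemma category_dom_cod: "category C \<Longrightarrow> f \<in> hom C a b \<Longrightarrow> a \<in> Obj C \<and> b \<in> Obj C"
  by (auto simp: category_def hom_def)

lemma category_id: "category C \<Longrightarrow> a \<in> Obj C \<Longrightarrow> Id C a \<in> hom C a a"
  by (simp add: category_def)

lemma category_comp:
  "category C \<Longrightarrow> f \<in> hom C a b \<Longrightarrow> g \<in> hom C b c \<Longrightarrow> Comp C g f \<in> hom C a c"
  by (simp add: category_def hom_def)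

lemma category_id_right: "category C \<Longrightarrow> f \<in> hom C a b \<Longrightarrow> Comp C f (Id C a) = f"
  unfolding category_def by (auto dest: homD)

lemma category_id_left: "category C \<Longrightarrow> f \<in> hom C a b \<Longrightarrow> Comp C (Id C b) f = f"
  unfolding category_def by (auto dest: homD)

lemma category_assoc:
  "category C \<Longrightarrow> f \<in> hom C a b \<Longrightarrow> g \<in> hom C b c \<Longrightarrow> h \<in> hom C c d \<Longrightarrow>
    Comp C h (Comp C g f) = Comp C (Comp C h g) f"
  by (simp add: category_def hom_def)

lemma functor_categories: "is_functor C D F \<Longrightarrow> category C \<and> category D"
  by (simp add: is_functor_def)

lemma functor_obj: "is_functor C D F \<Longrightarrow> a \<in> Obj C \<Longrightarrow> omap F a \<in> Obj D"
  by (auto simp: is_functor_def)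

lemma functor_hom:
  "is_functor C D F \<Longrightarrow> f \<in> hom C a b \<Longrightarrow> amap F f \<in> hom D (omap F a) (omap F b)"
  by (auto simp: is_functor_def dest!: homD)

lemma functor_id: "is_functor C D F \<Longrightarrow> a \<in> Obj C \<Longrightarrow> amap F (Id C a) = Id D (omap F a)"
  by (auto simp: is_functor_def)

lemma functor_comp:
  "is_functor C D F \<Longrightarrow> f \<in> hom C a b \<Longrightarrow> g \<in> hom C b c \<Longrightarrow>
    amap F (Comp C g f) = Comp D (amap F g) (amap F f)"
  by (auto simp: is_functor_def dest!: homD)

lemma is_functorI:
  assumes "category C" "category D"
    and "omap F \<in> extensional (Obj C)" "amap F \<in> extensional (Arr C)"
    and "\<And>a. a \<in> Obj C \<Longrightarrow> omap F a \<in> Obj D"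
    and "\<And>f a b. f \<in> hom C a b \<Longrightarrow> amap F f \<in> hom D (omap F a) (omap F b)"
    and "\<And>a. a \<in> Obj C \<Longrightarrow> amap F (Id C a) = Id D (omap F a)"
    and "\<And>f g a b c. f \<in> hom C a b \<Longrightarrow> g \<in> hom C b c \<Longrightarrow>
      amap F (Comp C g f) = Comp D (amap F g) (amap F f)"
  shows "is_functor C D F"
proof -
  have am: "amap F f \<in> hom D (omap F (Dom C f)) (omap F (Cod C f))" if "f \<in> Arr C" for f
    using assms(6)[of f "Dom C f" "Cod C f"] that by (simp add: hom_def)
  show ?thesis
    unfolding is_functor_def
  proof (intro conjI ballI impI)
    show "omap F \<in> Obj C \<rightarrow>\<^sub>E Obj D" using assms(3,5) by (simp add: PiE_iff)
    show "amap F \<in> Arr C \<rightarrow>\<^sub>E Arr D" using assms(4) am by (simp add: PiE_iff hom_def)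
    show "amap F (Comp C g f) = Comp D (amap F g) (amap F f)"
      if "f \<in> Arr C" "g \<in> Arr C" "Cod C f = Dom C g" for f g
      using assms(8)[of f "Dom C f" "Dom C g" g "Cod C g"] that by (simp add: hom_def)
  qed (use assms am in simp_all)
qed

lemma functor_id_fctr: "category C \<Longrightarrow> is_functor C C (id_fctr C)"
  by (intro is_functorI) (auto simp: id_fctr_def hom_def category_def)

lemma functor_comp_fctr:
  assumes F: "is_functor C D F" and G: "is_functor D E G"
  shows "is_functor C E (comp_fctr C G F)"
proof -
  have C: "category C" using F by (simp add: functor_categories)
  have om: "omap (comp_fctr C G F) a = omap G (omap F a)" if "a \<in> Obj C" for a
    using that by (simp add: comp_fctr_def compose_def)
  have am: "amap (comp_fctr C G F) f = amap G (amap F f)" if "f \<in> hom C a b" for f a b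
    using that by (simp add: comp_fctr_def compose_def hom_def)
  show ?thesis
  proof (rule is_functorI)
    show "category C" "category E" using F G by (auto dest: functor_categories)
    show "omap (comp_fctr C G F) \<in> extensional (Obj C)"
      "amap (comp_fctr C G F) \<in> extensional (Arr C)"
      by (simp_all add: comp_fctr_def)
    show "omap (comp_fctr C G F) a \<in> Obj E" if "a \<in> Obj C" for a
      using that by (simp add: om functor_obj[OF F] functor_obj[OF G])
    show "amap (comp_fctr C G F) f \<in> hom E (omap (comp_fctr C G F) a) (omap (comp_fctr C G F) b)"
      if "f \<in> hom C a b" for f a b
      using functor_hom[OF G functor_hom[OF F that]] category_dom_cod[OF C that]
      by (simp add: om am[OF that])
    show "amap (comp_fctr C G F) (Id C a) = Id E (omap (comp_fctr C G F) a)" if "a \<in> Obj C" for a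
      by (simp add: om[OF that] am[OF category_id[OF C that]] functor_id[OF F that]
          functor_id[OF G] functor_obj[OF F that])
    show "amap (comp_fctr C G F) (Comp C g f) =
        Comp E (amap (comp_fctr C G F) g) (amap (comp_fctr C G F) f)"
      if f: "f \<in> hom C a b" and g: "g \<in> hom C b c" for f g a b c
      using functor_comp[OF G functor_hom[OF F f] functor_hom[OF F g]]
      by (simp add: am[OF category_comp[OF C f g]] am[OF f] am[OF g] functor_comp[OF F f g])
  qed
qed

text \<open>The left adjoint sends an arrow to the unique solution of the universal problem for its composite with
the universal arrow.  All equations between arrows out of \<open>l a\<close> are checked after composition with
\<open>e a\<close>.\<close>

lemma right_adjoint_if_universal_arrows:
  assumes R: "is_functor D C R"
    and univ: "\<And>a. a \<in> Obj C \<Longrightarrow> \<exists>b \<in> Obj D. \<exists>e \<in> hom C a (omap R b).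
      \<forall>d \<in> Obj D. \<forall>g \<in> hom C a (omap R d). \<exists>!h. h \<in> hom D b d \<and> Comp C (amap R h) e = g"
  shows "is_right_adjoint D C R"
proof -
  have C: "category C" and D: "category D" using functor_categories[OF R] by auto
  obtain l e where l: "\<And>a. a \<in> Obj C \<Longrightarrow> l a \<in> Obj D"
    and e: "\<And>a. a \<in> Obj C \<Longrightarrow> e a \<in> hom C a (omap R (l a))"
    and u: "\<And>a d g. a \<in> Obj C \<Longrightarrow> d \<in> Obj D \<Longrightarrow> g \<in> hom C a (omap R d) \<Longrightarrow>
      \<exists>!h. h \<in> hom D (l a) d \<and> Comp C (amap R h) (e a) = g"
    using univ by metis
  define ext where "ext a d g = (THE h. h \<in> hom D (l a) d \<and> Comp C (amap R h) (e a) = g)"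
    for a d g
  have ext: "ext a d g \<in> hom D (l a) d \<and> Comp C (amap R (ext a d g)) (e a) = g"
    if "a \<in> Obj C" "d \<in> Obj D" "g \<in> hom C a (omap R d)" for a d g
    unfolding ext_def by (rule theI'[OF u[OF that]])
  have ext_hom: "ext a d g \<in> hom D (l a) d"
    if "a \<in> Obj C" "d \<in> Obj D" "g \<in> hom C a (omap R d)" for a d g
    using ext[OF that] by simp
  have eqI: "h = h'" if a: "a \<in> Obj C" and h: "h \<in> hom D (l a) d" "h' \<in> hom D (l a) d"
    and eq: "Comp C (amap R h) (e a) = Comp C (amap R h') (e a)" for a d h h'
  proof -
    have d: "d \<in> Obj D" using category_dom_cod[OF D h(1)] by simp
    have "Comp C (amap R h) (e a) \<in> hom C a (omap R d)"
      by (rule category_comp[OF C e[OF a] functor_hom[OF R h(1)]])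
    from u[OF a d this] h eq show ?thesis by auto
  qed
  define L where "L = \<lparr>omap = (\<lambda>a \<in> Obj C. l a),
    amap = (\<lambda>f \<in> Arr C. ext (Dom C f) (l (Cod C f)) (Comp C (e (Cod C f)) f))\<rparr>"
  have L_obj: "omap L a = l a" if "a \<in> Obj C" for a using that by (simp add: L_def)
  have L_arr: "amap L f = ext a (l b) (Comp C (e b) f)" if "f \<in> hom C a b" for f a b
    using that by (simp add: L_def hom_def)
  have ef: "Comp C (e b) f \<in> hom C a (omap R (l b))" if f: "f \<in> hom C a b" for f a b
    using category_comp[OF C f e] category_dom_cod[OF C f] by simp
  have L_hom: "amap L f \<in> hom D (l a) (l b)"
    and L_e: "Comp C (amap R (amap L f)) (e a) = Comp C (e b) f" if f: "f \<in> hom C a b" for f a b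
    using ext[OF _ _ ef[OF f]] category_dom_cod[OF C f] l by (auto simp: L_arr[OF f])
  have R_comp_e: "Comp C (amap R (Comp D k h)) (e a) = Comp C (amap R k) (Comp C (amap R h) (e a))"
    if "a \<in> Obj C" "h \<in> hom D (l a) d" "k \<in> hom D d d'" for a d d' h k
    using category_assoc[OF C e[OF that(1)] functor_hom[OF R that(2)] functor_hom[OF R that(3)]]
    by (simp add: functor_comp[OF R that(2,3)])
  have functor_L: "is_functor C D L"
  proof (rule is_functorI)
    show "amap L f \<in> hom D (omap L a) (omap L b)" if "f \<in> hom C a b" for f a b
      using L_hom[OF that] category_dom_cod[OF C that] by (simp add: L_obj)
    show "amap L (Id C a) = Id D (omap L a)" if a: "a \<in> Obj C" for a
    proof -
      have "amap L (Id C a) = Id D (l a)"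
      proof (rule eqI[OF a L_hom[OF category_id[OF C a]] category_id[OF D l[OF a]]])
        show "Comp C (amap R (amap L (Id C a))) (e a) = Comp C (amap R (Id D (l a))) (e a)"
          unfolding L_e[OF category_id[OF C a]] functor_id[OF R l[OF a]]
          by (simp add: category_id_left[OF C e[OF a]] category_id_right[OF C e[OF a]])
      qed
      then show ?thesis by (simp add: L_obj[OF a])
    qed
    show "amap L (Comp C g f) = Comp D (amap L g) (amap L f)"
      if f: "f \<in> hom C a b" and g: "g \<in> hom C b c" for f g a b c
    proof -
      have a: "a \<in> Obj C" and b: "b \<in> Obj C" and c: "c \<in> Obj C"
        using category_dom_cod[OF C f] category_dom_cod[OF C g] by auto
      note gf = category_comp[OF C f g]
      show ?thesis
      proof (rule eqI[OF a L_hom[OF gf] category_comp[OF D L_hom[OF f] L_hom[OF g]]])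
        have "Comp C (amap R (Comp D (amap L g) (amap L f))) (e a) =
            Comp C (amap R (amap L g)) (Comp C (e b) f)"
          by (simp add: R_comp_e[OF a L_hom[OF f] L_hom[OF g]] L_e[OF f])
        also have "\<dots> = Comp C (Comp C (amap R (amap L g)) (e b)) f"
          by (rule category_assoc[OF C f e[OF b] functor_hom[OF R L_hom[OF g]]])
        also have "\<dots> = Comp C (e c) (Comp C g f)"
          by (simp add: L_e[OF g] category_assoc[OF C f g e[OF c]])
        finally show "Comp C (amap R (amap L (Comp C g f))) (e a) =
            Comp C (amap R (Comp D (amap L g) (amap L f))) (e a)"
          by (simp add: L_e[OF gf])
      qed
    qed
  qed (auto simp: C D L_def l)
  define \<eta> where "\<eta> = (\<lambda>a \<in> Obj C. e a)"
  define \<epsilon> where "\<epsilon> = (\<lambda>b \<in> Obj D. ext (omap R b) b (Id C (omap R b)))"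
  note R_obj = functor_obj[OF R]
  have \<epsilon>_hom: "\<epsilon> b \<in> hom D (l (omap R b)) b"
    and \<epsilon>_e: "Comp C (amap R (\<epsilon> b)) (e (omap R b)) = Id C (omap R b)" if b: "b \<in> Obj D" for b
    using ext[OF R_obj[OF b] b category_id[OF C R_obj[OF b]]] b by (auto simp: \<epsilon>_def)
  have nat_\<eta>: "nat_trans C C (id_fctr C) (comp_fctr C R L) \<eta>"
    unfolding nat_trans_def
  proof (intro conjI ballI)
    show "\<eta> a \<in> hom C (omap (id_fctr C) a) (omap (comp_fctr C R L) a)" if "a \<in> Obj C" for a
      using that e[OF that] by (simp add: \<eta>_def id_fctr_def comp_fctr_def compose_def L_obj)
    show "Comp C (amap (comp_fctr C R L) f) (\<eta> (Dom C f)) =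
      Comp C (\<eta> (Cod C f)) (amap (id_fctr C) f)" if f: "f \<in> Arr C" for f
    proof -
      have fh: "f \<in> hom C (Dom C f) (Cod C f)" using f by (simp add: hom_def)
      then show ?thesis using L_e[OF fh] category_dom_cod[OF C fh] f
        by (simp add: \<eta>_def id_fctr_def comp_fctr_def compose_def)
    qed
  qed (use functor_id_fctr[OF C] functor_comp_fctr[OF functor_L R] in \<open>auto simp: \<eta>_def\<close>)
  have nat_\<epsilon>: "nat_trans D D (comp_fctr D L R) (id_fctr D) \<epsilon>"
    unfolding nat_trans_def
  proof (intro conjI ballI)
    show "\<epsilon> b \<in> hom D (omap (comp_fctr D L R) b) (omap (id_fctr D) b)" if "b \<in> Obj D" for b
      using that \<epsilon>_hom[OF that] by (simp add: id_fctr_def comp_fctr_def compose_def L_obj R_obj)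
    show "Comp D (amap (id_fctr D) f) (\<epsilon> (Dom D f)) =
      Comp D (\<epsilon> (Cod D f)) (amap (comp_fctr D L R) f)" if f: "f \<in> Arr D" for f
    proof -
      define a b where "a = Dom D f" and "b = Cod D f"
      have fh: "f \<in> hom D a b" using f by (simp add: hom_def a_def b_def)
      have a: "a \<in> Obj D" and b: "b \<in> Obj D" using category_dom_cod[OF D fh] by auto
      note Rf = functor_hom[OF R fh]
      have "Comp D f (\<epsilon> a) = Comp D (\<epsilon> b) (amap L (amap R f))"
      proof (rule eqI[OF R_obj[OF a] category_comp[OF D \<epsilon>_hom[OF a] fh]
            category_comp[OF D L_hom[OF Rf] \<epsilon>_hom[OF b]]])
        have "Comp C (amap R (Comp D (\<epsilon> b) (amap L (amap R f)))) (e (omap R a)) =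
            Comp C (amap R (\<epsilon> b)) (Comp C (e (omap R b)) (amap R f))"
          by (simp add: R_comp_e[OF R_obj[OF a] L_hom[OF Rf] \<epsilon>_hom[OF b]] L_e[OF Rf])
        also have "\<dots> = amap R f"
          by (simp add: category_assoc[OF C Rf e[OF R_obj[OF b]] functor_hom[OF R \<epsilon>_hom[OF b]]]
              \<epsilon>_e[OF b] category_id_left[OF C Rf])
        finally show "Comp C (amap R (Comp D f (\<epsilon> a))) (e (omap R a)) =
            Comp C (amap R (Comp D (\<epsilon> b) (amap L (amap R f)))) (e (omap R a))"
          by (simp add: R_comp_e[OF R_obj[OF a] \<epsilon>_hom[OF a] fh] \<epsilon>_e[OF a]
              category_id_right[OF C Rf])
      qed
      then show ?thesis using f by (simp add: id_fctr_def comp_fctr_def compose_def a_def b_def)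
    qed
  qed (use functor_id_fctr[OF D] functor_comp_fctr[OF R functor_L] in \<open>auto simp: \<epsilon>_def\<close>)
  have tri1: "Comp D (\<epsilon> (omap L a)) (amap L (\<eta> a)) = Id D (omap L a)" if a: "a \<in> Obj C" for a
  proof -
    note ea = e[OF a] and la = l[OF a]
    have "Comp D (\<epsilon> (l a)) (amap L (e a)) = Id D (l a)"
    proof (rule eqI[OF a category_comp[OF D L_hom[OF ea] \<epsilon>_hom[OF la]] category_id[OF D la]])
      have "Comp C (amap R (Comp D (\<epsilon> (l a)) (amap L (e a)))) (e a) =
          Comp C (amap R (\<epsilon> (l a))) (Comp C (e (omap R (l a))) (e a))"
        by (simp add: R_comp_e[OF a L_hom[OF ea] \<epsilon>_hom[OF la]] L_e[OF ea])
      also have "\<dots> = e a"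
        by (simp add: category_assoc[OF C ea e[OF R_obj[OF la]] functor_hom[OF R \<epsilon>_hom[OF la]]]
            \<epsilon>_e[OF la] category_id_left[OF C ea])
      finally show "Comp C (amap R (Comp D (\<epsilon> (l a)) (amap L (e a)))) (e a) =
          Comp C (amap R (Id D (l a))) (e a)"
        by (simp add: functor_id[OF R la] category_id_left[OF C ea])
    qed
    then show ?thesis using a by (simp add: L_obj \<eta>_def)
  qed
  have tri2: "Comp C (amap R (\<epsilon> b)) (\<eta> (omap R b)) = Id C (omap R b)" if b: "b \<in> Obj D" for b
    using \<epsilon>_e[OF b] R_obj[OF b] by (simp add: \<eta>_def)
  have "adjunction C D L R \<eta> \<epsilon>"
    unfolding adjunction_def using functor_L R nat_\<eta> nat_\<epsilon> tri1 tri2 by blast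
  then show ?thesis unfolding is_right_adjoint_def by blast
qed

text \<open>A factorisation \<open>\<alpha> = F \<beta> \<circ> e\<close> is generic if it is initial among the factorisations of \<open>\<alpha>\<close> over
\<open>X\<close>; then \<open>e\<close> is a universal arrow from \<open>\<alpha>\<close> to the slice functor \<open>F/X\<close>.\<close>

definition generic_factorisation :: "('o, 'm) cat \<Rightarrow> ('p, 'n) cat \<Rightarrow> ('o, 'm, 'p, 'n) fctr \<Rightarrow>
    'o \<Rightarrow> 'n \<Rightarrow> 'm \<Rightarrow> 'n \<Rightarrow> bool" where
  "generic_factorisation C D F X \<alpha> \<beta> e \<longleftrightarrow>
     \<beta> \<in> hom C (Dom C \<beta>) X \<and> e \<in> hom D (Dom D \<alpha>) (omap F (Dom C \<beta>)) \<and>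
     Comp D (amap F \<beta>) e = \<alpha> \<and>
     (\<forall>W \<gamma> g. \<gamma> \<in> hom C W X \<longrightarrow> g \<in> hom D (Dom D \<alpha>) (omap F W) \<longrightarrow> Comp D (amap F \<gamma>) g = \<alpha> \<longrightarrow>
        (\<exists>!h. h \<in> hom C (Dom C \<beta>) W \<and> Comp C \<gamma> h = \<beta> \<and> Comp D (amap F h) e = g))"

definition has_generic_factorisations ::
  "('o, 'm) cat \<Rightarrow> ('p, 'n) cat \<Rightarrow> ('o, 'm, 'p, 'n) fctr \<Rightarrow> bool" where
  "has_generic_factorisations C D F \<longleftrightarrow>
     (\<forall>X \<in> Obj C. \<forall>\<alpha> \<in> Arr D. Cod D \<alpha> = omap F X \<longrightarrow>
        (\<exists>\<beta> e. generic_factorisation C D F X \<alpha> \<beta> e))"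

lemma slice_cat_simps:
  "Obj (slice_cat C X) = {f \<in> Arr C. Cod C f = X}"
  "(f, h, g) \<in> Arr (slice_cat C X) \<longleftrightarrow> f \<in> Arr C \<and> g \<in> Arr C \<and> Cod C f = X \<and> Cod C g = X \<and>
     h \<in> hom C (Dom C f) (Dom C g) \<and> Comp C g h = f"
  "Dom (slice_cat C X) (f, h, g) = f"
  "Cod (slice_cat C X) (f, h, g) = g"
  "Id (slice_cat C X) f = (f, Id C (Dom C f), f)"
  "Comp (slice_cat C X) (f'', h', g') (f', h, g) = (f', Comp C h' h, g')"
  by (simp_all add: slice_cat_def)

lemma slice_hom:
  "k \<in> hom (slice_cat C X) f g \<longleftrightarrow> (\<exists>h. k = (f, h, g) \<and> f \<in> hom C (Dom C f) X \<and>
     g \<in> hom C (Dom C g) X \<and> h \<in> hom C (Dom C f) (Dom C g) \<and> Comp C g h = f)"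
  by (cases k) (auto simp: hom_def slice_cat_simps)

lemma category_slice:
  assumes C: "category C"
  shows "category (slice_cat C X)"
  unfolding category_def
proof (intro conjI ballI impI)
  note H = homI[OF _ refl refl]
  show "Dom (slice_cat C X) k \<in> Obj (slice_cat C X)" "Cod (slice_cat C X) k \<in> Obj (slice_cat C X)"
    if "k \<in> Arr (slice_cat C X)" for k
    using that by (cases k; auto simp: slice_cat_simps)+
  show "Id (slice_cat C X) f \<in> hom (slice_cat C X) f f" if "f \<in> Obj (slice_cat C X)" for f
    using that category_id[OF C] category_id_right[OF C H] category_dom_cod[OF C H]
    by (auto simp: slice_hom slice_cat_simps hom_def)
  show "Comp (slice_cat C X) k' k \<in> hom (slice_cat C X) (Dom (slice_cat C X) k) (Cod (slice_cat C X) k')"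
    if kk: "k \<in> Arr (slice_cat C X)" "k' \<in> Arr (slice_cat C X)"
      "Cod (slice_cat C X) k = Dom (slice_cat C X) k'" for k k'
  proof -
    obtain f h g h' g' where k: "k = (f, h, g)" "k' = (g, h', g')"
      using kk(3) by (cases k; cases k') (auto simp: slice_cat_simps)
    show ?thesis
      using kk category_comp[OF C, of h "Dom C f" "Dom C g" h' "Dom C g'"]
        category_assoc[OF C, of h "Dom C f" "Dom C g" h' "Dom C g'" g' X]
      by (auto simp: k slice_hom slice_cat_simps) (auto simp: hom_def)
  qed
  show "Comp (slice_cat C X) k (Id (slice_cat C X) (Dom (slice_cat C X) k)) = k"
    "Comp (slice_cat C X) (Id (slice_cat C X) (Cod (slice_cat C X) k)) k = k"
    if "k \<in> Arr (slice_cat C X)" for k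
    using that category_id_right[OF C] category_id_left[OF C]
    by (cases k; auto simp: slice_cat_simps)+
  show "Comp (slice_cat C X) k'' (Comp (slice_cat C X) k' k) =
      Comp (slice_cat C X) (Comp (slice_cat C X) k'' k') k"
    if "k \<in> Arr (slice_cat C X)" "k' \<in> Arr (slice_cat C X)" "k'' \<in> Arr (slice_cat C X)"
      "Cod (slice_cat C X) k = Dom (slice_cat C X) k' \<and>
       Cod (slice_cat C X) k' = Dom (slice_cat C X) k''" for k k' k''
    using that category_assoc[OF C]
    by (cases k; cases k'; cases k'') (auto simp: slice_cat_simps)
qed

lemma functor_slice:
  assumes F: "is_functor C D F"
  shows "is_functor (slice_cat C X) (slice_cat D (omap F X)) (slice_fctr C F X)"
proof (rule is_functorI)
  have C: "category C" and D: "category D" using functor_categories[OF F] by auto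
  show "category (slice_cat C X)" "category (slice_cat D (omap F X))"
    by (simp_all add: C D category_slice)
  have om: "omap (slice_fctr C F X) f = amap F f" if "f \<in> hom C a X" for f a
    using that by (simp add: slice_fctr_def slice_cat_simps hom_def)
  have am: "amap (slice_fctr C F X) (f, h, g) = (amap F f, amap F h, amap F g)"
    if "(f, h, g) \<in> hom (slice_cat C X) f' g'" for f h g f' g'
    using that by (simp add: slice_fctr_def hom_def)
  show "omap (slice_fctr C F X) \<in> extensional (Obj (slice_cat C X))"
    "amap (slice_fctr C F X) \<in> extensional (Arr (slice_cat C X))"
    by (simp_all add: slice_fctr_def)
  show "omap (slice_fctr C F X) f \<in> Obj (slice_cat D (omap F X))" if "f \<in> Obj (slice_cat C X)" for f
    using that functor_hom[OF F, of f "Dom C f" X]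
    by (simp add: om[of f "Dom C f"] hom_def slice_cat_simps)
  show "amap (slice_fctr C F X) k \<in>
      hom (slice_cat D (omap F X)) (omap (slice_fctr C F X) f) (omap (slice_fctr C F X) g)"
    if k: "k \<in> hom (slice_cat C X) f g" for k f g
  proof -
    from k obtain h where h: "k = (f, h, g)" "f \<in> hom C (Dom C f) X" "g \<in> hom C (Dom C g) X"
      "h \<in> hom C (Dom C f) (Dom C g)" "Comp C g h = f" unfolding slice_hom by blast
    have Fdom: "Dom D (amap F f) = omap F (Dom C f)" if "f \<in> hom C (Dom C f) X" for f
      using functor_hom[OF F that] by (simp add: hom_def)
    have "amap F f \<in> hom D (omap F (Dom C f)) (omap F X)"
      "amap F g \<in> hom D (omap F (Dom C g)) (omap F X)"
      "amap F h \<in> hom D (omap F (Dom C f)) (omap F (Dom C g))"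
      "Comp D (amap F g) (amap F h) = amap F f"
      using functor_hom[OF F h(2)] functor_hom[OF F h(3)] functor_hom[OF F h(4)]
        functor_comp[OF F h(4,3)] h(5) by auto
    then show ?thesis
      using k by (simp add: slice_hom h(1) am om[OF h(2)] om[OF h(3)] Fdom[OF h(2)] Fdom[OF h(3)])
  qed
  show "amap (slice_fctr C F X) (Id (slice_cat C X) f) =
      Id (slice_cat D (omap F X)) (omap (slice_fctr C F X) f)" if f: "f \<in> Obj (slice_cat C X)" for f
  proof -
    have fh: "f \<in> hom C (Dom C f) X" using f by (simp add: slice_cat_simps hom_def)
    have "Dom D (amap F f) = omap F (Dom C f)" using functor_hom[OF F fh] by (simp add: hom_def)
    then show ?thesis
      using am[of f "Id C (Dom C f)" f f f] category_id[OF category_slice[OF C] f]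
        functor_id[OF F] category_dom_cod[OF C fh]
      by (simp add: slice_cat_simps om[OF fh])
  qed
  show "amap (slice_fctr C F X) (Comp (slice_cat C X) k' k) =
      Comp (slice_cat D (omap F X)) (amap (slice_fctr C F X) k') (amap (slice_fctr C F X) k)"
    if k: "k \<in> hom (slice_cat C X) f g" and k': "k' \<in> hom (slice_cat C X) g g'" for k k' f g g'
  proof -
    from k obtain h where h: "k = (f, h, g)" "h \<in> hom C (Dom C f) (Dom C g)"
      unfolding slice_hom by blast
    from k' obtain h' where h': "k' = (g, h', g')" "h' \<in> hom C (Dom C g) (Dom C g')"
      unfolding slice_hom by blast
    show ?thesis
      using am k k' category_comp[OF category_slice[OF C] k k'] functor_comp[OF F h(2) h'(2)]
      by (simp add: h(1) h'(1) slice_cat_simps)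
  qed
qed

lemma ex1_tuple: "(\<exists>!h. \<exists>h'. h = (a, h', b) \<and> Q h') \<longleftrightarrow> (\<exists>!h'. Q h')"
  by (metis fst_conv snd_conv)

lemma local_right_adjoint_if_generic_factorisations:
  assumes F: "is_functor C D F" and gen: "has_generic_factorisations C D F"
  shows "local_right_adjoint C D F"
  unfolding local_right_adjoint_def
proof (intro conjI ballI F)
  fix X assume X: "X \<in> Obj C"
  have C: "category C" and D: "category D" using functor_categories[OF F] by auto
  show "is_right_adjoint (slice_cat C X) (slice_cat D (omap F X)) (slice_fctr C F X)"
  proof (rule right_adjoint_if_universal_arrows[OF functor_slice[OF F]])
    fix \<alpha> assume "\<alpha> \<in> Obj (slice_cat D (omap F X))"
    then have \<alpha>: "\<alpha> \<in> Arr D" "Cod D \<alpha> = omap F X" by (simp_all add: slice_cat_simps)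
    then obtain \<beta> e where "generic_factorisation C D F X \<alpha> \<beta> e"
      using gen X unfolding has_generic_factorisations_def by blast
    then have \<beta>: "\<beta> \<in> hom C (Dom C \<beta>) X" and e: "e \<in> hom D (Dom D \<alpha>) (omap F (Dom C \<beta>))"
      and fac: "Comp D (amap F \<beta>) e = \<alpha>"
      and uni: "\<And>W \<gamma> g. \<gamma> \<in> hom C W X \<Longrightarrow> g \<in> hom D (Dom D \<alpha>) (omap F W) \<Longrightarrow>
        Comp D (amap F \<gamma>) g = \<alpha> \<Longrightarrow>
        \<exists>!h. h \<in> hom C (Dom C \<beta>) W \<and> Comp C \<gamma> h = \<beta> \<and> Comp D (amap F h) e = g"
      unfolding generic_factorisation_def by blast+
    have om: "omap (slice_fctr C F X) \<gamma> = amap F \<gamma>" if "\<gamma> \<in> hom C W X" for \<gamma> W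
      using that by (simp add: slice_fctr_def slice_cat_simps hom_def)
    have F_dom: "Dom D (amap F \<gamma>) = omap F W" "amap F \<gamma> \<in> hom D (omap F W) (omap F X)"
      if "\<gamma> \<in> hom C W X" for \<gamma> W
      using functor_hom[OF F that] by (simp_all add: hom_def)
    show "\<exists>b \<in> Obj (slice_cat C X). \<exists>e \<in> hom (slice_cat D (omap F X)) \<alpha> (omap (slice_fctr C F X) b).
      \<forall>d \<in> Obj (slice_cat C X). \<forall>g \<in> hom (slice_cat D (omap F X)) \<alpha> (omap (slice_fctr C F X) d).
        \<exists>!h. h \<in> hom (slice_cat C X) b d \<and>
          Comp (slice_cat D (omap F X)) (amap (slice_fctr C F X) h) e = g"
    proof (intro bexI[of _ \<beta>] bexI[of _ "(\<alpha>, e, amap F \<beta>)"] ballI)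
      show "\<beta> \<in> Obj (slice_cat C X)" using \<beta> by (simp add: slice_cat_simps hom_def)
      show "(\<alpha>, e, amap F \<beta>) \<in> hom (slice_cat D (omap F X)) \<alpha> (omap (slice_fctr C F X) \<beta>)"
        using \<alpha> e fac F_dom[OF \<beta>] by (simp add: slice_hom om[OF \<beta>]) (simp add: hom_def)
      fix \<gamma> k assume \<gamma>0: "\<gamma> \<in> Obj (slice_cat C X)"
        and k0: "k \<in> hom (slice_cat D (omap F X)) \<alpha> (omap (slice_fctr C F X) \<gamma>)"
      have \<gamma>: "\<gamma> \<in> hom C (Dom C \<gamma>) X" using \<gamma>0 by (simp add: slice_cat_simps hom_def)
      obtain g where k: "k = (\<alpha>, g, amap F \<gamma>)" and g: "g \<in> hom D (Dom D \<alpha>) (omap F (Dom C \<gamma>))"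
        "Comp D (amap F \<gamma>) g = \<alpha>"
        using k0 F_dom[OF \<gamma>] unfolding slice_hom om[OF \<gamma>] by auto
      have am: "amap (slice_fctr C F X) (\<beta>, h, \<gamma>) = (amap F \<beta>, amap F h, amap F \<gamma>)"
        if "h \<in> hom C (Dom C \<beta>) (Dom C \<gamma>)" "Comp C \<gamma> h = \<beta>" for h
        using that \<beta> \<gamma> by (simp add: slice_fctr_def slice_cat_simps hom_def)
      have "Comp (slice_cat D (omap F X)) (amap (slice_fctr C F X) (\<beta>, h, \<gamma>)) (\<alpha>, e, amap F \<beta>) = k \<longleftrightarrow>
          Comp D (amap F h) e = g"
        if "h \<in> hom C (Dom C \<beta>) (Dom C \<gamma>)" "Comp C \<gamma> h = \<beta>" for h
        by (simp add: am[OF that] slice_cat_simps k)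
      then have hom_iff: "h \<in> hom (slice_cat C X) \<beta> \<gamma> \<and>
          Comp (slice_cat D (omap F X)) (amap (slice_fctr C F X) h) (\<alpha>, e, amap F \<beta>) = k \<longleftrightarrow>
        (\<exists>h'. h = (\<beta>, h', \<gamma>) \<and> h' \<in> hom C (Dom C \<beta>) (Dom C \<gamma>) \<and> Comp C \<gamma> h' = \<beta> \<and>
          Comp D (amap F h') e = g)" for h
        using \<beta> \<gamma> unfolding slice_hom by blast
      show "\<exists>!h. h \<in> hom (slice_cat C X) \<beta> \<gamma> \<and>
          Comp (slice_cat D (omap F X)) (amap (slice_fctr C F X) h) (\<alpha>, e, amap F \<beta>) = k"
        unfolding hom_iff ex1_tuple using uni[OF \<gamma> g] .
    qed
  qed
qed

lemma is_pullbackI: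
  assumes p: "p \<in> hom C V A" and q: "q \<in> hom C V B" and f: "f \<in> hom C A Z" and g: "g \<in> hom C B Z"
    and sq: "Comp C f p = Comp C g q"
    and lift: "\<And>W p' q'. p' \<in> hom C W A \<Longrightarrow> q' \<in> hom C W B \<Longrightarrow> Comp C f p' = Comp C g q' \<Longrightarrow>
      \<exists>!u. u \<in> hom C W V \<and> Comp C p u = p' \<and> Comp C q u = q'"
  shows "is_pullback C p q f g"
  unfolding is_pullback_def
proof (intro conjI ballI impI)
  fix p' q' assume "p' \<in> Arr C" "q' \<in> Arr C" and eq: "Dom C p' = Dom C q' \<and> Cod C p' = Dom C f \<and>
    Cod C q' = Dom C g \<and> Comp C f p' = Comp C g q'"
  then have "p' \<in> hom C (Dom C p') A" "q' \<in> hom C (Dom C p') B" "Dom C p = V"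
    using f g p by (auto simp: hom_def)
  then show "\<exists>!u. u \<in> hom C (Dom C p') (Dom C p) \<and> Comp C p u = p' \<and> Comp C q u = q'"
    using lift eq by simp
qed (use p q f g sq in \<open>auto simp: hom_def\<close>)

text \<open>The two legs of a cone over the image of a cospan \<open>f, g\<close> are factorisations of the same arrow, so
they descend to a cone over \<open>f, g\<close> itself whose vertex is the middle object of a generic
factorisation.\<close>

lemma preserves_pullbacks_if_generic_factorisations:
  assumes F: "is_functor C D F" and gen: "has_generic_factorisations C D F"
  shows "preserves_pullbacks C D F"
  unfolding preserves_pullbacks_def
proof (intro allI impI)
  fix p q f g assume pb: "is_pullback C p q f g"
  have C: "category C" and D: "category D" using functor_categories[OF F] by auto
  define V A B Z where "V = Dom C p" and "A = Dom C f" and "B = Dom C g" and "Z = Cod C f"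
  have p: "p \<in> hom C V A" and q: "q \<in> hom C V B" and f: "f \<in> hom C A Z" and g: "g \<in> hom C B Z"
    and sq: "Comp C f p = Comp C g q"
    using pb by (auto simp: is_pullback_def hom_def V_def A_def B_def Z_def)
  have lift: "\<exists>!u. u \<in> hom C W V \<and> Comp C p u = p' \<and> Comp C q u = q'"
    if "p' \<in> hom C W A" "q' \<in> hom C W B" "Comp C f p' = Comp C g q'" for W p' q'
  proof -
    have "p' \<in> Arr C" "q' \<in> Arr C" "Dom C p' = Dom C q'" "Cod C p' = Dom C f" "Cod C q' = Dom C g"
      "Dom C p' = W"
      using that by (auto simp: hom_def A_def B_def)
    with pb that(3) show ?thesis unfolding is_pullback_def V_def by blast
  qed
  note Fp = functor_hom[OF F p] and Fq = functor_hom[OF F q]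
    and Ff = functor_hom[OF F f] and Fg = functor_hom[OF F g]
  have F_sq: "Comp D (amap F f) (amap F p) = Comp D (amap F g) (amap F q)"
    using sq by (simp flip: functor_comp[OF F p f] functor_comp[OF F q g])
  have "\<exists>!u. u \<in> hom D W (omap F V) \<and> Comp D (amap F p) u = p' \<and> Comp D (amap F q) u = q'"
    if p': "p' \<in> hom D W (omap F A)" and q': "q' \<in> hom D W (omap F B)"
      and eq: "Comp D (amap F f) p' = Comp D (amap F g) q'" for W p' q'
  proof -
    define \<alpha> where "\<alpha> = Comp D (amap F f) p'"
    have \<alpha>: "\<alpha> \<in> hom D W (omap F Z)" unfolding \<alpha>_def by (rule category_comp[OF D p' Ff])
    then have \<alpha>': "\<alpha> \<in> Arr D" "Cod D \<alpha> = omap F Z" "Dom D \<alpha> = W" by (simp_all add: hom_def)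
    have "Z \<in> Obj C" using category_dom_cod[OF C f] by simp
    then obtain \<beta> e where gf: "generic_factorisation C D F Z \<alpha> \<beta> e"
      using gen \<alpha>'(1,2) unfolding has_generic_factorisations_def by blast
    define L where "L = Dom C \<beta>"
    have \<beta>: "\<beta> \<in> hom C L Z" and e: "e \<in> hom D W (omap F L)"
      and fac: "Comp D (amap F \<beta>) e = \<alpha>"
      using gf by (simp_all add: generic_factorisation_def L_def \<alpha>'(3))
    have uni: "\<exists>!h. h \<in> hom C L W' \<and> Comp C \<gamma> h = \<beta> \<and> Comp D (amap F h) e = g"
      if "\<gamma> \<in> hom C W' Z" "g \<in> hom D W (omap F W')" "Comp D (amap F \<gamma>) g = \<alpha>" for W' \<gamma> g
      using gf that unfolding generic_factorisation_def \<alpha>'(3) L_def by blast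
    have q\<alpha>: "Comp D (amap F g) q' = \<alpha>" by (simp add: \<alpha>_def eq)
    obtain h1 where h1: "h1 \<in> hom C L A" "Comp C f h1 = \<beta>" "Comp D (amap F h1) e = p'"
      using uni[OF f p' \<alpha>_def[symmetric]] by blast
    obtain h2 where h2: "h2 \<in> hom C L B" "Comp C g h2 = \<beta>" "Comp D (amap F h2) e = q'"
      using uni[OF g q' q\<alpha>] by blast
    obtain u where u: "u \<in> hom C L V" "Comp C p u = h1" "Comp C q u = h2"
      using lift[OF h1(1) h2(1)] h1(2) h2(2) by metis
    have F_comp_e: "Comp D (amap F r) (Comp D (amap F v) e) = Comp D (amap F (Comp C r v)) e"
      if "v \<in> hom C L M" "r \<in> hom C M N" for v r M N
      using category_assoc[OF D e functor_hom[OF F that(1)] functor_hom[OF F that(2)]]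
      by (simp add: functor_comp[OF F that])
    show ?thesis
    proof (rule ex1I[of _ "Comp D (amap F u) e"], intro conjI)
      show "Comp D (amap F u) e \<in> hom D W (omap F V)"
        by (rule category_comp[OF D e functor_hom[OF F u(1)]])
      show "Comp D (amap F p) (Comp D (amap F u) e) = p'"
        "Comp D (amap F q) (Comp D (amap F u) e) = q'"
        by (simp_all add: F_comp_e[OF u(1) p] F_comp_e[OF u(1) q] u h1 h2)
      fix v assume v: "v \<in> hom D W (omap F V) \<and> Comp D (amap F p) v = p' \<and> Comp D (amap F q) v = q'"
      then have vh: "v \<in> hom D W (omap F V)" by simp
      note fp = category_comp[OF C p f]
      have "Comp D (amap F (Comp C f p)) v = \<alpha>"
        using v category_assoc[OF D vh Fp Ff] by (simp add: \<alpha>_def functor_comp[OF F p f])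
      then obtain w where w: "w \<in> hom C L V" "Comp C (Comp C f p) w = \<beta>" "Comp D (amap F w) e = v"
        using uni[OF fp vh] by blast
      \<comment> \<open>Since \<open>v\<close> also factorises \<open>\<alpha>\<close>, it arises from some \<open>w\<close>, and the two legs of \<open>w\<close>
         are forced by the uniqueness of \<open>h1\<close> and \<open>h2\<close>.\<close>
      have "Comp C p w = h1"
      proof -
        have "Comp C p w \<in> hom C L A \<and> Comp C f (Comp C p w) = \<beta> \<and>
            Comp D (amap F (Comp C p w)) e = p'"
          using category_comp[OF C w(1) p] category_assoc[OF C w(1) p f] w(2,3) v
          by (simp flip: F_comp_e[OF w(1) p])
        then show ?thesis using uni[OF f p' \<alpha>_def[symmetric]] h1 by blast
      qed
      moreover have "Comp C q w = h2"
      proof -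
        have "Comp C q w \<in> hom C L B \<and> Comp C g (Comp C q w) = \<beta> \<and>
            Comp D (amap F (Comp C q w)) e = q'"
          using category_comp[OF C w(1) q] category_assoc[OF C w(1) q g] w(2,3) v
          by (simp add: sq flip: F_comp_e[OF w(1) q])
        then show ?thesis using uni[OF g q' q\<alpha>] h2 by blast
      qed
      ultimately have "w = u" using lift[OF h1(1) h2(1)] h1(2) h2(2) w(1) u by metis
      then show "v = Comp D (amap F u) e" using w(3) by simp
    qed
  qed
  then show "is_pullback D (amap F p) (amap F q) (amap F f) (amap F g)"
    using Fp Fq Ff Fg F_sq by (intro is_pullbackI)
qed


section \<open>Type-and-term structures\<close>

lemma is_path_append:
  "is_path E s t a (es @ fs) c \<longleftrightarrow> (\<exists>b. is_path E s t a es b \<and> is_path E s t b fs c)"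
  by (induction es arbitrary: a) auto

lemma category_free_cat:
  assumes "\<And>e. e \<in> E \<Longrightarrow> s e \<in> V \<and> t e \<in> V"
  shows "category (free_cat V E s t)"
  unfolding category_def free_cat_def by (auto simp: hom_def is_path_append)

lemma category_op_cat: "category C \<Longrightarrow> category (op_cat C)"
  unfolding category_def op_cat_def by (auto simp: hom_def)

lemma category_set_cat: "category set_cat"
  unfolding category_def set_cat_def
  by (auto simp: hom_def compose_def intro!: PiE_ext restrict_ext)

lemma nat_transD:
  assumes "nat_trans C D F G \<tau>"
  shows "is_functor C D F" "is_functor C D G" "\<tau> \<in> extensional (Obj C)"
    "\<And>a. a \<in> Obj C \<Longrightarrow> \<tau> a \<in> hom D (omap F a) (omap G a)"
    "\<And>f a b. f \<in> hom C a b \<Longrightarrow> Comp D (amap G f) (\<tau> a) = Comp D (\<tau> b) (amap F f)"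
  using assms unfolding nat_trans_def by (auto simp: hom_def)

lemma nat_transI:
  assumes "is_functor C D F" "is_functor C D G" "\<tau> \<in> extensional (Obj C)"
    and "\<And>a. a \<in> Obj C \<Longrightarrow> \<tau> a \<in> hom D (omap F a) (omap G a)"
    and "\<And>f a b. f \<in> hom C a b \<Longrightarrow> Comp D (amap G f) (\<tau> a) = Comp D (\<tau> b) (amap F f)"
  shows "nat_trans C D F G \<tau>"
  using assms unfolding nat_trans_def by (auto simp: hom_def)

lemma nat_trans_id:
  assumes "is_functor C D F"
  shows "nat_trans C D F F (\<lambda>a \<in> Obj C. Id D (omap F a))"
proof (rule nat_transI[OF assms assms])
  have C: "category C" and D: "category D" using functor_categories[OF assms] by auto
  fix f a b assume f: "f \<in> hom C a b"
  show "Comp D (amap F f) ((\<lambda>a \<in> Obj C. Id D (omap F a)) a) =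
      Comp D ((\<lambda>a \<in> Obj C. Id D (omap F a)) b) (amap F f)"
    using category_dom_cod[OF C f] functor_hom[OF assms f] category_id_left[OF D]
      category_id_right[OF D] by simp
qed (use functor_obj[OF assms] category_id[of D] functor_categories[OF assms] in auto)

lemma nat_trans_comp:
  assumes \<tau>: "nat_trans C D F G \<tau>" and \<sigma>: "nat_trans C D G H \<sigma>"
  shows "nat_trans C D F H (\<lambda>a \<in> Obj C. Comp D (\<sigma> a) (\<tau> a))"
proof (rule nat_transI)
  have F: "is_functor C D F" and G: "is_functor C D G" and H: "is_functor C D H"
    using nat_transD(1,2)[OF \<tau>] nat_transD(2)[OF \<sigma>] by auto
  have C: "category C" and D: "category D" using functor_categories[OF F] by auto
  note comp = category_comp[OF D nat_transD(4)[OF \<tau>] nat_transD(4)[OF \<sigma>]]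
  show "(\<lambda>a \<in> Obj C. Comp D (\<sigma> a) (\<tau> a)) a \<in> hom D (omap F a) (omap H a)" if "a \<in> Obj C" for a
    using comp[OF that that] that by simp
  fix f a b assume f: "f \<in> hom C a b"
  then have a: "a \<in> Obj C" and b: "b \<in> Obj C" using category_dom_cod[OF C] by auto
  have "Comp D (amap H f) (Comp D (\<sigma> a) (\<tau> a)) = Comp D (Comp D (\<sigma> b) (amap G f)) (\<tau> a)"
    by (simp add: category_assoc[OF D nat_transD(4)[OF \<tau> a] nat_transD(4)[OF \<sigma> a] functor_hom[OF H f]]
        nat_transD(5)[OF \<sigma> f])
  also have "\<dots> = Comp D (\<sigma> b) (Comp D (\<tau> b) (amap F f))"
    by (simp add: nat_transD(5)[OF \<tau> f] flip:
        category_assoc[OF D nat_transD(4)[OF \<tau> a] functor_hom[OF G f] nat_transD(4)[OF \<sigma> b]])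
  also have "\<dots> = Comp D (Comp D (\<sigma> b) (\<tau> b)) (amap F f)"
    by (rule category_assoc[OF D functor_hom[OF F f] nat_transD(4)[OF \<tau> b] nat_transD(4)[OF \<sigma> b]])
  finally show "Comp D (amap H f) ((\<lambda>a \<in> Obj C. Comp D (\<sigma> a) (\<tau> a)) a) =
      Comp D ((\<lambda>a \<in> Obj C. Comp D (\<sigma> a) (\<tau> a)) b) (amap F f)"
    using a b by simp
qed (use nat_transD(1)[OF \<tau>] nat_transD(2)[OF \<sigma>] in simp_all)

lemma category_functor_cat:
  assumes C: "category C" and D: "category D"
  shows "category (functor_cat C D)"
  unfolding category_def
proof (intro conjI ballI impI)
  show "Dom (functor_cat C D) f \<in> Obj (functor_cat C D)"
    "Cod (functor_cat C D) f \<in> Obj (functor_cat C D)"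
    if "f \<in> Arr (functor_cat C D)" for f
    using that nat_transD(1,2) by (fastforce simp: functor_cat_def)+
  show "Id (functor_cat C D) F \<in> hom (functor_cat C D) F F" if "F \<in> Obj (functor_cat C D)" for F
    using that nat_trans_id by (auto simp: functor_cat_def hom_def)
  show "Comp (functor_cat C D) g f \<in>
      hom (functor_cat C D) (Dom (functor_cat C D) f) (Cod (functor_cat C D) g)"
    if "f \<in> Arr (functor_cat C D)" "g \<in> Arr (functor_cat C D)"
      "Cod (functor_cat C D) f = Dom (functor_cat C D) g" for f g
    using that nat_trans_comp by (auto simp: functor_cat_def hom_def)
  show "Comp (functor_cat C D) f (Id (functor_cat C D) (Dom (functor_cat C D) f)) = f"
    "Comp (functor_cat C D) (Id (functor_cat C D) (Cod (functor_cat C D) f)) f = f"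
    if f: "f \<in> Arr (functor_cat C D)" for f
  proof -
    obtain F \<tau> G where "f = (F, \<tau>, G)" and \<tau>: "nat_trans C D F G \<tau>"
      using f by (auto simp: functor_cat_def)
    moreover have "(\<lambda>a \<in> Obj C. Comp D (\<tau> a) ((\<lambda>a \<in> Obj C. Id D (omap F a)) a)) = \<tau>"
      "(\<lambda>a \<in> Obj C. Comp D ((\<lambda>a \<in> Obj C. Id D (omap G a)) a) (\<tau> a)) = \<tau>"
      using nat_transD(3)[OF \<tau>] category_id_right[OF D nat_transD(4)[OF \<tau>]]
        category_id_left[OF D nat_transD(4)[OF \<tau>]]
      by (auto intro!: extensionalityI[of _ "Obj C"])
    ultimately show "Comp (functor_cat C D) f (Id (functor_cat C D) (Dom (functor_cat C D) f)) = f"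
      "Comp (functor_cat C D) (Id (functor_cat C D) (Cod (functor_cat C D) f)) f = f"
      by (simp_all add: functor_cat_def)
  qed
  show "Comp (functor_cat C D) h (Comp (functor_cat C D) g f) =
      Comp (functor_cat C D) (Comp (functor_cat C D) h g) f"
    if fgh: "f \<in> Arr (functor_cat C D)" "g \<in> Arr (functor_cat C D)" "h \<in> Arr (functor_cat C D)"
      "Cod (functor_cat C D) f = Dom (functor_cat C D) g \<and>
       Cod (functor_cat C D) g = Dom (functor_cat C D) h" for f g h
  proof -
    obtain F \<tau> G \<sigma> H \<rho> K where "f = (F, \<tau>, G)" "g = (G, \<sigma>, H)" "h = (H, \<rho>, K)"
      and n: "nat_trans C D F G \<tau>" "nat_trans C D G H \<sigma>" "nat_trans C D H K \<rho>"
      using fgh by (auto simp: functor_cat_def)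
    then show ?thesis
      using category_assoc[OF D nat_transD(4)[OF n(1)] nat_transD(4)[OF n(2)] nat_transD(4)[OF n(3)]]
      by (auto simp: functor_cat_def intro!: restrict_ext)
  qed
qed

lemma Obj_H: "x \<in> Obj H_cat \<longleftrightarrow> (\<exists>n \<ge> 1. x = Ty n \<or> x = Tm n)"
  by (auto simp: H_cat_def free_cat_def)

lemma Ty_Obj_H [simp]: "Ty n \<in> Obj H_cat \<longleftrightarrow> n \<ge> 1"
  and Tm_Obj_H [simp]: "Tm n \<in> Obj H_cat \<longleftrightarrow> n \<ge> 1"
  by (auto simp: Obj_H)

abbreviation hedges :: "hedge set" where
  "hedges \<equiv> Next ` {1..} \<union> Term ` {1..}"

lemma hedge_Obj_H: "e \<in> hedges \<Longrightarrow> hsrc e \<in> Obj H_cat \<and> htgt e \<in> Obj H_cat"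
  by auto

lemma Arr_H: "(a, es, b) \<in> Arr H_cat \<longleftrightarrow>
    a \<in> Obj H_cat \<and> b \<in> Obj H_cat \<and> is_path hedges hsrc htgt a es b"
  by (auto simp: H_cat_def free_cat_def)

lemma H_cat_simps [simp]:
  "Dom H_cat (a, es, b) = a" "Cod H_cat (a, es, b) = b" "Id H_cat a = (a, [], a)"
  "Comp H_cat (b', fs, c) (a, es, b) = (a, es @ fs, c)"
  by (simp_all add: H_cat_def free_cat_def)

lemma category_H: "category H_cat"
  unfolding H_cat_def by (rule category_free_cat) auto

lemma op_cat_simps [simp]:
  "Obj (op_cat C) = Obj C" "Arr (op_cat C) = Arr C" "Dom (op_cat C) = Cod C"
  "Cod (op_cat C) = Dom C" "Id (op_cat C) = Id C" "Comp (op_cat C) g f = Comp C f g"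
  by (simp_all add: op_cat_def)

lemma set_cat_simps:
  "Obj set_cat = UNIV" "(A, f, B) \<in> Arr set_cat \<longleftrightarrow> f \<in> A \<rightarrow>\<^sub>E B"
  "Dom set_cat (A, f, B) = A" "Cod set_cat (A, f, B) = B" "Id set_cat A = (A, \<lambda>x \<in> A. x, A)"
  "Comp set_cat (B', g, C) (A, f, B) = (A, compose A g f, C)"
  by (simp_all add: set_cat_def)

lemma set_hom: "k \<in> hom set_cat A B \<longleftrightarrow> k = (A, mid k, B) \<and> mid k \<in> A \<rightarrow>\<^sub>E B"
  by (cases k) (auto simp: hom_def set_cat_simps)

lemma set_comp_apply:
  "k \<in> hom set_cat A B \<Longrightarrow> l \<in> hom set_cat B C \<Longrightarrow> u \<in> A \<Longrightarrow>
    mid (Comp set_cat l k) u = mid l (mid k u)"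
  by (cases k; cases l) (auto simp: hom_def set_cat_simps compose_def)

lemma set_hom_eq:
  assumes "k \<in> hom set_cat A B" "l \<in> hom set_cat A B" "\<And>u. u \<in> A \<Longrightarrow> mid k u = mid l u"
  shows "k = l"
proof -
  have "mid k = mid l" using assms unfolding set_hom by (metis PiE_ext)
  then show ?thesis using assms(1,2) unfolding set_hom by metis
qed

lemma category_psh: "category psh_cat"
  unfolding psh_cat_def
  by (intro category_functor_cat category_op_cat category_H category_set_cat)

lemma Obj_psh: "X \<in> Obj psh_cat \<longleftrightarrow> is_functor (op_cat H_cat) set_cat X"
  by (simp add: psh_cat_def functor_cat_def)

text \<open>Both kinds of boundary, \<open>X(n + 1) \<rightarrow> X(n)\<close> and \<open>X(n\<^sub>t) \<rightarrow> X(n)\<close>, indexed by the generating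
arrows of \<^const>\<open>H_cat\<close>.\<close>

definition bd :: "'u psh \<Rightarrow> hedge \<Rightarrow> 'u \<Rightarrow> 'u" where
  "bd X e = mid (amap X (hsrc e, [e], htgt e))"

lemma psh_amap:
  assumes "X \<in> Obj psh_cat" "(a, es, b) \<in> Arr H_cat"
  shows "amap X (a, es, b) \<in> hom set_cat (omap X b) (omap X a)"
    and "mid (amap X (a, es, b)) \<in> omap X b \<rightarrow>\<^sub>E omap X a"
proof -
  have "(a, es, b) \<in> hom (op_cat H_cat) b a" using assms(2) by (simp add: hom_def)
  from functor_hom[OF assms(1)[unfolded Obj_psh] this]
  show "amap X (a, es, b) \<in> hom set_cat (omap X b) (omap X a)" .
  then show "mid (amap X (a, es, b)) \<in> omap X b \<rightarrow>\<^sub>E omap X a" unfolding set_hom by blast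
qed

lemma psh_amap_Nil:
  assumes "X \<in> Obj psh_cat" "a \<in> Obj H_cat" "u \<in> omap X a"
  shows "mid (amap X (a, [], a)) u = u"
  using functor_id[OF assms(1)[unfolded Obj_psh], of a] assms by (simp add: set_cat_simps)

lemma psh_amap_append:
  assumes X: "X \<in> Obj psh_cat" and m: "(a, es, b) \<in> Arr H_cat" "(b, fs, c) \<in> Arr H_cat"
    and u: "u \<in> omap X c"
  shows "mid (amap X (a, es @ fs, c)) u = mid (amap X (a, es, b)) (mid (amap X (b, fs, c)) u)"
proof -
  have "(a, es, b) \<in> hom (op_cat H_cat) b a" "(b, fs, c) \<in> hom (op_cat H_cat) c b"
    using m by (simp_all add: hom_def)
  from functor_comp[OF X[unfolded Obj_psh] this(2,1)]
  have "amap X (a, es @ fs, c) = Comp set_cat (amap X (a, es, b)) (amap X (b, fs, c))" by simp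
  then show ?thesis by (simp add: set_comp_apply[OF psh_amap(1)[OF X m(2)] psh_amap(1)[OF X m(1)] u])
qed

lemma hedge_arr: "e \<in> hedges \<Longrightarrow> (hsrc e, [e], htgt e) \<in> Arr H_cat"
  by (auto simp: Arr_H)

lemma bd_in: "X \<in> Obj psh_cat \<Longrightarrow> e \<in> hedges \<Longrightarrow> u \<in> omap X (htgt e) \<Longrightarrow> bd X e u \<in> omap X (hsrc e)"
  using psh_amap(2)[OF _ hedge_arr] unfolding bd_def by blast

lemma psh_amap_Cons:
  assumes X: "X \<in> Obj psh_cat" and m: "(a, e # es, c) \<in> Arr H_cat" and u: "u \<in> omap X c"
  shows "mid (amap X (a, e # es, c)) u = bd X e (mid (amap X (htgt e, es, c)) u)"
proof -
  have "(hsrc e, [e], htgt e) \<in> Arr H_cat" "(htgt e, es, c) \<in> Arr H_cat" "a = hsrc e"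
    using m hedge_Obj_H by (auto simp: Arr_H)
  then show ?thesis using psh_amap_append[OF X _ _ u, of "hsrc e" "[e]"] by (simp add: bd_def)
qed

text \<open>As \<^const>\<open>H_cat\<close> is free, arbitrary maps along its generating arrows extend to a functor.\<close>

definition psh_of :: "(hob \<Rightarrow> 'u set) \<Rightarrow> (hedge \<Rightarrow> 'u \<Rightarrow> 'u) \<Rightarrow> 'u psh" where
  "psh_of S r = \<lparr>omap = (\<lambda>x \<in> Obj H_cat. S x),
    amap = (\<lambda>(a, es, b) \<in> Arr H_cat. (S b, \<lambda>u \<in> S b. foldr r es u, S a))\<rparr>"

lemma omap_psh_of [simp]: "x \<in> Obj H_cat \<Longrightarrow> omap (psh_of S r) x = S x"
  by (simp add: psh_of_def)

lemma bd_psh_of: "e \<in> hedges \<Longrightarrow> u \<in> S (htgt e) \<Longrightarrow> bd (psh_of S r) e u = r e u"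
  using hedge_arr by (simp add: psh_of_def bd_def)

lemma psh_of_Obj:
  assumes r: "\<And>e u. e \<in> hedges \<Longrightarrow> u \<in> S (htgt e) \<Longrightarrow> r e u \<in> S (hsrc e)"
  shows "psh_of S r \<in> Obj psh_cat"
  unfolding Obj_psh
proof (rule is_functorI)
  have act: "foldr r es u \<in> S a" if "is_path hedges hsrc htgt a es b" "u \<in> S b" for a es b u
    using that r by (induction es arbitrary: a) auto
  have am: "amap (psh_of S r) (a, es, b) = (S b, \<lambda>u \<in> S b. foldr r es u, S a)"
    if "(a, es, b) \<in> Arr H_cat" for a es b
    using that by (simp add: psh_of_def)
  show "amap (psh_of S r) f \<in> hom set_cat (omap (psh_of S r) b) (omap (psh_of S r) a)"
    if "f \<in> hom (op_cat H_cat) b a" for f a b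
  proof (cases f)
    case (fields a' es b')
    then show ?thesis
      using that act[of a' es b'] by (auto simp: hom_def am Arr_H set_cat_simps)
  qed
  show "amap (psh_of S r) (Comp (op_cat H_cat) g f) =
      Comp set_cat (amap (psh_of S r) g) (amap (psh_of S r) f)"
    if fg: "f \<in> hom (op_cat H_cat) c b" "g \<in> hom (op_cat H_cat) b a" for f g a b c
  proof -
    obtain es fs where e: "g = (a, es, b)" "f = (b, fs, c)"
      using fg by (cases f; cases g) (auto simp: hom_def)
    then have m: "(a, es, b) \<in> Arr H_cat" "(b, fs, c) \<in> Arr H_cat"
      using fg by (auto simp: hom_def)
    then have "(a, es @ fs, c) \<in> Arr H_cat" "is_path hedges hsrc htgt b fs c"
      by (auto simp: Arr_H is_path_append)
    then show ?thesis
      by (auto simp: e am m set_cat_simps compose_def act intro!: restrict_ext)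
  qed
  show "amap (psh_of S r) (Id (op_cat H_cat) a) = Id set_cat (omap (psh_of S r) a)"
    if "a \<in> Obj (op_cat H_cat)" for a
    using that by (simp add: am Arr_H set_cat_simps)
qed (auto simp: category_op_cat category_H category_set_cat psh_of_def set_cat_simps)

lemma ty_bd_refl [simp]: "X \<in> Obj psh_cat \<Longrightarrow> n \<ge> 1 \<Longrightarrow> u \<in> omap X (Ty n) \<Longrightarrow> ty_bd X n n u = u"
  by (simp add: ty_bd_def psh_amap_Nil)

lemma is_path_Next:
  "1 \<le> i \<Longrightarrow> i \<le> n \<Longrightarrow> is_path hedges hsrc htgt (Ty i) (map Next [i..<n]) (Ty n)"
proof (induction "n - i" arbitrary: i)
  case (Suc d)
  then show ?case by (simp add: upt_conv_Cons)
qed simp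

lemma ty_bd_arr: "1 \<le> i \<Longrightarrow> i \<le> n \<Longrightarrow> (Ty i, map Next [i..<n], Ty n) \<in> Arr H_cat"
  using is_path_Next[of i n] by (simp add: Arr_H)

lemma ty_bd_in:
  "X \<in> Obj psh_cat \<Longrightarrow> 1 \<le> i \<Longrightarrow> i \<le> n \<Longrightarrow> u \<in> omap X (Ty n) \<Longrightarrow> ty_bd X i n u \<in> omap X (Ty i)"
  using psh_amap(2)[OF _ ty_bd_arr] unfolding ty_bd_def by blast

lemma ty_bd_trans:
  assumes "X \<in> Obj psh_cat" "1 \<le> i" "i \<le> j" "j \<le> n" "u \<in> omap X (Ty n)"
  shows "ty_bd X i j (ty_bd X j n u) = ty_bd X i n u"
proof -
  have "map Next [i..<n] = map Next [i..<j] @ map Next [j..<n]"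
    using assms upt_add_eq_append[of i j "n - j"] by (simp flip: map_append)
  then show ?thesis
    using psh_amap_append[OF assms(1) ty_bd_arr ty_bd_arr assms(5), of i j] assms
    by (simp add: ty_bd_def)
qed

lemma ty_bd_step: "ty_bd X n (Suc n) = bd X (Next n)"
  by (simp add: ty_bd_def bd_def)

lemma tm_bd_eq: "tm_bd X n = bd X (Term n)"
  by (simp add: tm_bd_def bd_def)

lemma ty_bd_Suc:
  "X \<in> Obj psh_cat \<Longrightarrow> 1 \<le> i \<Longrightarrow> i \<le> n \<Longrightarrow> u \<in> omap X (Ty (Suc n)) \<Longrightarrow>
    ty_bd X i (Suc n) u = ty_bd X i n (bd X (Next n) u)"
  using ty_bd_trans[of X i n "Suc n" u] by (simp add: ty_bd_step)

lemma ty_bd_step_in: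
  "X \<in> Obj psh_cat \<Longrightarrow> 1 \<le> n \<Longrightarrow> u \<in> omap X (Ty (Suc n)) \<Longrightarrow> bd X (Next n) u \<in> omap X (Ty n)"
  using bd_in[of X "Next n" u] by simp

lemma tm_bd_in:
  "X \<in> Obj psh_cat \<Longrightarrow> 1 \<le> n \<Longrightarrow> u \<in> omap X (Tm n) \<Longrightarrow> tm_bd X n u \<in> omap X (Ty n)"
  using bd_in[of X "Term n" u] by (simp add: tm_bd_eq)

definition act :: "'u psh_arr \<Rightarrow> hob \<Rightarrow> 'u \<Rightarrow> 'u" where
  "act f x = mid (mid f x)"

definition psh_map :: "'u psh \<Rightarrow> (hob \<Rightarrow> 'u \<Rightarrow> 'u) \<Rightarrow> 'u psh \<Rightarrow> 'u psh_arr" where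
  "psh_map X g Y = (X, \<lambda>x \<in> Obj H_cat. (omap X x, restrict (g x) (omap X x), omap Y x), Y)"

lemma psh_hom:
  "f \<in> hom psh_cat X Y \<longleftrightarrow> (\<exists>\<tau>. f = (X, \<tau>, Y) \<and> nat_trans (op_cat H_cat) set_cat X Y \<tau>)"
  by (cases f) (auto simp: hom_def psh_cat_def functor_cat_def)

lemma psh_hom_Obj: "f \<in> hom psh_cat X Y \<Longrightarrow> X \<in> Obj psh_cat \<and> Y \<in> Obj psh_cat"
  by (rule category_dom_cod[OF category_psh])

lemma psh_hom_comp: "f \<in> hom psh_cat X Y \<Longrightarrow> g \<in> hom psh_cat Y Z \<Longrightarrow> Comp psh_cat g f \<in> hom psh_cat X Z"
  by (rule category_comp[OF category_psh])

lemma psh_hom_component: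
  assumes "f \<in> hom psh_cat X Y" "x \<in> Obj H_cat"
  shows "mid f x \<in> hom set_cat (omap X x) (omap Y x)"
    and "mid f x = (omap X x, act f x, omap Y x)" and "act f x \<in> omap X x \<rightarrow>\<^sub>E omap Y x"
proof -
  obtain \<tau> where f: "f = (X, \<tau>, Y)" and n: "nat_trans (op_cat H_cat) set_cat X Y \<tau>"
    using assms(1) psh_hom by blast
  show "mid f x \<in> hom set_cat (omap X x) (omap Y x)"
    using nat_transD(4)[OF n, of x] assms(2) by (simp add: f)
  then show "mid f x = (omap X x, act f x, omap Y x)" "act f x \<in> omap X x \<rightarrow>\<^sub>E omap Y x"
    unfolding set_hom act_def by blast+
qed

lemma act_in:
  "f \<in> hom psh_cat X Y \<Longrightarrow> x \<in> Obj H_cat \<Longrightarrow> u \<in> omap X x \<Longrightarrow> act f x u \<in> omap Y x"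
  using psh_hom_component(3) by blast

lemma psh_hom_eq:
  assumes f: "f \<in> hom psh_cat X Y" and g: "g \<in> hom psh_cat X Y"
    and eq: "\<And>x u. x \<in> Obj H_cat \<Longrightarrow> u \<in> omap X x \<Longrightarrow> act f x u = act g x u"
  shows "f = g"
proof -
  have "mid f x = mid g x" if x: "x \<in> Obj H_cat" for x
    using set_hom_eq[OF psh_hom_component(1)[OF f x] psh_hom_component(1)[OF g x]] eq[OF x]
    by (simp add: act_def)
  moreover have "mid f \<in> extensional (Obj H_cat)" "mid g \<in> extensional (Obj H_cat)"
    "f = (X, mid f, Y)" "g = (X, mid g, Y)"
    using f g by (auto simp: psh_hom dest: nat_transD(3))
  ultimately show ?thesis by (metis extensionalityI)
qed

lemma act_amap:
  assumes f: "f \<in> hom psh_cat X Y" and m: "(a, es, b) \<in> Arr H_cat" and u: "u \<in> omap X b"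
  shows "mid (amap Y (a, es, b)) (act f b u) = act f a (mid (amap X (a, es, b)) u)"
proof -
  obtain \<tau> where \<tau>: "f = (X, \<tau>, Y)" and n: "nat_trans (op_cat H_cat) set_cat X Y \<tau>"
    using f psh_hom by blast
  have ab: "a \<in> Obj H_cat" "b \<in> Obj H_cat" using m by (auto simp: Arr_H)
  have X: "X \<in> Obj psh_cat" and Y: "Y \<in> Obj psh_cat" using psh_hom_Obj[OF f] by auto
  have "Comp set_cat (amap Y (a, es, b)) (mid f b) = Comp set_cat (mid f a) (amap X (a, es, b))"
    using nat_transD(5)[OF n, of "(a, es, b)" b a] m by (simp add: hom_def \<tau>)
  then show ?thesis
    using set_comp_apply[OF psh_hom_component(1)[OF f ab(2)] psh_amap(1)[OF Y m] u]
      set_comp_apply[OF psh_amap(1)[OF X m] psh_hom_component(1)[OF f ab(1)] u]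
    by (simp add: act_def)
qed

lemma act_bd:
  "f \<in> hom psh_cat X Y \<Longrightarrow> e \<in> hedges \<Longrightarrow> u \<in> omap X (htgt e) \<Longrightarrow>
    bd Y e (act f (htgt e) u) = act f (hsrc e) (bd X e u)"
  unfolding bd_def by (rule act_amap[OF _ hedge_arr])

lemma act_ty_bd:
  "f \<in> hom psh_cat X Y \<Longrightarrow> 1 \<le> i \<Longrightarrow> i \<le> n \<Longrightarrow> u \<in> omap X (Ty n) \<Longrightarrow>
    ty_bd Y i n (act f (Ty n) u) = act f (Ty i) (ty_bd X i n u)"
  unfolding ty_bd_def by (rule act_amap[OF _ ty_bd_arr])

lemma act_tm_bd:
  "f \<in> hom psh_cat X Y \<Longrightarrow> 1 \<le> n \<Longrightarrow> u \<in> omap X (Tm n) \<Longrightarrow>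
    tm_bd Y n (act f (Tm n) u) = act f (Ty n) (tm_bd X n u)"
  using act_bd[of f X Y "Term n" u] by (simp add: tm_bd_eq)

lemma psh_map_hom:
  assumes X: "X \<in> Obj psh_cat" and Y: "Y \<in> Obj psh_cat"
    and g: "\<And>x u. x \<in> Obj H_cat \<Longrightarrow> u \<in> omap X x \<Longrightarrow> g x u \<in> omap Y x"
    and nat: "\<And>e u. e \<in> hedges \<Longrightarrow> u \<in> omap X (htgt e) \<Longrightarrow>
      bd Y e (g (htgt e) u) = g (hsrc e) (bd X e u)"
  shows "psh_map X g Y \<in> hom psh_cat X Y"
proof -
  let ?\<tau> = "\<lambda>x \<in> Obj H_cat. (omap X x, restrict (g x) (omap X x), omap Y x)"
  have path: "mid (amap Y (a, es, b)) (g b u) = g a (mid (amap X (a, es, b)) u)"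
    if "(a, es, b) \<in> Arr H_cat" "u \<in> omap X b" for a es b u
    using that
  proof (induction es arbitrary: a)
    case Nil
    then show ?case using g by (auto simp: Arr_H psh_amap_Nil X Y)
  next
    case (Cons e es)
    have b: "b \<in> Obj H_cat" and e: "e \<in> hedges" "a = hsrc e"
      and es: "(htgt e, es, b) \<in> Arr H_cat"
      using Cons.prems hedge_Obj_H by (auto simp: Arr_H)
    have "mid (amap X (htgt e, es, b)) u \<in> omap X (htgt e)"
      using psh_amap(2)[OF X es] Cons.prems by blast
    from Cons.IH[OF es Cons.prems(2)] nat[OF e(1) this] e(2) show ?case
      unfolding psh_amap_Cons[OF X Cons.prems] psh_amap_Cons[OF Y Cons.prems(1) g[OF b Cons.prems(2)]]
      by simp
  qed
  have \<tau>: "?\<tau> x \<in> hom set_cat (omap X x) (omap Y x)" if "x \<in> Obj H_cat" for x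
    using that g by (auto simp: set_hom)
  have "nat_trans (op_cat H_cat) set_cat X Y ?\<tau>"
  proof (rule nat_transI)
    fix m a b assume m0: "m \<in> hom (op_cat H_cat) b a"
    then obtain es where m: "m = (a, es, b)" by (cases m) (auto simp: hom_def)
    have arr: "(a, es, b) \<in> Arr H_cat" and ab: "a \<in> Obj H_cat" "b \<in> Obj H_cat"
      using m0 by (auto simp: m hom_def Arr_H)
    note Xm = psh_amap(1)[OF X arr] and Ym = psh_amap(1)[OF Y arr]
    have in_a: "mid (amap X (a, es, b)) u \<in> omap X a" if "u \<in> omap X b" for u
      using psh_amap(2)[OF X arr] that by blast
    show "Comp set_cat (amap Y m) (?\<tau> b) = Comp set_cat (?\<tau> a) (amap X m)"
      unfolding m
    proof (rule set_hom_eq[OF category_comp[OF category_set_cat \<tau>[OF ab(2)] Ym]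
          category_comp[OF category_set_cat Xm \<tau>[OF ab(1)]]])
      fix u assume u: "u \<in> omap X b"
      show "mid (Comp set_cat (amap Y (a, es, b)) (?\<tau> b)) u =
          mid (Comp set_cat (?\<tau> a) (amap X (a, es, b))) u"
        unfolding set_comp_apply[OF \<tau>[OF ab(2)] Ym u] set_comp_apply[OF Xm \<tau>[OF ab(1)] u]
        using ab u in_a[OF u] path[OF arr u] by simp
    qed
  qed (use X Y \<tau> in \<open>auto simp: Obj_psh\<close>)
  then show ?thesis by (simp add: psh_hom psh_map_def)
qed

lemma act_psh_map [simp]:
  "x \<in> Obj H_cat \<Longrightarrow> u \<in> omap X x \<Longrightarrow> act (psh_map X g Y) x u = g x u"
  by (simp add: act_def psh_map_def)

lemma act_comp:
  assumes f: "f \<in> hom psh_cat X Y" and g: "g \<in> hom psh_cat Y Z"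
    and x: "x \<in> Obj H_cat" "u \<in> omap X x"
  shows "act (Comp psh_cat g f) x u = act g x (act f x u)"
proof -
  obtain \<tau> \<sigma> where "f = (X, \<tau>, Y)" "g = (Y, \<sigma>, Z)" using f g psh_hom by metis
  then have "mid (Comp psh_cat g f) x = Comp set_cat (mid g x) (mid f x)"
    using x(1) by (simp add: psh_cat_def functor_cat_def)
  then show ?thesis
    using set_comp_apply[OF psh_hom_component(1)[OF f x(1)] psh_hom_component(1)[OF g x(1)] x(2)]
    by (simp add: act_def)
qed

lemma act_id:
  "X \<in> Obj psh_cat \<Longrightarrow> x \<in> Obj H_cat \<Longrightarrow> u \<in> omap X x \<Longrightarrow> act (Id psh_cat X) x u = u"
  by (simp add: act_def psh_cat_def functor_cat_def set_cat_simps)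

text \<open>The elements chosen at the various objects of \<^const>\<open>H_cat\<close> form a map, since by uniqueness the choice
commutes with boundaries.\<close>

lemma psh_pullbackI:
  assumes p: "p \<in> hom psh_cat V A" and q: "q \<in> hom psh_cat V B"
    and f: "f \<in> hom psh_cat A Z" and g: "g \<in> hom psh_cat B Z"
    and sq: "\<And>x v. x \<in> Obj H_cat \<Longrightarrow> v \<in> omap V x \<Longrightarrow> act f x (act p x v) = act g x (act q x v)"
    and lift: "\<And>x a b. x \<in> Obj H_cat \<Longrightarrow> a \<in> omap A x \<Longrightarrow> b \<in> omap B x \<Longrightarrow> act f x a = act g x b \<Longrightarrow>
      \<exists>!v. v \<in> omap V x \<and> act p x v = a \<and> act q x v = b"
  shows "is_pullback psh_cat p q f g"
proof (rule is_pullbackI[OF p q f g])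
  show "Comp psh_cat f p = Comp psh_cat g q"
    by (rule psh_hom_eq[OF psh_hom_comp[OF p f] psh_hom_comp[OF q g]])
       (simp add: act_comp[OF p f] act_comp[OF q g] sq)
next
  fix W p' q'
  assume p': "p' \<in> hom psh_cat W A" and q': "q' \<in> hom psh_cat W B"
    and eq: "Comp psh_cat f p' = Comp psh_cat g q'"
  have W: "W \<in> Obj psh_cat" and V: "V \<in> Obj psh_cat" using psh_hom_Obj[OF p] psh_hom_Obj[OF p'] by auto
  have eq': "act f x (act p' x w) = act g x (act q' x w)" if "x \<in> Obj H_cat" "w \<in> omap W x" for x w
    using act_comp[OF p' f that] act_comp[OF q' g that] eq by simp
  define u where
    "u x w = (THE v. v \<in> omap V x \<and> act p x v = act p' x w \<and> act q x v = act q' x w)" for x w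
  have u: "u x w \<in> omap V x" "act p x (u x w) = act p' x w" "act q x (u x w) = act q' x w"
    if "x \<in> Obj H_cat" "w \<in> omap W x" for x w
    using theI'[OF lift[OF that(1) act_in[OF p' that] act_in[OF q' that] eq'[OF that]]]
    by (simp_all add: u_def)
  have unique: "v = v'" if "x \<in> Obj H_cat" "v \<in> omap V x" "v' \<in> omap V x"
    "act p x v = act p x v'" "act q x v = act q x v'" for x v v'
    using lift[OF that(1) act_in[OF p that(1,2)] act_in[OF q that(1,2)] sq[OF that(1,2)]] that by metis
  let ?u = "psh_map W u V"
  have u_hom: "?u \<in> hom psh_cat W V"
  proof (rule psh_map_hom[OF W V u(1)])
    fix e w assume e: "e \<in> hedges" and w: "w \<in> omap W (htgt e)"
    have ob: "hsrc e \<in> Obj H_cat" "htgt e \<in> Obj H_cat" using hedge_Obj_H[OF e] by auto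
    note uw = u[OF ob(2) w] and bw = bd_in[OF W e w]
    show "bd V e (u (htgt e) w) = u (hsrc e) (bd W e w)"
      by (rule unique[OF ob(1) bd_in[OF V e uw(1)] u(1)[OF ob(1) bw]])
         (simp_all add: u[OF ob(1) bw] uw flip: act_bd[OF p e uw(1)] act_bd[OF q e uw(1)]
           act_bd[OF p' e w] act_bd[OF q' e w])
  qed
  show "\<exists>!u. u \<in> hom psh_cat W V \<and> Comp psh_cat p u = p' \<and> Comp psh_cat q u = q'"
  proof (intro ex1I[of _ ?u] conjI u_hom)
    show "Comp psh_cat p ?u = p'"
      by (rule psh_hom_eq[OF psh_hom_comp[OF u_hom p] p']) (simp add: act_comp[OF u_hom p] u)
    show "Comp psh_cat q ?u = q'"
      by (rule psh_hom_eq[OF psh_hom_comp[OF u_hom q] q']) (simp add: act_comp[OF u_hom q] u)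
    fix v assume v: "v \<in> hom psh_cat W V \<and> Comp psh_cat p v = p' \<and> Comp psh_cat q v = q'"
    then have vh: "v \<in> hom psh_cat W V" by simp
    show "v = ?u"
    proof (rule psh_hom_eq[OF vh u_hom])
      fix x w assume xw: "x \<in> Obj H_cat" "w \<in> omap W x"
      show "act v x w = act ?u x w"
        using unique[OF xw(1) act_in[OF vh xw] u(1)[OF xw]] u[OF xw] v xw
          act_comp[OF vh p xw] act_comp[OF vh q xw] by simp
    qed
  qed
qed


section \<open>Derivability in a free theory\<close>

lemma subst_cong: "(\<And>v. v \<in> fv e \<Longrightarrow> \<theta> v = \<theta>' v) \<Longrightarrow> subst \<theta> e = subst \<theta>' e"
  by (induction e) auto

lemma subst_subst: "subst \<theta> (subst \<rho> e) = subst (\<lambda>v. subst \<theta> (\<rho> v)) e"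
  by (induction e) auto

lemma fv_subst: "fv (subst \<theta> e) = (\<Union>v \<in> fv e. fv (\<theta> v))"
  by (induction e) auto

lemma subst_Var [simp]: "subst Var e = e"
  by (induction e) (auto intro: map_idI)

abbreviation ren :: "(nat \<Rightarrow> nat) \<Rightarrow> 'w expr \<Rightarrow> 'w expr" where
  "ren \<sigma> \<equiv> subst (\<lambda>v. Var (\<sigma> v))"

lemma ren_ren: "ren \<sigma> (ren \<rho> e) = ren (\<sigma> \<circ> \<rho>) e"
  by (simp add: subst_subst comp_def)

lemma ren_ident: "(\<And>v. v \<in> fv e \<Longrightarrow> \<sigma> v = v) \<Longrightarrow> ren \<sigma> e = e"
  using subst_cong[of e "\<lambda>v. Var (\<sigma> v)" Var] by simp

lemma fv_ren [simp]: "fv (ren \<sigma> e) = \<sigma> ` fv e"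
  by (auto simp: fv_subst)

type_synonym 'u uexpr = "((nat \<times> 'u) + (nat \<times> 'u)) expr"
type_synonym 'u uctx = "((nat \<times> 'u) + (nat \<times> 'u)) ctx"
type_synonym 'u urhs = "((nat \<times> 'u) + (nat \<times> 'u)) rhs"

abbreviation ty_app :: "nat \<Rightarrow> 'u \<Rightarrow> nat list \<Rightarrow> 'u uexpr" where
  "ty_app n A ys \<equiv> App (Inl (n, A)) (map Var ys)"

abbreviation tm_app :: "nat \<Rightarrow> 'u \<Rightarrow> nat list \<Rightarrow> 'u uexpr" where
  "tm_app n a ys \<equiv> App (Inr (n, a)) (map Var ys)"

lemma inj_map_Var [simp]: "map Var xs = map Var ys \<longleftrightarrow> xs = ys"
  by (rule inj_map_eq_map) (simp add: inj_def)

lemma map_Var_snoc [simp]: "map Var ys = map Var zs @ [Var y] \<longleftrightarrow> ys = zs @ [y]"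
  using inj_map_Var[of ys "zs @ [y]"] unfolding map_append list.map .

lemma ren_map_Var [simp]: "map (ren \<sigma>) (map Var ys) = map Var (map \<sigma> ys)"
  by simp

text \<open>The syntactic description of derivable judgements.  Only the last argument of a type need be looked up
in the context: its own type lists the preceding arguments and names the boundary of the head.\<close>

inductive ok_type :: "'u psh \<Rightarrow> 'u uctx \<Rightarrow> 'u uexpr \<Rightarrow> bool"
  for X :: "'u psh" and \<Gamma> where
  closed: "A \<in> omap X (Ty 1) \<Longrightarrow> ok_type X \<Gamma> (ty_app 1 A [])"
| dependent: "n \<ge> 1 \<Longrightarrow> A \<in> omap X (Ty (Suc n)) \<Longrightarrow> (y, ty_app n (bd X (Next n) A) ys) \<in> set \<Gamma> \<Longrightarrow>
    ok_type X \<Gamma> (ty_app (Suc n) A (ys @ [y]))"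

inductive ok_ctx :: "'u psh \<Rightarrow> 'u uctx \<Rightarrow> bool" for X :: "'u psh" where
  Nil: "ok_ctx X []"
| Snoc: "ok_ctx X \<Gamma> \<Longrightarrow> ok_type X \<Gamma> T \<Longrightarrow> x \<notin> fst ` set \<Gamma> \<Longrightarrow> ok_ctx X (\<Gamma> @ [(x, T)])"

inductive ok_term :: "'u psh \<Rightarrow> 'u uctx \<Rightarrow>
    'u uexpr \<Rightarrow> 'u uexpr \<Rightarrow> bool"
  for X :: "'u psh" and \<Gamma> where
  var: "(x, T) \<in> set \<Gamma> \<Longrightarrow> ok_term X \<Gamma> (Var x) T"
| const: "n \<ge> 1 \<Longrightarrow> a \<in> omap X (Tm n) \<Longrightarrow> ok_type X \<Gamma> (ty_app n (tm_bd X n a) ys) \<Longrightarrow>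
    ok_term X \<Gamma> (tm_app n a ys) (ty_app n (tm_bd X n a) ys)"

primrec ok_rhs :: "'u psh \<Rightarrow> 'u uctx \<Rightarrow> 'u urhs \<Rightarrow> bool"
where
  "ok_rhs X \<Gamma> (IsType T) \<longleftrightarrow> ok_type X \<Gamma> T"
| "ok_rhs X \<Gamma> (HasType t T) \<longleftrightarrow> ok_term X \<Gamma> t T"
| "ok_rhs X \<Gamma> (TypeEq T T') \<longleftrightarrow> T = T' \<and> ok_type X \<Gamma> T"
| "ok_rhs X \<Gamma> (TermEq t t' T) \<longleftrightarrow> t = t' \<and> ok_term X \<Gamma> t T"

definition ok_jdg :: "'u psh \<Rightarrow> 'u ujdg \<Rightarrow> bool" where
  "ok_jdg X J \<longleftrightarrow> ok_ctx X (ctx J) \<and> ok_rhs X (ctx J) (rhs J)"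

lemma ok_jdg_simp [simp]: "ok_jdg X (\<Gamma> \<turnstile> R) \<longleftrightarrow> ok_ctx X \<Gamma> \<and> ok_rhs X \<Gamma> R"
  by (simp add: ok_jdg_def)

lemma ok_ctx_snoc [simp]:
  "ok_ctx X (\<Gamma> @ [(x, T)]) \<longleftrightarrow> ok_ctx X \<Gamma> \<and> ok_type X \<Gamma> T \<and> x \<notin> fst ` set \<Gamma>"
  by (subst ok_ctx.simps) auto

lemma ok_type_mono: "ok_type X \<Gamma> T \<Longrightarrow> set \<Gamma> \<subseteq> set \<Delta> \<Longrightarrow> ok_type X \<Delta> T"
  by (auto elim!: ok_type.cases intro: ok_type.intros)

lemma ok_term_mono: "ok_term X \<Gamma> t T \<Longrightarrow> set \<Gamma> \<subseteq> set \<Delta> \<Longrightarrow> ok_term X \<Delta> t T"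
  by (auto elim!: ok_term.cases intro: ok_term.intros ok_type_mono)

lemma ok_rhs_mono: "ok_rhs X \<Gamma> R \<Longrightarrow> set \<Gamma> \<subseteq> set \<Delta> \<Longrightarrow> ok_rhs X \<Delta> R"
  by (cases R) (auto intro: ok_type_mono ok_term_mono)

lemma ok_ctx_type: "ok_ctx X \<Gamma> \<Longrightarrow> (x, T) \<in> set \<Gamma> \<Longrightarrow> ok_type X \<Gamma> T"
  by (induction rule: ok_ctx.induct) (auto intro: ok_type_mono)

lemma ok_term_type: "ok_ctx X \<Gamma> \<Longrightarrow> ok_term X \<Gamma> t T \<Longrightarrow> ok_type X \<Gamma> T"
  by (auto elim!: ok_term.cases intro: ok_ctx_type)

lemma ok_ctx_distinct: "ok_ctx X \<Gamma> \<Longrightarrow> distinct (map fst \<Gamma>)"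
  by (induction rule: ok_ctx.induct) auto

lemma ok_ctx_append: "ok_ctx X (\<Gamma> @ \<Delta>) \<Longrightarrow> ok_ctx X \<Gamma>"
proof (induction \<Delta> rule: rev_induct)
  case (snoc p \<Delta>)
  obtain x T where p: "p = (x, T)" by fastforce
  have "ok_ctx X ((\<Gamma> @ \<Delta>) @ [(x, T)])" using snoc.prems by (simp add: p)
  then show ?case unfolding ok_ctx_snoc using snoc.IH by blast
qed simp

lemma ok_ctx_prefix:
  assumes "ok_ctx X (\<Gamma> @ (x, T) # \<Delta>)" shows "ok_ctx X \<Gamma>" "ok_type X \<Gamma> T" "x \<notin> fst ` set \<Gamma>"
proof -
  have "ok_ctx X (\<Gamma> @ [(x, T)])" using assms ok_ctx_append[of X "\<Gamma> @ [(x, T)]" \<Delta>] by simp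
  then show "ok_ctx X \<Gamma>" "ok_type X \<Gamma> T" "x \<notin> fst ` set \<Gamma>" by simp_all
qed

text \<open>Although a type only mentions its last argument in the context, the type of that argument mentions the
preceding ones, so induction along the context reaches all of them.\<close>

lemma ok_type_fv:
  assumes "ok_ctx X \<Gamma>" "ok_type X \<Gamma> T" shows "fv T \<subseteq> fst ` set \<Gamma>"
  using assms
proof (induction arbitrary: T rule: ok_ctx.induct)
  case Nil
  then show ?case by (auto elim: ok_type.cases)
next
  case (Snoc \<Gamma> S x)
  have step: "fv T \<subseteq> insert x (fst ` set \<Gamma>)" if "ok_type X \<Gamma> T" for T
    using Snoc.IH[OF that] by blast
  from Snoc.prems show ?case
  proof cases
    case (dependent n A y ys)
    then have "ok_type X \<Gamma> (ty_app n (bd X (Next n) A) ys)"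
      using Snoc.hyps ok_ctx_type by fastforce
    from Snoc.IH[OF this] dependent show ?thesis by force
  qed simp
qed

lemma ok_term_fv: "ok_ctx X \<Gamma> \<Longrightarrow> ok_term X \<Gamma> t T \<Longrightarrow> fv t \<subseteq> fst ` set \<Gamma>"
  by (erule ok_term.cases) (force, use ok_type_fv in fastforce)

lemma fv_ctx_append: "fv_ctx (\<Gamma> @ \<Delta>) = fv_ctx \<Gamma> \<union> fv_ctx \<Delta>"
  by (simp add: fv_ctx_def)

lemma fv_ok_ctx:
  assumes "ok_ctx X \<Gamma>" shows "fv_ctx \<Gamma> = fst ` set \<Gamma>"
proof -
  have "insert (fst p) (fv (snd p)) \<subseteq> fst ` set \<Gamma>" if "p \<in> set \<Gamma>" for p
    using ok_type_fv[OF assms ok_ctx_type[OF assms, of "fst p" "snd p"]] that by simp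
  then have "(\<Union>p \<in> set \<Gamma>. insert (fst p) (fv (snd p))) \<subseteq> fst ` set \<Gamma>" by (rule UN_least)
  moreover have "fst ` set \<Gamma> \<subseteq> (\<Union>p \<in> set \<Gamma>. insert (fst p) (fv (snd p)))" by auto
  ultimately show ?thesis unfolding fv_ctx_def split_beta by (rule equalityI)
qed

lemma ok_ctx_weaken:
  "ok_ctx X (\<Gamma> @ \<Delta>) \<Longrightarrow> ok_type X \<Gamma> T \<Longrightarrow> y \<notin> fst ` set (\<Gamma> @ \<Delta>) \<Longrightarrow> ok_ctx X (\<Gamma> @ (y, T) # \<Delta>)"
proof (induction \<Delta> rule: rev_induct)
  case Nil
  then show ?case by auto
next
  case (snoc p \<Delta>)
  obtain x S where p: "p = (x, S)" by fastforce
  have "ok_ctx X ((\<Gamma> @ \<Delta>) @ [(x, S)])" using snoc.prems by (simp add: p)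
  then have "ok_ctx X (\<Gamma> @ \<Delta>)" "ok_type X (\<Gamma> @ \<Delta>) S" "x \<notin> fst ` set (\<Gamma> @ \<Delta>)"
    unfolding ok_ctx_snoc by auto
  then have "ok_ctx X ((\<Gamma> @ (y, T) # \<Delta>) @ [(x, S)])"
    unfolding ok_ctx_snoc using snoc by (auto simp: p intro: ok_type_mono)
  then show ?case by (simp add: p)
qed

abbreviation ren_ctx :: "(nat \<Rightarrow> nat) \<Rightarrow> 'w ctx \<Rightarrow> 'w ctx" where
  "ren_ctx \<sigma> \<equiv> map (\<lambda>(x, T). (\<sigma> x, ren \<sigma> T))"

lemma ok_type_ren: "ok_type X \<Gamma> T \<Longrightarrow> ok_type X (ren_ctx \<sigma> \<Gamma>) (ren \<sigma> T)"
proof (erule ok_type.cases)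
  fix n A y ys assume a: "T = ty_app (Suc n) A (ys @ [y])" "1 \<le> n" "A \<in> omap X (Ty (Suc n))"
    "(y, ty_app n (bd X (Next n) A) ys) \<in> set \<Gamma>"
  then have "(\<sigma> y, ty_app n (bd X (Next n) A) (map \<sigma> ys)) \<in> set (ren_ctx \<sigma> \<Gamma>)"
    by (force simp: image_iff)
  from dependent[OF a(2,3) this] show ?thesis by (simp add: a(1) comp_def)
qed (use closed in auto)

lemma ok_term_ren: "ok_term X \<Gamma> t T \<Longrightarrow> ok_term X (ren_ctx \<sigma> \<Gamma>) (ren \<sigma> t) (ren \<sigma> T)"
proof (erule ok_term.cases)
  fix x T' assume "t = Var x" "T = T'" "(x, T') \<in> set \<Gamma>"
  then show ?thesis by (auto intro!: var simp: image_iff) (metis case_prod_conv)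
next
  fix n a ys assume a: "t = tm_app n a ys" "T = ty_app n (tm_bd X n a) ys" "1 \<le> n"
    "a \<in> omap X (Tm n)" "ok_type X \<Gamma> (ty_app n (tm_bd X n a) ys)"
  have "ok_type X (ren_ctx \<sigma> \<Gamma>) (ty_app n (tm_bd X n a) (map \<sigma> ys))"
    using ok_type_ren[OF a(5), of \<sigma>] by (simp add: comp_def)
  from const[OF a(3,4) this] show ?thesis by (simp add: a(1,2) comp_def)
qed

lemma ok_ctx_ren:
  "ok_ctx X \<Gamma> \<Longrightarrow> inj_on \<sigma> (fst ` set \<Gamma>) \<Longrightarrow> ok_ctx X (ren_ctx \<sigma> \<Gamma>)"
proof (induction rule: ok_ctx.induct)
  case (Snoc \<Gamma> T x)
  then show ?case by (auto simp: inj_on_def image_iff intro: ok_type_ren)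
qed (simp add: ok_ctx.Nil)

lemma ok_jdg_perm: "ok_jdg X J \<Longrightarrow> inj_on \<sigma> (fst ` set (ctx J)) \<Longrightarrow> ok_jdg X (perm_jdg \<sigma> J)"
  by (cases "rhs J") (auto simp: ok_jdg_def perm_jdg_def comp_def intro: ok_ctx_ren ok_type_ren ok_term_ren)

text \<open>The context of the basic judgement of \<open>A\<close> with its variables renamed to \<open>ys\<close>.\<close>

definition inst_ctx :: "'u psh \<Rightarrow> nat \<Rightarrow> 'u \<Rightarrow> nat list \<Rightarrow> 'u uctx" where
  "inst_ctx X n A ys =
     map (\<lambda>i. (ys ! (i - 1), ty_app i (ty_bd X i n A) (take (i - 1) ys))) [1..<n]"

lemma ren_basic_ctx: "ren_ctx \<sigma> (basic_ctx X n A) = inst_ctx X n A (map \<sigma> [1..<n])"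
  by (auto simp: basic_ctx_def inst_ctx_def take_map)

lemma basic_ctx_eq_inst: "basic_ctx X n A = inst_ctx X n A [1..<n]"
  using ren_basic_ctx[of id X n A] by simp

lemma map_fst_inst_ctx: "length ys = n - 1 \<Longrightarrow> map fst (inst_ctx X n A ys) = ys"
  by (auto simp: inst_ctx_def intro!: nth_equalityI)

lemma inst_ctx_Suc:
  assumes "X \<in> Obj psh_cat" "n \<ge> 1" "A \<in> omap X (Ty (Suc n))" "length ys = n - 1"
  shows "inst_ctx X (Suc n) A (ys @ [y]) =
    inst_ctx X n (bd X (Next n) A) ys @ [(y, ty_app n (bd X (Next n) A) ys)]"
  using assms by (auto simp: inst_ctx_def nth_append ty_bd_Suc ty_bd_step)

lemma ok_type_head:
  assumes "ok_type X \<Gamma> T" obtains n A ys where "T = ty_app n A ys"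
  using assms
proof cases
  case (closed A)
  then show ?thesis using that[of 1 A "[]"] by simp
next
  case (dependent n A y ys)
  show ?thesis by (rule that) (rule dependent(1))
qed

lemma ok_type_app:
  assumes "ok_ctx X \<Gamma>" "ok_type X \<Gamma> (ty_app n A ys)"
  shows "n \<ge> 1" "A \<in> omap X (Ty n)" "length ys = n - 1"
proof -
  show "n \<ge> 1" "A \<in> omap X (Ty n)" using assms(2) by (auto elim: ok_type.cases)
  from assms(2) show "length ys = n - 1"
  proof (induction n arbitrary: A ys rule: less_induct)
    case (less n)
    from less.prems show ?case
    proof cases
      case (dependent m y zs)
      then have "ok_type X \<Gamma> (ty_app m (bd X (Next m) A) zs)" using ok_ctx_type[OF assms(1)] by blast
      moreover have "ys = zs @ [y]"
        using dependent by simp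
      ultimately show ?thesis using less.IH[of m] dependent by simp
    qed simp
  qed
qed

text \<open>There is neither exchange nor contraction: the variables of a type occur in the context in the order
and with the types in which the basic judgement of its head declares them.  By induction along the
context, it suffices to look at the last argument, whose type is headed by the boundary.\<close>

lemma filter_ok_ctx:
  assumes X: "X \<in> Obj psh_cat" and "ok_ctx X \<Gamma>" "ok_type X \<Gamma> (ty_app n A ys)"
  shows "filter (\<lambda>p. fst p \<in> set ys) \<Gamma> = inst_ctx X n A ys"
  using assms(2,3)
proof (induction arbitrary: n A ys rule: ok_ctx.induct)
  case Nil
  then show ?case by (auto elim!: ok_type.cases simp: inst_ctx_def)
next
  case (Snoc \<Gamma> S x)
  note ok = ok_ctx.Snoc[OF Snoc.hyps]
  from Snoc.prems show ?case
  proof cases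
    case closed
    then show ?thesis by (simp add: inst_ctx_def)
  next
    case (dependent m y zs)
    have ys: "ys = zs @ [y]" using dependent(2) by simp
    show ?thesis
    proof (cases "(y, ty_app m (bd X (Next m) A) zs) \<in> set \<Gamma>")
      case True
      then have T: "ok_type X \<Gamma> (ty_app n A ys)"
        using ok_type.dependent dependent by metis
      have "x \<notin> set ys" using ok_type_fv[OF Snoc.hyps(1) T] Snoc.hyps(3) by auto
      then show ?thesis using Snoc.IH[OF T] by simp
    next
      case False
      then have yx: "y = x" and S: "S = ty_app m (bd X (Next m) A) zs" using dependent by auto
      have zs: "length zs = m - 1" using ok_type_app[OF Snoc.hyps(1)] Snoc.hyps(2) S by blast
      have "filter (\<lambda>p. fst p \<in> set ys) \<Gamma> = filter (\<lambda>p. fst p \<in> set zs) \<Gamma>"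
        using Snoc.hyps(3) ys yx by (intro filter_cong) auto
      also have "\<dots> = inst_ctx X m (bd X (Next m) A) zs"
        using Snoc.IH Snoc.hyps(2) S by blast
      finally show ?thesis
        using inst_ctx_Suc[OF X dependent(3,4) zs] yx S dependent(1) ys by simp
    qed
  qed
qed

lemma ok_type_distinct:
  assumes "X \<in> Obj psh_cat" "ok_ctx X \<Gamma>" "ok_type X \<Gamma> (ty_app n A ys)"
  shows "distinct ys"
proof -
  have "map fst (filter (\<lambda>p. fst p \<in> set ys) \<Gamma>) = ys"
    unfolding filter_ok_ctx[OF assms] by (rule map_fst_inst_ctx) (rule ok_type_app[OF assms(2,3)])
  then show ?thesis
    using distinct_map_filter[OF ok_ctx_distinct[OF assms(2)]] by metis
qed

lemma basic_ctx_Suc: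
  assumes "X \<in> Obj psh_cat" "n \<ge> 1" "A \<in> omap X (Ty (Suc n))"
  shows "basic_ctx X (Suc n) A =
    basic_ctx X n (bd X (Next n) A) @ [(n, ty_app n (bd X (Next n) A) [1..<n])]"
  using inst_ctx_Suc[OF assms, of "[1..<n]" n] assms(2) by (simp add: basic_ctx_eq_inst)

lemma basic_ok_type:
  assumes X: "X \<in> Obj psh_cat" and "n \<ge> 1" "A \<in> omap X (Ty n)"
  shows "ok_ctx X (basic_ctx X n A) \<and> ok_type X (basic_ctx X n A) (ty_app n A [1..<n])"
  using assms(2,3)
proof (induction n arbitrary: A rule: nat_induct_at_least)
  case base
  then show ?case using ok_ctx.Nil closed[of A X] by (simp add: basic_ctx_def)
next
  case (Suc n)
  let ?B = "bd X (Next n) A"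
  have "?B \<in> omap X (Ty n)" using ty_bd_step_in[OF X] Suc by simp
  from Suc.IH[OF this] have IH: "ok_ctx X (basic_ctx X n ?B)" "ok_type X (basic_ctx X n ?B) (ty_app n ?B [1..<n])"
    by auto
  have "n \<notin> fst ` set (basic_ctx X n ?B)" by (force simp: basic_ctx_def)
  moreover have "ok_type X (basic_ctx X (Suc n) A) (ty_app (Suc n) A ([1..<n] @ [n]))"
    by (rule dependent) (use Suc in \<open>auto simp: basic_ctx_Suc[OF X]\<close>)
  ultimately show ?case using IH Suc by (simp add: basic_ctx_Suc[OF X])
qed

lemma basic_ok:
  assumes X: "X \<in> Obj psh_cat" and x: "x \<in> Obj H_cat" "u \<in> omap X x"
  shows "ok_jdg X (basic_jdg X x u)"
proof (cases x)
  case (Ty n)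
  then show ?thesis using basic_ok_type[OF X] x by simp
next
  case (Tm n)
  then show ?thesis
    using basic_ok_type[OF X _ tm_bd_in[OF X], of n u] x const[of n u X _ "[1..<n]"] by simp
qed

lemma deduction_ok:
  assumes "deduction r Js J" "\<forall>K \<in> set Js. ok_jdg X K"
  shows "ok_jdg X J"
  using assms
proof cases
  case (9 \<sigma> J')
  then show ?thesis using assms(2) ok_jdg_perm[of X J'] by (auto dest: bij_is_inj inj_on_subset)
next
  case (10 y \<Gamma> \<Delta> T R)
  then have ok: "ok_ctx X (\<Gamma> @ \<Delta>)" "ok_type X \<Gamma> T" "ok_rhs X (\<Gamma> @ \<Delta>) R" using assms(2) by auto
  have "y \<notin> fst ` set (\<Gamma> @ \<Delta>)" using 10(4) by (force simp: fv_ctx_def)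
  then show ?thesis
    using ok ok_ctx_weaken[OF ok(1,2)] ok_rhs_mono[OF ok(3), of "\<Gamma> @ (y, T) # \<Delta>"] by (auto simp: 10)
next
  case (11 y \<Gamma> T)
  then have "y \<notin> fst ` set \<Gamma>" by (force simp: fv_ctx_def)
  then show ?thesis using 11 assms(2) by (auto intro: var)
qed (use assms(2) in auto)

lemma derived_ok:
  assumes "X \<in> Obj psh_cat" "J \<in> derived (free_obj X)"
  shows "ok_jdg X J"
  using assms(2) unfolding derived_def
proof (induction rule: derived_from.induct)
  case (1 r Js J)
  then show ?case by (intro deduction_ok) auto
next
  case (2 J)
  then show ?case using basic_ok[OF assms(1)] by (auto simp: free_obj_def)
qed

lemma derived_rule: "deduction r Js J \<Longrightarrow> set Js \<subseteq> derived T \<Longrightarrow> J \<in> derived T"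
  unfolding derived_def by (rule derived_from.intros(1)) auto

lemma derived_basic: "J \<in> basic T \<Longrightarrow> set (boundary J) \<subseteq> derived T \<Longrightarrow> J \<in> derived T"
  unfolding derived_def by (rule derived_from.intros(2)) auto

lemma derived_perm: "bij \<sigma> \<Longrightarrow> J \<in> derived T \<Longrightarrow> perm_jdg \<sigma> J \<in> derived T"
  by (rule derived_rule[OF deduction.intros(9)]) auto

lemma basic_in_free: "x \<in> Obj H_cat \<Longrightarrow> u \<in> omap X x \<Longrightarrow> basic_jdg X x u \<in> basic (free_obj X)"
  by (auto simp: free_obj_def)

lemma boundary_basic_Ty:
  assumes "X \<in> Obj psh_cat" "n \<ge> 1" "A \<in> omap X (Ty (Suc n))"
  shows "boundary (basic_jdg X (Ty (Suc n)) A) = [basic_jdg X (Ty n) (bd X (Next n) A)]"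
  using basic_ctx_Suc[OF assms] by simp

lemma basic_derived:
  assumes X: "X \<in> Obj psh_cat" and x: "x \<in> Obj H_cat" "u \<in> omap X x"
  shows "basic_jdg X x u \<in> derived (free_obj X)"
proof -
  have ty: "basic_jdg X (Ty n) A \<in> derived (free_obj X)" if "n \<ge> 1" "A \<in> omap X (Ty n)" for n A
    using that
  proof (induction n arbitrary: A rule: nat_induct_at_least)
    case base
    show ?case by (rule derived_basic[OF basic_in_free]) (use base in \<open>auto simp: basic_ctx_def\<close>)
  next
    case (Suc n)
    show ?case
      by (rule derived_basic[OF basic_in_free], simp, fact)
         (use Suc ty_bd_step_in[OF X] in \<open>simp add: boundary_basic_Ty[OF X] del: basic_jdg.simps\<close>)
  qed
  show ?thesis
  proof (cases x)
    case (Tm n)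
    have "basic_jdg X (Ty n) (tm_bd X n u) \<in> derived (free_obj X)"
      using ty tm_bd_in[OF X] x Tm by simp
    then show ?thesis
      by (intro derived_basic[OF basic_in_free[OF x]]) (simp add: Tm)
  qed (use ty x in auto)
qed

text \<open>The rule for renaming asks for permutations of all variables, while renamings of contexts are given on
finitely many variables only.\<close>

lemma bij_extension:
  fixes xs ys :: "nat list"
  assumes "length xs = length ys" "distinct xs" "distinct ys"
  shows "\<exists>\<sigma>. bij \<sigma> \<and> map \<sigma> xs = ys"
  using assms
proof (induction xs ys rule: list_induct2)
  case Nil
  show ?case using bij_id by auto
next
  case (Cons x xs y ys)
  then obtain \<sigma> where \<sigma>: "bij \<sigma>" "map \<sigma> xs = ys" by auto
  \<comment> \<open>Correcting \<open>\<sigma>\<close> by a transposition leaves its values on \<open>xs\<close> alone, as these differ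
     from both \<open>\<sigma> x\<close> and \<open>y\<close>.\<close>
  define \<tau> where "\<tau> z = (if z = \<sigma> x then y else if z = y then \<sigma> x else z)" for z
  have "bij \<tau>" by (rule involuntory_imp_bij) (auto simp: \<tau>_def)
  then have "bij (\<tau> \<circ> \<sigma>)" using \<sigma>(1) by (rule bij_comp[rotated])
  moreover have "\<tau> (\<sigma> z) = \<sigma> z" if "z \<in> set xs" for z
  proof -
    have "\<sigma> z \<in> set ys" using \<sigma>(2) that by auto
    then have "\<sigma> z \<noteq> y" using Cons.prems by auto
    moreover have "\<sigma> z \<noteq> \<sigma> x" using Cons.prems that bij_is_inj[OF \<sigma>(1)] by (auto dest: injD)
    ultimately show ?thesis by (simp add: \<tau>_def)
  qed
  then have "map (\<tau> \<circ> \<sigma>) (x # xs) = y # ys" using \<sigma>(2) by (auto simp: \<tau>_def)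
  ultimately show ?case by (intro exI[of _ "\<tau> \<circ> \<sigma>"] conjI)
qed

text \<open>A judgement derived over part of a context is weakened to the whole context by inserting the missing
variables one at a time from the left, so that the type of each inserted variable lives over a context
that is already complete.\<close>

lemma weaken_filter:
  assumes X: "X \<in> Obj psh_cat" and \<Gamma>: "ok_ctx X \<Gamma>"
    and R: "(filter P \<Gamma> \<turnstile> R) \<in> derived (free_obj X)"
    and ty: "\<And>\<Gamma>1 y T \<Gamma>2. \<Gamma> = \<Gamma>1 @ (y, T) # \<Gamma>2 \<Longrightarrow> (\<Gamma>1 \<turnstile> IsType T) \<in> derived (free_obj X)"
  shows "(\<Gamma> \<turnstile> R) \<in> derived (free_obj X)"
proof -
  have "(\<Gamma>1 @ filter P \<Gamma>2 \<turnstile> R) \<in> derived (free_obj X)" if "\<Gamma> = \<Gamma>1 @ \<Gamma>2" for \<Gamma>1 \<Gamma>2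
    using that
  proof (induction \<Gamma>1 arbitrary: \<Gamma>2 rule: rev_induct)
    case (snoc p \<Gamma>1)
    obtain y T where p: "p = (y, T)" by fastforce
    have split: "\<Gamma> = \<Gamma>1 @ (y, T) # \<Gamma>2" using snoc.prems by (simp add: p)
    note IH = snoc.IH[OF split]
    show ?case
    proof (cases "P (y, T)")
      case False
      then have D: "(\<Gamma>1 @ filter P \<Gamma>2 \<turnstile> R) \<in> derived (free_obj X)" using IH by simp
      then have "ok_ctx X (\<Gamma>1 @ filter P \<Gamma>2)" using derived_ok[OF X D] by simp
      from fv_ok_ctx[OF this]
      have "fv_ctx \<Gamma>1 \<union> fv_ctx (filter P \<Gamma>2) = fst ` set (\<Gamma>1 @ filter P \<Gamma>2)"
        by (simp add: fv_ctx_append)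
      moreover have "y \<notin> fst ` set (\<Gamma>1 @ filter P \<Gamma>2)"
        using ok_ctx_distinct[OF \<Gamma>] by (auto simp: split)
      ultimately have "y \<notin> fv_ctx \<Gamma>1 \<union> fv_ctx (filter P \<Gamma>2)" by simp
      from derived_rule[OF deduction.intros(10)[OF this]] ty[OF split] D
      show ?thesis by (simp add: p)
    qed (use IH p in simp)
  qed (use R in simp)
  from this[of \<Gamma> "[]"] show ?thesis by simp
qed

lemma perm_basic:
  "map \<sigma> [1..<n] = ys \<Longrightarrow> perm_jdg \<sigma> (basic_jdg X (Ty n) A) = (inst_ctx X n A ys \<turnstile> IsType (ty_app n A ys))"
  "map \<sigma> [1..<n] = ys \<Longrightarrow> perm_jdg \<sigma> (basic_jdg X (Tm n) a) =
    (inst_ctx X n (tm_bd X n a) ys \<turnstile> HasType (tm_app n a ys) (ty_app n (tm_bd X n a) ys))"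
  by (simp_all add: perm_jdg_def comp_def ren_basic_ctx del: upt.simps upt_Suc flip: map_map)

lemma ex_perm_upt:
  fixes ys :: "nat list"
  assumes "distinct ys" "length ys = n - 1" shows "\<exists>\<sigma>. bij \<sigma> \<and> map \<sigma> [1..<n] = ys"
  using bij_extension[of "[1..<n]" ys] assms by simp

text \<open>A well-formed type is a renamed basic judgement, weakened from the part of the context that consists
of its arguments.  The types needed for the weakening live over shorter contexts.\<close>

lemma ok_type_derived:
  assumes X: "X \<in> Obj psh_cat" and "ok_ctx X \<Gamma>" "ok_type X \<Gamma> T"
  shows "(\<Gamma> \<turnstile> IsType T) \<in> derived (free_obj X)"
  using assms(2,3)
proof (induction "length \<Gamma>" arbitrary: \<Gamma> T rule: less_induct)
  case less
  obtain n A ys where T: "T = ty_app n A ys"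
    using ok_type_head[OF less.prems(2)] .
  note app = ok_type_app[OF less.prems[unfolded T]]
  obtain \<sigma> where \<sigma>: "bij \<sigma>" "map \<sigma> [1..<n] = ys"
    using ex_perm_upt[OF ok_type_distinct[OF X less.prems[unfolded T]] app(3)] by blast
  have "(filter (\<lambda>p. fst p \<in> set ys) \<Gamma> \<turnstile> IsType T) \<in> derived (free_obj X)"
    using derived_perm[OF \<sigma>(1) basic_derived[OF X, of "Ty n" A]] app
    by (simp add: perm_basic(1)[OF \<sigma>(2)] filter_ok_ctx[OF X less.prems[unfolded T]] T
        del: basic_jdg.simps)
  then show ?case
  proof (rule weaken_filter[OF X less.prems(1)])
    fix \<Gamma>1 y S \<Gamma>2 assume split: "\<Gamma> = \<Gamma>1 @ (y, S) # \<Gamma>2"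
    show "(\<Gamma>1 \<turnstile> IsType S) \<in> derived (free_obj X)"
      using less.hyps[OF _ ok_ctx_prefix(1,2)[OF less.prems(1)[unfolded split]]] by (simp add: split)
  qed
qed

lemma ok_term_derived:
  assumes X: "X \<in> Obj psh_cat" and \<Gamma>: "ok_ctx X \<Gamma>" and t: "ok_term X \<Gamma> t T"
  shows "(\<Gamma> \<turnstile> HasType t T) \<in> derived (free_obj X)"
proof -
  have prefix: "(\<Gamma>1 \<turnstile> IsType S) \<in> derived (free_obj X)" if "\<Gamma> = \<Gamma>1 @ (y, S) # \<Gamma>2" for \<Gamma>1 y S \<Gamma>2
    by (rule ok_type_derived[OF X ok_ctx_prefix(1,2)[OF \<Gamma>[unfolded that]]])
  from t show ?thesis
  proof cases
    case (var x)
    then obtain \<Gamma>1 \<Gamma>2 where split: "\<Gamma> = \<Gamma>1 @ (x, T) # \<Gamma>2" by (meson split_list)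
    note ok = ok_ctx_prefix[OF \<Gamma>[unfolded split]]
    have "x \<notin> fv_ctx \<Gamma>1" using fv_ok_ctx[OF ok(1)] ok(3) by simp
    from derived_rule[OF deduction.intros(11)[OF this]] prefix[OF split]
    have D: "(\<Gamma>1 @ [(x, T)] \<turnstile> HasType t T) \<in> derived (free_obj X)" by (simp add: var)
    \<comment> \<open>The filter selects the prefix of the context that ends in \<open>x\<close>, over which \<open>x\<close> is
       projected out.\<close>
    have "filter (\<lambda>p. p \<in> set (\<Gamma>1 @ [(x, T)])) \<Gamma> = \<Gamma>1 @ [(x, T)]"
    proof -
      have "distinct \<Gamma>" using ok_ctx_distinct[OF \<Gamma>] by (simp add: distinct_map)
      then have "filter (\<lambda>p. p \<in> set (\<Gamma>1 @ [(x, T)])) \<Gamma>2 = []"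
        by (auto simp: split filter_empty_conv)
      then show ?thesis by (simp add: split)
    qed
    with D show ?thesis
      by (intro weaken_filter[OF X \<Gamma> _ prefix, of "\<lambda>p. p \<in> set (\<Gamma>1 @ [(x, T)])"]) (simp only:)
  next
    case (const n a ys)
    note app = ok_type_app[OF \<Gamma> const(5)]
    obtain \<sigma> where \<sigma>: "bij \<sigma>" "map \<sigma> [1..<n] = ys"
      using ex_perm_upt[OF ok_type_distinct[OF X \<Gamma> const(5)] app(3)] by blast
    have "(filter (\<lambda>p. fst p \<in> set ys) \<Gamma> \<turnstile> HasType t T) \<in> derived (free_obj X)"
      using derived_perm[OF \<sigma>(1) basic_derived[OF X, of "Tm n" a]] const
      by (simp add: perm_basic(2)[OF \<sigma>(2)] filter_ok_ctx[OF X \<Gamma> const(5)] del: basic_jdg.simps)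
    then show ?thesis by (rule weaken_filter[OF X \<Gamma> _ prefix])
  qed
qed

lemma derived_iff_ok:
  assumes X: "X \<in> Obj psh_cat"
  shows "J \<in> derived (free_obj X) \<longleftrightarrow> ok_jdg X J"
proof
  assume ok: "ok_jdg X J"
  show "J \<in> derived (free_obj X)"
  proof (cases J)
    case (Jdg \<Gamma> R)
    have "(\<Gamma> \<turnstile> TypeEq T T) \<in> derived (free_obj X)" if "ok_ctx X \<Gamma>" "ok_type X \<Gamma> T" for T
      using derived_rule[OF deduction.intros(4)] ok_type_derived[OF X that] by simp
    moreover have "(\<Gamma> \<turnstile> TermEq t t T) \<in> derived (free_obj X)"
      if "ok_ctx X \<Gamma>" "ok_term X \<Gamma> t T" for t T
      using derived_rule[OF deduction.intros(1)] ok_term_derived[OF X that] by simp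
    ultimately show ?thesis
      using ok ok_type_derived[OF X] ok_term_derived[OF X] by (cases R) (auto simp: Jdg)
  qed
qed (rule derived_ok[OF X])


section \<open>Equivalence of judgements and normal forms\<close>

lemma perm_jdg_simp [simp]: "perm_jdg \<sigma> (\<Gamma> \<turnstile> R) = (ren_ctx \<sigma> \<Gamma> \<turnstile> perm_rhs \<sigma> R)"
  by (simp add: perm_jdg_def comp_def)

lemma perm_rhs_simps [simp]:
  "perm_rhs \<sigma> (IsType T) = IsType (ren \<sigma> T)"
  "perm_rhs \<sigma> (HasType t T) = HasType (ren \<sigma> t) (ren \<sigma> T)"
  "perm_rhs \<sigma> (TypeEq T T') = TypeEq (ren \<sigma> T) (ren \<sigma> T')"
  "perm_rhs \<sigma> (TermEq t t' T) = TermEq (ren \<sigma> t) (ren \<sigma> t') (ren \<sigma> T)"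
  by (simp_all add: comp_def)

declare perm_rhs.simps [simp del]

lemma perm_perm: "perm_jdg \<sigma> (perm_jdg \<rho> J) = perm_jdg (\<sigma> \<circ> \<rho>) J"
  by (cases J; cases "rhs J") (auto simp: ren_ren comp_def)

lemma perm_id: "perm_jdg id J = J"
  by (cases J; cases "rhs J") (auto intro: map_idI)

definition alpha :: "'w jdg \<Rightarrow> 'w jdg \<Rightarrow> bool" where
  "alpha J K \<longleftrightarrow> (\<exists>\<sigma>. bij \<sigma> \<and> K = perm_jdg \<sigma> J)"

lemma alpha_refl: "alpha J J"
  unfolding alpha_def using perm_id bij_id by metis

lemma alpha_sym: "alpha J K \<Longrightarrow> alpha K J"
proof -
  assume "alpha J K"
  then obtain \<sigma> where \<sigma>: "bij \<sigma>" "K = perm_jdg \<sigma> J" by (auto simp: alpha_def)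
  then have "J = perm_jdg (inv \<sigma>) K" by (simp add: perm_perm perm_id bij_is_inj)
  then show ?thesis using bij_imp_bij_inv[OF \<sigma>(1)] by (auto simp: alpha_def)
qed

lemma alpha_trans: "alpha J K \<Longrightarrow> alpha K L \<Longrightarrow> alpha J L"
  unfolding alpha_def using perm_perm bij_comp by metis

definition ty_or_tm :: "'w jdg \<Rightarrow> bool" where
  "ty_or_tm J \<longleftrightarrow> is_type_jdg J \<or> is_term_jdg J"

lemma ty_or_tm_cases:
  assumes "ty_or_tm J"
  obtains (ty) \<Gamma> T where "J = (\<Gamma> \<turnstile> IsType T)" | (tm) \<Gamma> t T where "J = (\<Gamma> \<turnstile> HasType t T)"
  using assms by (auto simp: ty_or_tm_def is_type_jdg_def is_term_jdg_def)

lemma ty_or_tm_simps [simp]: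
  "ty_or_tm (\<Gamma> \<turnstile> IsType T)" "ty_or_tm (\<Gamma> \<turnstile> HasType t T)"
  "\<not> ty_or_tm (\<Gamma> \<turnstile> TypeEq T T')" "\<not> ty_or_tm (\<Gamma> \<turnstile> TermEq t t' T)"
  by (auto simp: ty_or_tm_def is_type_jdg_def is_term_jdg_def)

lemma is_jdg_simps [simp]:
  "is_type_jdg (\<Gamma> \<turnstile> IsType T)" "\<not> is_type_jdg (\<Gamma> \<turnstile> HasType t T)"
  "is_term_jdg (\<Gamma> \<turnstile> HasType t T)" "\<not> is_term_jdg (\<Gamma> \<turnstile> IsType T)"
  by (auto simp: is_type_jdg_def is_term_jdg_def)

lemma var_subst_ren:
  assumes "xs = map \<sigma> ys" "fv e \<subseteq> set ys" shows "var_subst xs ys e = ren \<sigma> e"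
  unfolding var_subst_def
proof (rule subst_cong)
  fix v assume "v \<in> fv e"
  then show "(case map_of (zip ys xs) v of None \<Rightarrow> Var v | Some x \<Rightarrow> Var x) = Var (\<sigma> v)"
    using assms by (auto simp: map_of_zip_map)
qed

lemma ok_ctx_nth:
  assumes "ok_ctx X \<Gamma>" "i < length \<Gamma>"
  shows "ok_ctx X (take i \<Gamma>)" "ok_type X (take i \<Gamma>) (snd (\<Gamma> ! i))"
proof -
  have split: "\<Gamma> = take i \<Gamma> @ (fst (\<Gamma> ! i), snd (\<Gamma> ! i)) # drop (Suc i) \<Gamma>"
    using id_take_nth_drop[OF assms(2)] by simp
  then have "ok_ctx X (take i \<Gamma> @ (fst (\<Gamma> ! i), snd (\<Gamma> ! i)) # drop (Suc i) \<Gamma>)" using assms(1) by simp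
  from ok_ctx_prefix[OF this] show "ok_ctx X (take i \<Gamma>)" "ok_type X (take i \<Gamma>) (snd (\<Gamma> ! i))" by auto
qed

text \<open>Without equality axioms only reflexive equalities are derivable, so the equalities required for
equivalence of judgements say that they agree up to the renaming of their contexts.\<close>

lemma equiv_type_iff:
  assumes X: "X \<in> Obj psh_cat"
    and J: "ok_ctx X \<Gamma>" "ok_type X \<Gamma> S" and K: "ok_ctx X \<Gamma>'" "ok_type X \<Gamma>' S'"
    and \<sigma>: "map fst \<Gamma> = map \<sigma> (map fst \<Gamma>')"
  shows "jdg_equiv (free_obj X) (\<Gamma> \<turnstile> IsType S) (\<Gamma>' \<turnstile> IsType S') \<longleftrightarrow>
    \<Gamma> = ren_ctx \<sigma> \<Gamma>' \<and> S = ren \<sigma> S'"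
proof -
  have len: "length \<Gamma> = length \<Gamma>'" using arg_cong[OF \<sigma>, of length] by simp
  have ok: "ok_ctx X (take i \<Gamma>') \<and> ok_type X (take i \<Gamma>') ((map snd \<Gamma>' @ [S']) ! i)"
    if "i \<le> length \<Gamma>'" for i
    using that K ok_ctx_nth[OF K(1), of i] by (cases "i = length \<Gamma>'") (auto simp: nth_append)
  have ok': "ok_ctx X (take i \<Gamma>) \<and> ok_type X (take i \<Gamma>) ((map snd \<Gamma> @ [S]) ! i)"
    if "i \<le> length \<Gamma>" for i
    using that J ok_ctx_nth[OF J(1), of i] by (cases "i = length \<Gamma>") (auto simp: nth_append)
  have vs: "var_subst (map fst (take i \<Gamma>)) (map fst (take i \<Gamma>')) ((map snd \<Gamma>' @ [S']) ! i) =
      ren \<sigma> ((map snd \<Gamma>' @ [S']) ! i)" if "i \<le> length \<Gamma>'" for i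
  proof (rule var_subst_ren)
    show "map fst (take i \<Gamma>) = map \<sigma> (map fst (take i \<Gamma>'))" using \<sigma> by (metis take_map)
    show "fv ((map snd \<Gamma>' @ [S']) ! i) \<subseteq> set (map fst (take i \<Gamma>'))"
      using ok_type_fv[of X "take i \<Gamma>'"] ok[OF that] by simp
  qed
  have "jdg_equiv (free_obj X) (\<Gamma> \<turnstile> IsType S) (\<Gamma>' \<turnstile> IsType S') \<longleftrightarrow>
    (\<forall>i \<le> length \<Gamma>. (map snd \<Gamma> @ [S]) ! i = ren \<sigma> ((map snd \<Gamma>' @ [S']) ! i))"
    using J K len ok' vs by (subst jdg_equiv.simps) (auto simp: derived_iff_ok[OF X])
  also have "\<dots> \<longleftrightarrow> (\<forall>i < length \<Gamma>. snd (\<Gamma> ! i) = ren \<sigma> (snd (\<Gamma>' ! i))) \<and> S = ren \<sigma> S'"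
    by (auto simp: nth_append len less_Suc_eq_le[symmetric] less_Suc_eq)
  also have "(\<forall>i < length \<Gamma>. snd (\<Gamma> ! i) = ren \<sigma> (snd (\<Gamma>' ! i))) \<longleftrightarrow> \<Gamma> = ren_ctx \<sigma> \<Gamma>'"
  proof -
    have fst_eq: "fst (\<Gamma> ! i) = \<sigma> (fst (\<Gamma>' ! i))" if "i < length \<Gamma>" for i
      using arg_cong[OF \<sigma>, of "\<lambda>l. l ! i"] that len by simp
    have "\<Gamma> ! i = ren_ctx \<sigma> \<Gamma>' ! i \<longleftrightarrow> snd (\<Gamma> ! i) = ren \<sigma> (snd (\<Gamma>' ! i))" if "i < length \<Gamma>" for i
      using that len fst_eq[OF that] by (simp add: prod_eq_iff split_beta)
    then show ?thesis using len by (auto simp: list_eq_iff_nth_eq)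
  qed
  finally show ?thesis .
qed

lemma ex_ctx_renaming:
  assumes "ok_ctx X \<Gamma>" "ok_ctx X' \<Gamma>'" "length \<Gamma> = length \<Gamma>'"
  shows "\<exists>\<sigma>. bij \<sigma> \<and> map fst \<Gamma> = map \<sigma> (map fst \<Gamma>')"
  using bij_extension[of "map fst \<Gamma>'" "map fst \<Gamma>"] assms ok_ctx_distinct by (metis length_map)

lemma jdg_equiv_iff_alpha:
  assumes X: "X \<in> Obj psh_cat"
  shows "jdg_equiv (free_obj X) J K \<longleftrightarrow>
    J \<in> derived (free_obj X) \<and> K \<in> derived (free_obj X) \<and> ty_or_tm J \<and> alpha J K"
proof
  note d = derived_iff_ok[OF X]
  assume "jdg_equiv (free_obj X) J K"
  then show "J \<in> derived (free_obj X) \<and> K \<in> derived (free_obj X) \<and> ty_or_tm J \<and> alpha J K"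
  proof cases
    case (equiv_type \<Gamma> S \<Gamma>' S')
    then have ok: "ok_ctx X \<Gamma>" "ok_type X \<Gamma> S" "ok_ctx X \<Gamma>'" "ok_type X \<Gamma>' S'"
      by (auto simp: d)
    obtain \<sigma> where \<sigma>: "bij \<sigma>" "map fst \<Gamma> = map \<sigma> (map fst \<Gamma>')"
      using ex_ctx_renaming[OF ok(1,3)] equiv_type by blast
    have "J = perm_jdg \<sigma> K"
      using jdg_equiv.equiv_type[OF equiv_type(3-6)] unfolding equiv_type_iff[OF X ok \<sigma>(2)]
      by (simp add: equiv_type(1,2))
    then have "alpha K J" using \<sigma>(1) by (auto simp: alpha_def)
    then show ?thesis using equiv_type alpha_sym by auto
  next
    case (equiv_term \<Gamma> s S \<Gamma>' t S')
    then have ok: "ok_ctx X \<Gamma>" "ok_type X \<Gamma> S" "ok_ctx X \<Gamma>'" "ok_type X \<Gamma>' S'"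
      and t: "ok_term X \<Gamma>' t S'" and st: "s = var_subst (map fst \<Gamma>) (map fst \<Gamma>') t"
      using ok_term_type by (auto simp: d)
    have "length \<Gamma> = length \<Gamma>'" using equiv_term(5) by cases
    then obtain \<sigma> where \<sigma>: "bij \<sigma>" "map fst \<Gamma> = map \<sigma> (map fst \<Gamma>')"
      using ex_ctx_renaming[OF ok(1,3)] by blast
    have "s = ren \<sigma> t" unfolding st using ok_term_fv[OF ok(3) t] by (intro var_subst_ren \<sigma>(2)) auto
    then have "J = perm_jdg \<sigma> K"
      using equiv_term(5) unfolding equiv_type_iff[OF X ok \<sigma>(2)] by (simp add: equiv_term(1,2))
    then have "alpha K J" using \<sigma>(1) by (auto simp: alpha_def)
    then show ?thesis using equiv_term alpha_sym by auto
  qed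
next
  note d = derived_iff_ok[OF X]
  assume a: "J \<in> derived (free_obj X) \<and> K \<in> derived (free_obj X) \<and> ty_or_tm J \<and> alpha J K"
  then obtain \<sigma> where \<sigma>: "bij \<sigma>" "J = perm_jdg \<sigma> K" using alpha_sym[of J K] by (auto simp: alpha_def)
  have JK: "ok_jdg X J" "ok_jdg X K" using a by (auto simp: d)
  have "ty_or_tm K" using a \<sigma>(2) by (cases K; cases "rhs K") auto
  then show "jdg_equiv (free_obj X) J K"
  proof (cases rule: ty_or_tm_cases)
    case (ty \<Gamma>' S')
    have "map fst (ren_ctx \<sigma> \<Gamma>') = map \<sigma> (map fst \<Gamma>')" by auto
    from equiv_type_iff[OF X _ _ _ _ this, of "ren \<sigma> S'" S'] JK show ?thesis
      by (simp add: \<sigma>(2) ty)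
  next
    case (tm \<Gamma>' t S')
    have fst_eq: "map fst (ren_ctx \<sigma> \<Gamma>') = map \<sigma> (map fst \<Gamma>')" by auto
    have ok: "ok_ctx X \<Gamma>'" "ok_term X \<Gamma>' t S'" "ok_ctx X (ren_ctx \<sigma> \<Gamma>')"
      "ok_term X (ren_ctx \<sigma> \<Gamma>') (ren \<sigma> t) (ren \<sigma> S')"
      using JK by (simp_all add: \<sigma>(2) tm)
    have "var_subst (map fst (ren_ctx \<sigma> \<Gamma>')) (map fst \<Gamma>') t = ren \<sigma> t"
      using ok_term_fv[OF ok(1,2)] by (intro var_subst_ren fst_eq) auto
    moreover have "jdg_equiv (free_obj X) (ren_ctx \<sigma> \<Gamma>' \<turnstile> IsType (ren \<sigma> S')) (\<Gamma>' \<turnstile> IsType S')"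
      using equiv_type_iff[OF X _ _ _ _ fst_eq, of "ren \<sigma> S'" S'] ok ok_term_type by blast
    ultimately show ?thesis
      unfolding \<sigma>(2) tm perm_jdg_simp perm_rhs_simps using ok
      by (intro equiv_term) (auto simp: d)
  qed
qed

lemma same_class_iff_alpha:
  assumes X: "X \<in> Obj psh_cat" and J: "J \<in> derived (free_obj X)" "ty_or_tm J"
  shows "same_class (free_obj X) J K \<longleftrightarrow> alpha J K"
proof
  assume "same_class (free_obj X) J K"
  then show "alpha J K"
    unfolding same_class_def
  proof (induction rule: equivclp_induct)
    case base
    show ?case by (rule alpha_refl)
  next
    case (step K L)
    then show ?case using jdg_equiv_iff_alpha[OF X] alpha_sym alpha_trans by metis
  qed
next
  assume \<alpha>: "alpha J K"
  then have "K \<in> derived (free_obj X)" using derived_perm[OF _ J(1)] by (auto simp: alpha_def)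
  then have "jdg_equiv (free_obj X) J K" using J \<alpha> by (simp add: jdg_equiv_iff_alpha[OF X])
  then show "same_class (free_obj X) J K" unfolding same_class_def by (rule r_into_equivclp)
qed

lemma class_of_eq_iff:
  fixes X :: "'u::infinite psh"
  assumes X: "X \<in> Obj psh_cat" and J: "J \<in> derived (free_obj X)" "ty_or_tm J"
    and K: "K \<in> derived (free_obj X)" "ty_or_tm K"
  shows "class_of (free_obj X) J = class_of (free_obj X) K \<longleftrightarrow> alpha J K"
proof
  note sJ = same_class_iff_alpha[OF X J] and sK = same_class_iff_alpha[OF X K]
  assume "class_of (free_obj X) J = class_of (free_obj X) K"
  then have "(SOME L. alpha J L) = (SOME L. alpha K L)"
    unfolding class_of_def sJ sK by (rule injD[OF inj_code])
  then have "alpha J (SOME L. alpha J L)" "alpha K (SOME L. alpha J L)"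
    using alpha_refl someI[of "alpha J"] someI[of "alpha K"] by metis+
  then show "alpha J K" using alpha_sym alpha_trans by blast
next
  note sJ = same_class_iff_alpha[OF X J] and sK = same_class_iff_alpha[OF X K]
  assume "alpha J K"
  then have "alpha J L \<longleftrightarrow> alpha K L" for L using alpha_sym alpha_trans by blast
  then show "class_of (free_obj X) J = class_of (free_obj X) K" unfolding class_of_def sJ sK by simp
qed

definition normal :: "'w jdg \<Rightarrow> bool" where
  "normal J \<longleftrightarrow> map fst (ctx J) = [1..<degree J]"

lemma perm_jdg_ident:
  assumes ok: "ok_jdg X J" and \<sigma>: "\<And>v. v \<in> fst ` set (ctx J) \<Longrightarrow> \<sigma> v = v"
  shows "perm_jdg \<sigma> J = J"
proof (cases J)
  case (Jdg \<Gamma> R)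
  have \<Gamma>: "ok_ctx X \<Gamma>" and R: "ok_rhs X \<Gamma> R" using ok by (simp_all add: Jdg)
  have ty: "ren \<sigma> T = T" if "ok_type X \<Gamma> T" for T
    by (rule ren_ident) (use ok_type_fv[OF \<Gamma> that] \<sigma> in \<open>auto simp: Jdg\<close>)
  have tm: "ren \<sigma> t = t" if "ok_term X \<Gamma> t T" for t T
    by (rule ren_ident) (use ok_term_fv[OF \<Gamma> that] \<sigma> in \<open>auto simp: Jdg\<close>)
  have "ren_ctx \<sigma> \<Gamma> = \<Gamma>"
    using \<sigma> ty ok_ctx_type[OF \<Gamma>] by (intro map_idI) (force simp: Jdg)
  moreover have "perm_rhs \<sigma> R = R"
    using R ty tm ok_term_type[OF \<Gamma>] by (cases R) auto
  ultimately show ?thesis by (simp add: Jdg)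
qed

text \<open>A derivable judgement is closed, so a renaming that fixes the variables of its context fixes it.\<close>

lemma alpha_same_vars:
  assumes "ok_jdg X J" "alpha J K" "map fst (ctx J) = map fst (ctx K)"
  shows "J = K"
proof -
  obtain \<sigma> where \<sigma>: "K = perm_jdg \<sigma> J" using assms(2) by (auto simp: alpha_def)
  have "map \<sigma> (map fst (ctx J)) = map fst (ctx J)"
    using assms(3) by (cases J) (auto simp: \<sigma> comp_def split_beta)
  then have "\<sigma> v = v" if "v \<in> fst ` set (ctx J)" for v
    using that map_eq_conv[of \<sigma> "map fst (ctx J)" id] by auto
  then show ?thesis using perm_jdg_ident[OF assms(1)] \<sigma> by simp
qed

lemma alpha_preserves:
  assumes "alpha J K"
  shows "degree K = degree J" "is_type_jdg K \<longleftrightarrow> is_type_jdg J" "is_term_jdg K \<longleftrightarrow> is_term_jdg J"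
  using assms by (cases J; cases "rhs J"; auto simp: alpha_def degree_def is_type_jdg_def is_term_jdg_def)+

lemma alpha_jdgs_at:
  assumes "alpha J K" "J \<in> jdgs_at T x" shows "K \<in> jdgs_at T x"
proof -
  have "K \<in> derived T" if "J \<in> derived T"
    using assms(1) derived_perm[OF _ that] by (auto simp: alpha_def)
  then show ?thesis using assms(2) alpha_preserves[OF assms(1)] by (cases x) auto
qed

lemma jdgs_atD: "J \<in> jdgs_at T x \<Longrightarrow> J \<in> derived T \<and> ty_or_tm J"
  by (cases x) (auto simp: ty_or_tm_def)

lemma normal_exists:
  assumes "X \<in> Obj psh_cat" "J \<in> derived (free_obj X)"
  shows "\<exists>K. alpha J K \<and> normal K"
proof -
  have dist: "distinct (map fst (ctx J))"
    using assms derived_iff_ok[OF assms(1)] ok_ctx_distinct by (auto simp: ok_jdg_def)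
  have "length (map fst (ctx J)) = length [1..<degree J]" by (simp add: degree_def del: upt_Suc)
  from bij_extension[OF this dist distinct_upt]
  obtain \<sigma> where \<sigma>: "bij \<sigma>" "map \<sigma> (map fst (ctx J)) = [1..<degree J]" by blast
  then have "normal (perm_jdg \<sigma> J)"
    by (cases J) (simp add: normal_def degree_def comp_def split_beta del: upt_Suc)
  then show ?thesis using \<sigma>(1) by (auto simp: alpha_def)
qed

abbreviation P_obj :: "'u psh \<Rightarrow> 'u psh" where
  "P_obj X \<equiv> forget_obj (free_obj X)"

text \<open>Since the variables of a context are distinct, each class contains exactly one normal judgement.\<close>

definition norm_jdg :: "'u psh \<Rightarrow> 'u \<Rightarrow> 'u ujdg" where
  "norm_jdg X u = (SOME J. normal J \<and> J \<in> derived (free_obj X) \<and> ty_or_tm J \<and>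
     class_of (free_obj X) J = u)"

lemma P_obj_elements: "x \<in> Obj H_cat \<Longrightarrow> omap (P_obj X) x = class_of (free_obj X) ` jdgs_at (free_obj X) x"
  by (simp add: forget_obj_def)

lemma class_of_in: "x \<in> Obj H_cat \<Longrightarrow> J \<in> jdgs_at (free_obj X) x \<Longrightarrow> class_of (free_obj X) J \<in> omap (P_obj X) x"
  by (simp add: P_obj_elements)

lemma norm_class_of:
  fixes X :: "'u::infinite psh"
  assumes X: "X \<in> Obj psh_cat" and J: "J \<in> derived (free_obj X)" "ty_or_tm J"
  shows "alpha J (norm_jdg X (class_of (free_obj X) J))"
    and "normal (norm_jdg X (class_of (free_obj X) J))"
    and "normal J \<Longrightarrow> norm_jdg X (class_of (free_obj X) J) = J"
proof -
  let ?N = "norm_jdg X (class_of (free_obj X) J)"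
  obtain K where K: "alpha J K" "normal K" using normal_exists[OF X J(1)] by blast
  then have "K \<in> derived (free_obj X)" "ty_or_tm K"
    using derived_perm[OF _ J(1)] J(2) alpha_preserves[OF K(1)] by (auto simp: alpha_def ty_or_tm_def)
  then have "normal K \<and> K \<in> derived (free_obj X) \<and> ty_or_tm K \<and>
      class_of (free_obj X) K = class_of (free_obj X) J"
    using K class_of_eq_iff[OF X J, of K] by (intro conjI) (assumption, simp_all)
  then have N: "normal ?N \<and> ?N \<in> derived (free_obj X) \<and> ty_or_tm ?N \<and>
      class_of (free_obj X) ?N = class_of (free_obj X) J"
    unfolding norm_jdg_def by (rule someI)
  then show \<alpha>: "alpha J ?N" and "normal ?N" using class_of_eq_iff[OF X J, of ?N] by simp_all
  then have "degree ?N = degree J" using alpha_preserves by blast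
  then show "?N = J" if "normal J"
    using alpha_same_vars[of X J ?N] \<alpha> N that J derived_iff_ok[OF X]
    unfolding normal_def by metis
qed

lemma norm_jdg:
  fixes X :: "'u::infinite psh"
  assumes X: "X \<in> Obj psh_cat" and x: "x \<in> Obj H_cat" "u \<in> omap (P_obj X) x"
  shows "norm_jdg X u \<in> jdgs_at (free_obj X) x" "normal (norm_jdg X u)"
    "class_of (free_obj X) (norm_jdg X u) = u"
proof -
  obtain J where J: "J \<in> jdgs_at (free_obj X) x" "u = class_of (free_obj X) J"
    using x by (auto simp: P_obj_elements)
  have d: "J \<in> derived (free_obj X)" "ty_or_tm J" using jdgs_atD[OF J(1)] by auto
  note N = norm_class_of[OF X d, folded J(2)]
  show 1: "norm_jdg X u \<in> jdgs_at (free_obj X) x" by (rule alpha_jdgs_at[OF N(1) J(1)])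
  show "normal (norm_jdg X u)" by (rule N(2))
  show "class_of (free_obj X) (norm_jdg X u) = u"
    using class_of_eq_iff[OF X d, of "norm_jdg X u"] N(1) jdgs_atD[OF 1] J(2) by simp
qed

lemma norm_jdg_ok:
  fixes X :: "'u::infinite psh"
  assumes "X \<in> Obj psh_cat" "x \<in> Obj H_cat" "u \<in> omap (P_obj X) x"
  shows "ok_jdg X (norm_jdg X u)" "ty_or_tm (norm_jdg X u)"
  using jdgs_atD[OF norm_jdg(1)[OF assms]] derived_iff_ok[OF assms(1)] by auto

lemma norm_jdg_inj:
  fixes X :: "'u::infinite psh"
  assumes "X \<in> Obj psh_cat" "x \<in> Obj H_cat" "u \<in> omap (P_obj X) x" "v \<in> omap (P_obj X) x"
    "norm_jdg X u = norm_jdg X v"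
  shows "u = v"
  using norm_jdg(3)[OF assms(1-3)] norm_jdg(3)[OF assms(1,2,4)] assms(5) by metis

lemma boundary_perm: "boundary (perm_jdg \<sigma> J) = map (perm_jdg \<sigma>) (boundary J)"
proof (cases J)
  case (Jdg \<Gamma> R)
  show ?thesis by (cases R) (auto simp: Jdg map_butlast last_map split_beta)
qed

lemma boundary_derived:
  assumes X: "X \<in> Obj psh_cat" and J: "J \<in> derived (free_obj X)"
  shows "set (boundary J) \<subseteq> derived (free_obj X)"
proof (cases J)
  case (Jdg \<Gamma> R)
  have ok: "ok_ctx X \<Gamma>" "ok_rhs X \<Gamma> R" using J by (simp_all add: derived_iff_ok[OF X] Jdg)
  have pre: "ok_ctx X (butlast \<Gamma>) \<and> ok_type X (butlast \<Gamma>) (snd (last \<Gamma>))" if "\<Gamma> \<noteq> []"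
  proof -
    have "ok_ctx X (butlast \<Gamma> @ [(fst (last \<Gamma>), snd (last \<Gamma>))])" using ok(1) that by simp
    then show ?thesis unfolding ok_ctx_snoc by blast
  qed
  have tm: "ok_type X \<Gamma> T" if "ok_term X \<Gamma> t T" for t T
    using ok_term_type[OF ok(1) that] .
  show ?thesis
    by (cases R; cases "\<Gamma> = []") (use ok pre tm in \<open>simp_all add: derived_iff_ok[OF X] Jdg\<close>)
qed

lemma boundary_edge:
  assumes e: "e \<in> hedges" and J: "J \<in> jdgs_at (free_obj X) (htgt e)" and X: "X \<in> Obj psh_cat"
  shows "\<exists>K. boundary J = [K] \<and> K \<in> jdgs_at (free_obj X) (hsrc e)"
proof -
  have d: "set (boundary J) \<subseteq> derived (free_obj X)" using boundary_derived[OF X] jdgs_atD[OF J] by blast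
  show ?thesis
  proof (cases e)
    case (Next n)
    then obtain \<Gamma> T where "J = (\<Gamma> \<turnstile> IsType T)" "length \<Gamma> = n" "n \<ge> 1"
      using J e by (auto simp: is_type_jdg_def degree_def)
    then show ?thesis using d Next by (auto simp: degree_def split: if_splits)
  next
    case (Term n)
    then obtain \<Gamma> t T where "J = (\<Gamma> \<turnstile> HasType t T)" "n = length \<Gamma> + 1"
      using J by (auto simp: is_term_jdg_def degree_def)
    then show ?thesis using d Term by (auto simp: degree_def)
  qed
qed

lemma alpha_boundary:
  assumes "alpha J K" "boundary J \<noteq> []" shows "alpha (hd (boundary J)) (hd (boundary K))"
  using assms by (auto simp: alpha_def boundary_perm hd_map)

definition P_bd :: "'u psh \<Rightarrow> hedge \<Rightarrow> 'u \<Rightarrow> 'u" where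
  "P_bd X e u = class_of (free_obj X) (hd (boundary (norm_jdg X u)))"

lemma P_bd_class_of:
  fixes X :: "'u::infinite psh"
  assumes X: "X \<in> Obj psh_cat" and e: "e \<in> hedges" and J: "J \<in> jdgs_at (free_obj X) (htgt e)"
  shows "P_bd X e (class_of (free_obj X) J) = class_of (free_obj X) (hd (boundary J))"
proof -
  have d: "J \<in> derived (free_obj X)" "ty_or_tm J" using jdgs_atD[OF J] by auto
  let ?N = "norm_jdg X (class_of (free_obj X) J)"
  note N = norm_class_of(1)[OF X d]
  obtain K where K: "boundary J = [K]" "K \<in> jdgs_at (free_obj X) (hsrc e)"
    using boundary_edge[OF e J X] by blast
  obtain L where L: "boundary ?N = [L]" "L \<in> jdgs_at (free_obj X) (hsrc e)"
    using boundary_edge[OF e alpha_jdgs_at[OF N J] X] by blast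
  have "alpha K L" using alpha_boundary[OF N] K L by simp
  then show ?thesis
    using class_of_eq_iff[OF X, of K L] jdgs_atD[OF K(2)] jdgs_atD[OF L(2)] K(1) L(1)
    by (simp add: P_bd_def)
qed

lemma member_alpha:
  fixes X :: "'u::infinite psh"
  assumes X: "X \<in> Obj psh_cat" and J: "J \<in> derived (free_obj X)" "ty_or_tm J"
  shows "alpha J (member (free_obj X) (class_of (free_obj X) J))"
proof -
  let ?M = "member (free_obj X) (class_of (free_obj X) J)"
  have "?M \<in> derived (free_obj X) \<and> (is_type_jdg ?M \<or> is_term_jdg ?M) \<and>
      class_of (free_obj X) ?M = class_of (free_obj X) J"
    unfolding member_def by (rule someI[of _ J]) (use J in \<open>simp add: ty_or_tm_def\<close>)
  then show ?thesis using class_of_eq_iff[OF X J, of ?M] by (simp add: ty_or_tm_def)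
qed

text \<open>The forgetful functor computes boundaries on chosen members of the classes.  They may be computed on
normal forms instead, as renaming commutes with boundaries.\<close>

lemma P_obj_eq:
  fixes X :: "'u::infinite psh"
  assumes X: "X \<in> Obj psh_cat"
  shows "P_obj X = psh_of (\<lambda>x. class_of (free_obj X) ` jdgs_at (free_obj X) x) (P_bd X)"
proof -
  let ?T = "free_obj X" and ?b = "\<lambda>J :: 'u ujdg. hd (boundary J)"
  have iter: "(?b ^^ length es) J \<in> jdgs_at ?T a \<and>
      foldr (P_bd X) es (class_of ?T J) = class_of ?T ((?b ^^ length es) J)"
    if "is_path hedges hsrc htgt a es b" "J \<in> jdgs_at ?T b" for a es b J
    using that
  proof (induction es arbitrary: a)
    case (Cons e es)
    then have e: "e \<in> hedges" "a = hsrc e" and IH: "(?b ^^ length es) J \<in> jdgs_at ?T (htgt e)"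
      "foldr (P_bd X) es (class_of ?T J) = class_of ?T ((?b ^^ length es) J)" by auto
    then show ?case using boundary_edge[OF e(1) IH(1) X] P_bd_class_of[OF X e(1) IH(1)] by auto
  qed simp
  have "class_of ?T ((?b ^^ length es) (member ?T u)) = foldr (P_bd X) es u"
    if m: "(a, es, b) \<in> Arr H_cat" and u: "u \<in> class_of ?T ` jdgs_at ?T b" for a es b u
  proof -
    obtain J where J: "J \<in> jdgs_at ?T b" "u = class_of ?T J" using u by blast
    have d: "J \<in> derived ?T" "ty_or_tm J" using jdgs_atD[OF J(1)] by auto
    have M: "member ?T u \<in> jdgs_at ?T b"
      using alpha_jdgs_at[OF member_alpha[OF X d] J(1)] J(2) by simp
    then have "class_of ?T (member ?T u) = u"
      using class_of_eq_iff[OF X d, of "member ?T u"] member_alpha[OF X d] J(2) jdgs_atD[OF M] by simp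
    then show ?thesis using iter[of a es b, OF _ M] m by (simp add: Arr_H)
  qed
  then show ?thesis unfolding forget_obj_def psh_of_def by (auto intro!: restrict_ext)
qed

lemma P_obj_Obj:
  fixes X :: "'u::infinite psh"
  assumes X: "X \<in> Obj psh_cat"
  shows "P_obj X \<in> Obj psh_cat"
  unfolding P_obj_eq[OF X]
proof (rule psh_of_Obj)
  fix e u assume e: "e \<in> hedges" and "u \<in> class_of (free_obj X) ` jdgs_at (free_obj X) (htgt e)"
  then obtain J where J: "J \<in> jdgs_at (free_obj X) (htgt e)" "u = class_of (free_obj X) J" by blast
  then show "P_bd X e u \<in> class_of (free_obj X) ` jdgs_at (free_obj X) (hsrc e)"
    using boundary_edge[OF e J(1) X] P_bd_class_of[OF X e J(1)] by auto
qed

lemma bd_P_obj: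
  fixes X :: "'u::infinite psh"
  assumes X: "X \<in> Obj psh_cat" and e: "e \<in> hedges" and J: "J \<in> jdgs_at (free_obj X) (htgt e)"
  shows "bd (P_obj X) e (class_of (free_obj X) J) = class_of (free_obj X) (hd (boundary J))"
  unfolding P_obj_eq[OF X] using J P_bd_class_of[OF X e J] by (subst bd_psh_of[OF e]) auto

lemma boundary_normal:
  assumes "normal J" "boundary J = [K]" "ty_or_tm J" shows "normal K"
  using assms(3)
proof (cases rule: ty_or_tm_cases)
  case (ty \<Gamma> T)
  then have "\<Gamma> \<noteq> []" and K: "K = (butlast \<Gamma> \<turnstile> IsType (snd (last \<Gamma>)))"
    using assms(2) by (auto split: if_splits)
  then have len: "length \<Gamma> \<ge> 1" by (cases \<Gamma>) auto
  then have deg: "degree K = length \<Gamma>" by (simp add: K degree_def)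
  have "map fst (butlast \<Gamma>) = butlast [1..<Suc (length \<Gamma>)]"
    using assms(1) by (simp add: map_butlast normal_def degree_def ty)
  then show ?thesis unfolding normal_def deg using len by (simp add: K)
next
  case (tm \<Gamma> t T)
  then show ?thesis using assms(1,2) by (auto simp: normal_def degree_def)
qed

lemma norm_jdg_bd:
  fixes X :: "'u::infinite psh"
  assumes X: "X \<in> Obj psh_cat" and e: "e \<in> hedges" and u: "u \<in> omap (P_obj X) (htgt e)"
  shows "boundary (norm_jdg X u) = [norm_jdg X (bd (P_obj X) e u)]"
proof -
  have t: "htgt e \<in> Obj H_cat" using hedge_Obj_H[OF e] by simp
  note N = norm_jdg[OF X t u]
  obtain K where K: "boundary (norm_jdg X u) = [K]" "K \<in> jdgs_at (free_obj X) (hsrc e)"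
    using boundary_edge[OF e N(1) X] by blast
  have "normal K" using boundary_normal[OF N(2) K(1)] jdgs_atD[OF N(1)] by simp
  moreover have "bd (P_obj X) e u = class_of (free_obj X) K"
    using bd_P_obj[OF X e N(1)] K(1) N(3) by simp
  ultimately show ?thesis using norm_class_of(3)[OF X, of K] jdgs_atD[OF K(2)] K(1) by simp
qed


section \<open>Interpretations given by translating expressions\<close>

primrec rhs_map :: "('v expr \<Rightarrow> 'w expr) \<Rightarrow> 'v rhs \<Rightarrow> 'w rhs" where
  "rhs_map \<tau> (IsType T) = IsType (\<tau> T)"
| "rhs_map \<tau> (HasType t T) = HasType (\<tau> t) (\<tau> T)"
| "rhs_map \<tau> (TypeEq T T') = TypeEq (\<tau> T) (\<tau> T')"
| "rhs_map \<tau> (TermEq t t' T) = TermEq (\<tau> t) (\<tau> t') (\<tau> T)"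

definition jdg_map :: "('v expr \<Rightarrow> 'w expr) \<Rightarrow> 'v jdg \<Rightarrow> 'w jdg" where
  "jdg_map \<tau> J = (map (apsnd \<tau>) (ctx J) \<turnstile> rhs_map \<tau> (rhs J))"

lemma jdg_map_simp [simp]: "jdg_map \<tau> (\<Gamma> \<turnstile> R) = (map (apsnd \<tau>) \<Gamma> \<turnstile> rhs_map \<tau> R)"
  by (simp add: jdg_map_def)

lemma map_jdg_eq_jdg_map: "map_jdg h J = jdg_map (map_expr h) J"
  by (cases J; cases "rhs J") (auto simp: apsnd_def)

lemma jdg_map_comp: "jdg_map \<tau> (jdg_map \<rho> J) = jdg_map (\<lambda>e. \<tau> (\<rho> e)) J"
  by (cases J; cases "rhs J") (auto simp: apsnd_def)

lemma jdg_map_preserves [simp]: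
  "map fst (ctx (jdg_map \<tau> J)) = map fst (ctx J)"
  "degree (jdg_map \<tau> J) = degree J"
  "is_type_jdg (jdg_map \<tau> J) = is_type_jdg J"
  "is_term_jdg (jdg_map \<tau> J) = is_term_jdg J"
  "ty_or_tm (jdg_map \<tau> J) = ty_or_tm J"
  "normal (jdg_map \<tau> J) = normal J"
  by (cases J; cases "rhs J"; simp add: degree_def ty_or_tm_def is_type_jdg_def is_term_jdg_def normal_def)+

lemma boundary_jdg_map: "boundary (jdg_map \<tau> J) = map (jdg_map \<tau>) (boundary J)"
proof (cases J)
  case (Jdg \<Gamma> R)
  show ?thesis by (cases R) (auto simp: Jdg map_butlast last_map)
qed

text \<open>The conditions under which mapping all expressions of a judgement respects the deduction rules:
projection introduces variables as terms, weakening has a freshness condition, and renaming must be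
compatible.\<close>

definition translation :: "('v expr \<Rightarrow> 'w expr) \<Rightarrow> bool" where
  "translation \<tau> \<longleftrightarrow> (\<forall>x. \<tau> (Var x) = Var x) \<and> (\<forall>e. fv (\<tau> e) \<subseteq> fv e) \<and>
     (\<forall>\<sigma> e. \<tau> (ren \<sigma> e) = ren \<sigma> (\<tau> e))"

lemma jdg_map_perm:
  assumes "translation \<tau>"
  shows "jdg_map \<tau> (perm_jdg \<sigma> J) = perm_jdg \<sigma> (jdg_map \<tau> J)"
proof (cases J)
  case (Jdg \<Gamma> R)
  have "\<tau> (ren \<sigma> e) = ren \<sigma> (\<tau> e)" for e using assms by (simp add: translation_def)
  then show ?thesis by (cases R) (auto simp: Jdg)
qed

lemma alpha_jdg_map: "translation \<tau> \<Longrightarrow> alpha J K \<Longrightarrow> alpha (jdg_map \<tau> J) (jdg_map \<tau> K)"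
  unfolding alpha_def by (auto simp: jdg_map_perm)

lemma fv_ctx_translation:
  assumes "translation \<tau>" shows "fv_ctx (map (apsnd \<tau>) \<Gamma>) \<subseteq> fv_ctx \<Gamma>"
proof (induction \<Gamma>)
  case (Cons p \<Gamma>)
  have "fv (\<tau> (snd p)) \<subseteq> fv (snd p)" using assms by (simp add: translation_def)
  with Cons show ?case by (auto simp: fv_ctx_def split_beta)
qed (simp add: fv_ctx_def)

lemma deduction_jdg_map:
  assumes \<tau>: "translation \<tau>" and "deduction r Js J"
  shows "deduction r (map (jdg_map \<tau>) Js) (jdg_map \<tau> J)"
  using assms(2)
proof cases
  case (9 \<sigma> J')
  then show ?thesis by (simp add: jdg_map_perm[OF \<tau>] deduction.intros)
next
  case (10 y \<Gamma> \<Delta> T R)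
  have "y \<notin> fv_ctx (map (apsnd \<tau>) \<Gamma>) \<union> fv_ctx (map (apsnd \<tau>) \<Delta>)"
    using 10(4) fv_ctx_translation[OF \<tau>, of \<Gamma>] fv_ctx_translation[OF \<tau>, of \<Delta>] by blast
  from deduction.intros(10)[OF this] show ?thesis by (simp add: 10)
next
  case (11 y \<Gamma> T)
  have "y \<notin> fv_ctx (map (apsnd \<tau>) \<Gamma>)" using 11(4) fv_ctx_translation[OF \<tau>, of \<Gamma>] by blast
  moreover have "\<tau> (Var y) = Var y" using \<tau> by (simp add: translation_def)
  ultimately show ?thesis using deduction.intros(11) by (simp add: 11)
qed (auto intro: deduction.intros)

lemma deduction_functional: "deduction r Js J \<Longrightarrow> deduction r Js J' \<Longrightarrow> J = J'"
  by (erule deduction.cases; erule deduction.cases) auto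

lemma jdg_map_derived:
  assumes \<tau>: "translation \<tau>" and basic: "\<And>J. J \<in> basic T \<Longrightarrow> jdg_map \<tau> J \<in> derived U"
    and J: "J \<in> derived T"
  shows "jdg_map \<tau> J \<in> derived U"
  using J unfolding derived_def[of T]
proof (induction rule: derived_from.induct)
  case (1 r Js J)
  then show ?case by (intro derived_rule[OF deduction_jdg_map[OF \<tau> 1(1)]]) auto
next
  case (2 J)
  then show ?case using basic by blast
qed

lemma interpretation_jdg_map:
  assumes X: "X \<in> Obj psh_cat" and \<tau>: "translation \<tau>"
    and der: "\<And>J. J \<in> derived (free_obj X) \<Longrightarrow> jdg_map \<tau> J \<in> derived U"
  shows "interpretation_of (free_obj X) U (\<lambda>J \<in> derived (free_obj X). jdg_map \<tau> J)"
  unfolding interpretation_of_def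
proof (intro conjI ballI allI impI)
  let ?\<phi> = "\<lambda>J \<in> derived (free_obj X). jdg_map \<tau> J"
  have map_eq: "map ?\<phi> Js = map (jdg_map \<tau>) Js" if "set Js \<subseteq> derived (free_obj X)" for Js
    using that by auto
  show "?\<phi> \<in> derived (free_obj X) \<rightarrow>\<^sub>E derived U" using der by auto
  show "boundary (?\<phi> J) = map ?\<phi> (boundary J)" if "J \<in> derived (free_obj X)" for J
    using that boundary_derived[OF X that] by (simp add: boundary_jdg_map map_eq)
  fix r Js J J'
  assume a: "set Js \<subseteq> derived (free_obj X) \<and> deduction r Js J \<and> deduction r (map ?\<phi> Js) J'"
  then have "J \<in> derived (free_obj X)" using derived_rule by blast
  moreover have "jdg_map \<tau> J = J'"
    using deduction_functional[OF deduction_jdg_map[OF \<tau>], of r Js J J'] a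
    unfolding map_eq[OF conjunct1[OF a]] by blast
  ultimately show "?\<phi> J = J'" by simp
qed

text \<open>An arbitrary interpretation between free theories commutes with permutations of variables, and
judgements are closed, so it introduces no variables.  As it also preserves boundaries, it preserves
contexts variable by variable.  For this the form of a judgement has to be preserved too, although a
boundary does not determine it: both a type and a term judgement may have a single type judgement as
their boundary.\<close>

context
  fixes X Y :: "'u psh" and \<psi>
  assumes X: "X \<in> Obj psh_cat" and Y: "Y \<in> Obj psh_cat"
    and \<psi>: "interpretation_of (free_obj Y) (free_obj X) \<psi>"
begin

lemma interpretation_in: "J \<in> derived (free_obj Y) \<Longrightarrow> \<psi> J \<in> derived (free_obj X)"
  using \<psi> unfolding interpretation_of_def by blast

lemma interpretation_boundary: "J \<in> derived (free_obj Y) \<Longrightarrow> boundary (\<psi> J) = map \<psi> (boundary J)"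
  using \<psi> unfolding interpretation_of_def by blast

lemma interpretation_rule:
  "set Js \<subseteq> derived (free_obj Y) \<Longrightarrow> deduction r Js J \<Longrightarrow> deduction r (map \<psi> Js) J' \<Longrightarrow> \<psi> J = J'"
  using \<psi> unfolding interpretation_of_def by blast

lemma interpretation_no_new_vars:
  assumes J: "J \<in> derived (free_obj Y)"
  shows "fst ` set (ctx (\<psi> J)) \<subseteq> fst ` set (ctx J)"
proof
  fix v assume v: "v \<in> fst ` set (ctx (\<psi> J))"
  show "v \<in> fst ` set (ctx J)"
  proof (rule ccontr)
    assume nv: "v \<notin> fst ` set (ctx J)"
    have "finite (insert v (fst ` set (ctx J)))" by simp
    from ex_new_if_finite[OF infinite_UNIV_nat this]
    obtain w where w: "w \<noteq> v" "w \<notin> fst ` set (ctx J)" by blast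
    \<comment> \<open>The transposition of \<open>v\<close> with a fresh variable fixes \<open>J\<close>, hence its image, which
       would not be so if \<open>v\<close> occurred there.\<close>
    define \<sigma> where "\<sigma> z = (if z = v then w else if z = w then v else z)" for z
    have \<sigma>: "bij \<sigma>" by (rule involuntory_imp_bij) (auto simp: \<sigma>_def)
    have "perm_jdg \<sigma> J = J"
      by (rule perm_jdg_ident[of Y])
         (use J nv w in \<open>auto simp: derived_iff_ok[OF Y] \<sigma>_def\<close>)
    then have "deduction (Perm \<sigma>) [J] J" using deduction.intros(9)[OF \<sigma>, of J] by simp
    from interpretation_rule[OF _ this, of "perm_jdg \<sigma> (\<psi> J)"]
    have "perm_jdg \<sigma> (\<psi> J) = \<psi> J" using J deduction.intros(9)[OF \<sigma>, of "\<psi> J"] by simp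
    then have "map fst (ctx (perm_jdg \<sigma> (\<psi> J))) = map fst (ctx (\<psi> J))" by simp
    then have "map \<sigma> (map fst (ctx (\<psi> J))) = map id (map fst (ctx (\<psi> J)))"
      by (simp add: perm_jdg_def comp_def split_beta)
    then have "\<sigma> v = v" using v unfolding map_eq_conv by auto
    then show False using w by (simp add: \<sigma>_def)
  qed
qed

text \<open>Every type judgement is the boundary of another judgement, by weakening a type by itself, and the only
member of a one-element boundary is a type judgement.\<close>

lemma interpretation_is_type:
  assumes J: "(\<Gamma> \<turnstile> IsType T) \<in> derived (free_obj Y)"
  shows "\<exists>\<Delta> S. \<psi> (\<Gamma> \<turnstile> IsType T) = (\<Delta> \<turnstile> IsType S)"
proof -
  have ok: "ok_ctx Y \<Gamma>" "ok_type Y \<Gamma> T" using J by (simp_all add: derived_iff_ok[OF Y])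
  have "finite (fst ` set \<Gamma>)" by simp
  from ex_new_if_finite[OF infinite_UNIV_nat this] obtain y where y: "y \<notin> fst ` set \<Gamma>" by blast
  \<comment> \<open>The judgement whose boundary is the given one.\<close>
  have "(\<Gamma> @ [(y, T)] \<turnstile> IsType T) \<in> derived (free_obj Y)"
    using ok y ok_type_mono[OF ok(2)] by (simp add: derived_iff_ok[OF Y] subset_insertI)
  from interpretation_boundary[OF this] have "boundary (\<psi> (\<Gamma> @ [(y, T)] \<turnstile> IsType T)) = [\<psi> (\<Gamma> \<turnstile> IsType T)]"
    by simp
  moreover have "\<exists>\<Delta> S. L = (\<Delta> \<turnstile> IsType S)" if "boundary K = [L]" for K L :: "'u ujdg"
    using that by (cases K rule: boundary.cases) (auto split: if_splits)
  ultimately show ?thesis by blast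
qed

lemma interpretation_type_vars:
  assumes "(\<Gamma> \<turnstile> IsType T) \<in> derived (free_obj Y)"
  shows "map fst (ctx (\<psi> (\<Gamma> \<turnstile> IsType T))) = map fst \<Gamma>"
  using assms
proof (induction \<Gamma> arbitrary: T rule: rev_induct)
  case Nil
  obtain \<Delta> S where \<Delta>: "\<psi> ([] \<turnstile> IsType T) = (\<Delta> \<turnstile> IsType S)" using interpretation_is_type[OF Nil] by blast
  then show ?case using interpretation_boundary[OF Nil] by (simp split: if_splits)
next
  case (snoc p \<Gamma>)
  obtain x S where p: "p = (x, S)" by (cases p)
  let ?J = "\<Gamma> @ [(x, S)] \<turnstile> IsType T"
  have J: "?J \<in> derived (free_obj Y)" using snoc.prems by (simp add: p)
  then have K: "(\<Gamma> \<turnstile> IsType S) \<in> derived (free_obj Y)" using boundary_derived[OF Y J] by simp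
  note IH = snoc.IH[OF K]
  obtain \<Delta> S' where \<Delta>: "\<psi> ?J = (\<Delta> \<turnstile> IsType S')" using interpretation_is_type[OF J] by blast
  have bdy: "boundary (\<psi> ?J) = [\<psi> (\<Gamma> \<turnstile> IsType S)]" using interpretation_boundary[OF J] by simp
  then have ne: "\<Delta> \<noteq> []" and but: "ctx (\<psi> (\<Gamma> \<turnstile> IsType S)) = butlast \<Delta>"
    by (auto simp: \<Delta> split: if_splits) (metis jdg.sel(1))
  have snoc_eq: "map fst \<Delta> = map fst \<Gamma> @ [fst (last \<Delta>)]"
    using arg_cong[OF append_butlast_last_id[OF ne], of "map fst"] IH but by simp
  \<comment> \<open>The last variable differs from the preceding ones, which are those of \<open>\<Gamma>\<close>, but is not
     new; so it is \<open>x\<close>.\<close>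
  have "ok_ctx X \<Delta>" using interpretation_in[OF J] by (simp add: \<Delta> derived_iff_ok[OF X])
  from ok_ctx_distinct[OF this] have "fst (last \<Delta>) \<notin> fst ` set \<Gamma>" unfolding snoc_eq by simp
  moreover have "fst (last \<Delta>) \<in> fst ` set (\<Gamma> @ [(x, S)])"
    using interpretation_no_new_vars[OF J] last_in_set[OF ne] by (auto simp: \<Delta>)
  ultimately have "fst (last \<Delta>) = x" by auto
  then show ?case using snoc_eq by (simp add: p \<Delta>)
qed

lemma interpretation_vars:
  assumes J: "J \<in> derived (free_obj Y)" "ty_or_tm J"
  shows "map fst (ctx (\<psi> J)) = map fst (ctx J)"
  using J(2)
proof (cases rule: ty_or_tm_cases)
  case (ty \<Gamma> T)
  then show ?thesis using interpretation_type_vars J by simp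
next
  case (tm \<Gamma> t T)
  have K: "(\<Gamma> \<turnstile> IsType T) \<in> derived (free_obj Y)" using boundary_derived[OF Y J(1)] by (simp add: tm)
  obtain \<Delta> S where \<Delta>: "\<psi> (\<Gamma> \<turnstile> IsType T) = (\<Delta> \<turnstile> IsType S)"
    using interpretation_is_type[OF K] by blast
  have vars: "map fst \<Delta> = map fst \<Gamma>" using interpretation_type_vars[OF K] by (simp add: \<Delta>)
  have bdy: "boundary (\<psi> J) = [\<Delta> \<turnstile> IsType S]"
    using interpretation_boundary[OF J(1)] by (simp add: tm \<Delta>)
  show ?thesis
  proof (cases "\<psi> J" rule: boundary.cases)
    \<comment> \<open>A type judgement of the next degree would need a variable that does not occur in \<open>J\<close>.\<close>
    case (1 \<Theta> S')
    then have ne: "\<Theta> \<noteq> []" and \<Theta>: "butlast \<Theta> = \<Delta>" using bdy by (auto split: if_splits)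
    have "ok_ctx X \<Theta>" using interpretation_in[OF J(1)] by (simp add: 1 derived_iff_ok[OF X])
    from ok_ctx_distinct[OF this] have "distinct (map fst (butlast \<Theta> @ [last \<Theta>]))" using ne by simp
    then have "fst (last \<Theta>) \<notin> set (map fst \<Gamma>)" unfolding \<Theta> using vars by simp
    moreover have "fst (last \<Theta>) \<in> fst ` set (ctx J)"
      using interpretation_no_new_vars[OF J(1)] last_in_set[OF ne] by (auto simp: 1)
    ultimately show ?thesis by (simp add: tm)
  qed (use bdy vars in \<open>auto simp: tm\<close>)
qed

text \<open>On basic judgements, equivalence becomes equality because the names of the variables agree; from there
equality propagates along derivations, as a translation is defined wherever the rules are.\<close>

lemma interpretation_unique:
  assumes \<tau>: "translation \<tau>"
    and basic: "\<And>x u. x \<in> Obj H_cat \<Longrightarrow> u \<in> omap Y x \<Longrightarrow> alpha (\<psi> (basic_jdg Y x u)) (jdg_map \<tau> (basic_jdg Y x u))"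
    and J: "J \<in> derived (free_obj Y)"
  shows "\<psi> J = jdg_map \<tau> J"
  using J unfolding derived_def
proof (induction rule: derived_from.induct)
  case (1 r Js J)
  then have Js: "set Js \<subseteq> derived (free_obj Y)" by (auto simp: derived_def)
  have m: "map \<psi> Js = map (jdg_map \<tau>) Js" using 1 by simp
  have "deduction r (map \<psi> Js) (jdg_map \<tau> J)" unfolding m by (rule deduction_jdg_map[OF \<tau> 1(1)])
  then show ?case by (rule interpretation_rule[OF Js 1(1)])
next
  case (2 J)
  then obtain x u where xu: "x \<in> Obj H_cat" "u \<in> omap Y x" and J: "J = basic_jdg Y x u"
    by (auto simp: free_obj_def)
  have d: "J \<in> derived (free_obj Y)" "ty_or_tm J"
    using basic_derived[OF Y xu] J by (auto simp: ty_or_tm_def) (cases x; simp)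
  have "ok_jdg X (\<psi> J)" using interpretation_in[OF d(1)] by (simp add: derived_iff_ok[OF X])
  from alpha_same_vars[OF this basic[OF xu, folded J]] show ?case
    using interpretation_vars[OF d] by simp
qed

end


section \<open>The monad on judgements in normal form\<close>

text \<open>The map on classes that the translation \<open>\<tau>\<close> induces, computed on normal forms.\<close>

definition lift_map :: "'u psh \<Rightarrow> ('u uexpr \<Rightarrow> 'u uexpr) \<Rightarrow>
    'u psh \<Rightarrow> 'u psh_arr" where
  "lift_map X \<tau> Y = psh_map (P_obj X) (\<lambda>x u. class_of (free_obj Y) (jdg_map \<tau> (norm_jdg X u))) (P_obj Y)"

lemma is_gat_free_obj:
  assumes X: "X \<in> Obj psh_cat" shows "is_gat (free_obj X)"
  unfolding is_gat_def
proof (intro conjI ballI)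
  let ?T = "free_obj X"
  have vars: "map (\<lambda>p. Var (fst p)) (basic_ctx X n A) = map Var [1..<n]" for n A
    by (simp add: basic_ctx_def)
  show "distinct (map fst (ctx J))" if "J \<in> basic ?T" for J
  proof -
    obtain x u where "J = basic_jdg X x u" using \<open>J \<in> basic ?T\<close> by (auto simp: free_obj_def)
    moreover have "map fst (basic_ctx X n A) = [1..<n]" for n A
      by (simp add: basic_ctx_def comp_def)
    ultimately show ?thesis by (cases x) (simp_all del: upt_Suc)
  qed
  show "set_jdg J \<subseteq> Inl ` tyconsts ?T \<union> Inr ` tmconsts ?T" if "J \<in> basic ?T" for J
  proof -
    obtain x u where xu: "x \<in> Obj H_cat" "u \<in> omap X x" and J: "J = basic_jdg X x u"
      using \<open>J \<in> basic ?T\<close> by (auto simp: free_obj_def)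
    have sub: "\<exists>m B. w = Inl (m, B) \<and> m \<ge> 1 \<and> B \<in> omap X (Ty m)"
      if "(i, T) \<in> set (basic_ctx X n A)" "w \<in> set_expr T" "A \<in> omap X (Ty n)" for i T n A w
      using that ty_bd_in[OF X] by (auto simp: basic_ctx_def)
    show ?thesis
      using xu tm_bd_in[OF X] by (cases x) (auto simp: J free_obj_def dest!: sub)
  qed
  show "\<exists>!J. J \<in> basic ?T \<and> introduces_type A J" if A0: "A \<in> tyconsts ?T" for A
  proof -
    obtain n a where A: "A = (n, a)" "n \<ge> 1" "a \<in> omap X (Ty n)" using A0 by (auto simp: free_obj_def)
    show ?thesis
    proof (intro ex1I[of _ "basic_jdg X (Ty n) a"] conjI)
      show "basic_jdg X (Ty n) a \<in> basic ?T" using A by (intro basic_in_free) auto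
      show "introduces_type A (basic_jdg X (Ty n) a)" by (simp add: introduces_type_def vars A comp_def)
      fix J assume J: "J \<in> basic ?T \<and> introduces_type A J"
      then obtain x u where "J = basic_jdg X x u" by (auto simp: free_obj_def)
      then show "J = basic_jdg X (Ty n) a" using J by (cases x) (auto simp: introduces_type_def A)
    qed
  qed
  show "\<exists>!J. J \<in> basic ?T \<and> introduces_term f J" if f0: "f \<in> tmconsts ?T" for f
  proof -
    obtain n a where f: "f = (n, a)" "n \<ge> 1" "a \<in> omap X (Tm n)" using f0 by (auto simp: free_obj_def)
    show ?thesis
    proof (intro ex1I[of _ "basic_jdg X (Tm n) a"] conjI)
      show "basic_jdg X (Tm n) a \<in> basic ?T" using f by (intro basic_in_free) auto
      show "introduces_term f (basic_jdg X (Tm n) a)" by (simp add: introduces_term_def vars f comp_def)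
      fix J assume J: "J \<in> basic ?T \<and> introduces_term f J"
      then obtain x u where "J = basic_jdg X x u" by (auto simp: free_obj_def)
      then show "J = basic_jdg X (Tm n) a" using J by (cases x) (auto simp: introduces_term_def f)
    qed
  qed
  show "(\<exists>A \<in> tyconsts ?T. introduces_type A J) \<or> (\<exists>f \<in> tmconsts ?T. introduces_term f J) \<or>
      \<not> is_type_jdg J \<and> \<not> is_term_jdg J" if J: "J \<in> basic ?T" for J
  proof -
    obtain x u where xu: "x \<in> Obj H_cat" "u \<in> omap X x" "J = basic_jdg X x u"
      using J by (auto simp: free_obj_def)
    show ?thesis
    proof (cases x)
      case (Ty n)
      then have "(n, u) \<in> tyconsts ?T" "introduces_type (n, u) J"
        using xu by (simp_all add: free_obj_def introduces_type_def vars comp_def)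
      then show ?thesis by blast
    next
      case (Tm n)
      then have "(n, u) \<in> tmconsts ?T" "introduces_term (n, u) J"
        using xu by (simp_all add: free_obj_def introduces_term_def vars comp_def)
      then show ?thesis by blast
    qed
  qed
  show "basic ?T \<subseteq> derived ?T" using basic_derived[OF X] by (auto simp: free_obj_def)
qed

context
  fixes X Y :: "'u::infinite psh" and \<tau>
  assumes X: "X \<in> Obj psh_cat" and Y: "Y \<in> Obj psh_cat" and \<tau>: "translation \<tau>"
    and der: "\<And>J. J \<in> derived (free_obj X) \<Longrightarrow> jdg_map \<tau> J \<in> derived (free_obj Y)"
begin

lemma jdg_map_jdgs_at: "J \<in> jdgs_at (free_obj X) x \<Longrightarrow> jdg_map \<tau> J \<in> jdgs_at (free_obj Y) x"
  using der by (cases x) auto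

lemma lift_map_hom: "lift_map X \<tau> Y \<in> hom psh_cat (P_obj X) (P_obj Y)"
  unfolding lift_map_def
proof (rule psh_map_hom[OF P_obj_Obj[OF X] P_obj_Obj[OF Y]])
  show "class_of (free_obj Y) (jdg_map \<tau> (norm_jdg X u)) \<in> omap (P_obj Y) x"
    if "x \<in> Obj H_cat" "u \<in> omap (P_obj X) x" for x u
    by (rule class_of_in[OF that(1) jdg_map_jdgs_at[OF norm_jdg(1)[OF X that]]])
  fix e u assume e: "e \<in> hedges" and u: "u \<in> omap (P_obj X) (htgt e)"
  have t: "htgt e \<in> Obj H_cat" using hedge_Obj_H[OF e] by simp
  show "bd (P_obj Y) e (class_of (free_obj Y) (jdg_map \<tau> (norm_jdg X u))) =
      class_of (free_obj Y) (jdg_map \<tau> (norm_jdg X (bd (P_obj X) e u)))"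
    using bd_P_obj[OF Y e jdg_map_jdgs_at[OF norm_jdg(1)[OF X t u]]]
    by (simp add: boundary_jdg_map norm_jdg_bd[OF X e u])
qed

lemma act_lift_map:
  "x \<in> Obj H_cat \<Longrightarrow> u \<in> omap (P_obj X) x \<Longrightarrow>
    act (lift_map X \<tau> Y) x u = class_of (free_obj Y) (jdg_map \<tau> (norm_jdg X u))"
  unfolding lift_map_def by (rule act_psh_map)

lemma norm_lift_map:
  assumes "x \<in> Obj H_cat" "u \<in> omap (P_obj X) x"
  shows "norm_jdg Y (act (lift_map X \<tau> Y) x u) = jdg_map \<tau> (norm_jdg X u)"
  unfolding act_lift_map[OF assms]
  using norm_class_of(3)[OF Y, of "jdg_map \<tau> (norm_jdg X u)"] norm_jdg(2)[OF X assms]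
    jdgs_atD[OF jdg_map_jdgs_at[OF norm_jdg(1)[OF X assms]]] by simp

text \<open>The arrow remembers an interpretation only up to equivalence, and the forgetful functor evaluates some
representative at some member of a class; by equivariance the result is independent of both choices.\<close>

lemma forget_gat_arrow:
  assumes \<phi>: "interpretation_of (free_obj X) (free_obj Y) \<phi>"
    and eq: "\<And>J. J \<in> derived (free_obj X) \<Longrightarrow> \<phi> J = jdg_map \<tau> J"
  shows "gat_arrow (free_obj X) (free_obj Y) \<phi> \<in> Arr gat_cat"
    and "amap forget (gat_arrow (free_obj X) (free_obj Y) \<phi>) = lift_map X \<tau> Y"
proof -
  let ?f = "gat_arrow (free_obj X) (free_obj Y) \<phi>"
  show arr: "?f \<in> Arr gat_cat"
    using is_gat_free_obj[OF X] is_gat_free_obj[OF Y] \<phi> by (auto simp: gat_cat_def)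
  have mid_f: "mid ?f = {\<psi>. interpretation_of (free_obj X) (free_obj Y) \<psi> \<and>
      (\<forall>J \<in> derived (free_obj X). ty_or_tm J \<longrightarrow> same_class (free_obj Y) (\<phi> J) (\<psi> J))}"
    by (simp add: gat_arrow_def ty_or_tm_def)
  have "\<phi> \<in> mid ?f" using \<phi> by (simp add: mid_f same_class_def)
  then have "representative ?f \<in> mid ?f" unfolding representative_def by (rule someI[of "\<lambda>\<psi>. \<psi> \<in> mid ?f"])
  then have rep: "same_class (free_obj Y) (\<phi> J) (representative ?f J)"
    if "J \<in> derived (free_obj X)" "ty_or_tm J" for J
    using that unfolding mid_f by blast
  have "class_of (free_obj Y) (representative ?f (member (free_obj X) u)) =
      class_of (free_obj Y) (jdg_map \<tau> (norm_jdg X u))"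
    if x: "x \<in> Obj H_cat" and u: "u \<in> class_of (free_obj X) ` jdgs_at (free_obj X) x" for x u
  proof -
    let ?N = "norm_jdg X u" and ?M = "member (free_obj X) u"
    have uP: "u \<in> omap (P_obj X) x" using u by (simp add: P_obj_elements[OF x])
    note N = norm_jdg[OF X x uP]
    have "alpha ?N ?M" using member_alpha[OF X, of ?N] jdgs_atD[OF N(1)] N(3) by simp
    then have M: "?M \<in> jdgs_at (free_obj X) x" and \<alpha>: "alpha (jdg_map \<tau> ?N) (jdg_map \<tau> ?M)"
      using alpha_jdgs_at[OF _ N(1)] alpha_jdg_map[OF \<tau>] by auto
    have d: "?M \<in> derived (free_obj X)" "ty_or_tm ?M" using jdgs_atD[OF M] by auto
    have NY: "jdg_map \<tau> ?N \<in> derived (free_obj Y)" "ty_or_tm (jdg_map \<tau> ?N)"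
      using jdgs_atD[OF jdg_map_jdgs_at[OF N(1)]] by auto
    have MY: "jdg_map \<tau> ?M \<in> derived (free_obj Y)" "ty_or_tm (jdg_map \<tau> ?M)"
      using jdgs_atD[OF jdg_map_jdgs_at[OF M]] by auto
    have "alpha (jdg_map \<tau> ?M) (representative ?f ?M)"
      using rep[OF d] same_class_iff_alpha[OF Y MY] eq[OF d(1)] by simp
    then have \<alpha>': "alpha (jdg_map \<tau> ?N) (representative ?f ?M)" using \<alpha> alpha_trans by blast
    then have "representative ?f ?M \<in> jdgs_at (free_obj Y) x"
      using alpha_jdgs_at[OF _ jdg_map_jdgs_at[OF N(1)]] by blast
    from class_of_eq_iff[OF Y NY, of "representative ?f ?M"] jdgs_atD[OF this] \<alpha>'
    show ?thesis by simp
  qed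
  then have "forget_arr ?f = lift_map X \<tau> Y"
    unfolding forget_arr_def lift_map_def psh_map_def Let_def
    by (auto simp: gat_arrow_def P_obj_elements intro!: restrict_ext)
  then show "amap forget ?f = lift_map X \<tau> Y" using arr by (simp add: forget_def)
qed

end


text \<open>Type heads and term heads are treated alike by indexing them with the objects of \<^const>\<open>H_cat\<close>.\<close>

primrec app :: "hob \<Rightarrow> 'u \<Rightarrow> nat list \<Rightarrow> 'u uexpr" where
  "app (Ty n) u ys = ty_app n u ys"
| "app (Tm n) u ys = tm_app n u ys"

primrec hdeg :: "hob \<Rightarrow> nat" where
  "hdeg (Ty n) = n"
| "hdeg (Tm n) = n"

primrec subject :: "'w rhs \<Rightarrow> 'w expr" where
  "subject (IsType T) = T"
| "subject (HasType t T) = t"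
| "subject (TypeEq T T') = T"
| "subject (TermEq t t' T) = t"

lemma subject_rhs_map [simp]: "subject (rhs_map \<tau> R) = \<tau> (subject R)"
  by (cases R) auto

lemma subject_basic: "subject (rhs (basic_jdg X x u)) = app x u [1..<hdeg x]"
  by (cases x) auto

lemma normal_basic: "normal (basic_jdg X x u)"
proof -
  have "map fst (basic_ctx X n A) = [1..<n]" "length (basic_ctx X n A) + 1 = (if n = 0 then 1 else n)" for n A
    by (auto simp: basic_ctx_def comp_def)
  then show ?thesis by (cases x) (simp_all add: normal_def degree_def del: upt_Suc)
qed

lemma ty_or_tm_basic: "ty_or_tm (basic_jdg X x u)"
  by (cases x) auto

lemma basic_jdgs_at:
  assumes "X \<in> Obj psh_cat" "x \<in> Obj H_cat" "u \<in> omap X x"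
  shows "basic_jdg X x u \<in> jdgs_at (free_obj X) x"
  using basic_derived[OF assms] assms(2) by (cases x) (auto simp: degree_def basic_ctx_def)

text \<open>Every expression in a well-formed judgement is a variable or a head applied to variables.\<close>

lemma jdg_map_cong:
  assumes J: "ok_jdg X J" "ty_or_tm J"
    and app: "\<And>x u ys. x \<in> Obj H_cat \<Longrightarrow> u \<in> omap X x \<Longrightarrow> length ys = hdeg x - 1 \<Longrightarrow>
      \<tau> (app x u ys) = \<tau>' (app x u ys)"
    and var: "\<And>x. \<tau> (Var x) = \<tau>' (Var x)"
  shows "jdg_map \<tau> J = jdg_map \<tau>' J"
proof -
  obtain \<Gamma> R where J': "J = (\<Gamma> \<turnstile> R)" by (cases J)
  have \<Gamma>: "ok_ctx X \<Gamma>" and R: "ok_rhs X \<Gamma> R" using J by (simp_all add: J')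
  have ty: "\<tau> T = \<tau>' T" if T: "ok_type X \<Gamma> T" for T
  proof -
    obtain n A ys where T': "T = ty_app n A ys" using ok_type_head[OF T] .
    show ?thesis using ok_type_app[OF \<Gamma> T[unfolded T']] app[of "Ty n" A ys] by (simp add: T')
  qed
  have tm: "\<tau> t = \<tau>' t" if t: "ok_term X \<Gamma> t T" for t T
    using t
  proof cases
    case (const n a ys)
    then show ?thesis using ok_type_app(3)[OF \<Gamma> const(5)] app[of "Tm n" a ys] by simp
  qed (simp add: var)
  have "map (apsnd \<tau>) \<Gamma> = map (apsnd \<tau>') \<Gamma>"
    using ty ok_ctx_type[OF \<Gamma>] by (auto simp: apsnd_def)
  moreover have "rhs_map \<tau> R = rhs_map \<tau>' R"
    using R J(2) ty tm ok_term_type[OF \<Gamma>] unfolding J' by (cases R) auto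
  ultimately show ?thesis by (simp add: J')
qed

lemma jdg_map_ident: "jdg_map (\<lambda>e. e) J = J"
  by (cases J; cases "rhs J") (auto intro: map_idI)


definition relabel :: "'u psh_arr \<Rightarrow> 'u uexpr \<Rightarrow> 'u uexpr" where
  "relabel f = map_expr (map_sum (\<lambda>(n, A). (n, act f (Ty n) A)) (\<lambda>(n, a). (n, act f (Tm n) a)))"

lemma relabel_Var [simp]: "relabel f (Var x) = Var x"
  by (simp add: relabel_def)

lemma relabel_app [simp]: "relabel f (app x u ys) = app x (act f x u) ys"
  by (cases x) (auto simp: relabel_def)

lemma relabel_ty_app [simp]: "relabel f (ty_app n A ys) = ty_app n (act f (Ty n) A) ys"
  and relabel_tm_app [simp]: "relabel f (tm_app n A ys) = tm_app n (act f (Tm n) A) ys"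
  by (auto simp: relabel_def)

lemma fv_map_expr [simp]: "fv (map_expr h e) = fv e"
  by (induction e) auto

lemma map_expr_ren: "map_expr h (ren \<sigma> e) = ren \<sigma> (map_expr h e)"
  by (induction e) auto

lemma translation_relabel: "translation (relabel f)"
  unfolding translation_def relabel_def by (auto simp: map_expr_ren)

lemma relabel_ren: "relabel f (ren \<sigma> e) = ren \<sigma> (relabel f e)"
  by (simp add: relabel_def map_expr_ren)

lemma relabel_basic_ctx:
  assumes f: "f \<in> hom psh_cat X Y" and "A \<in> omap X (Ty n)"
  shows "map (apsnd (relabel f)) (basic_ctx X n A) = basic_ctx Y n (act f (Ty n) A)"
  using assms act_ty_bd[OF f] by (auto simp: basic_ctx_def)

lemma relabel_basic:
  assumes f: "f \<in> hom psh_cat X Y" and x: "x \<in> Obj H_cat" "u \<in> omap X x"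
  shows "jdg_map (relabel f) (basic_jdg X x u) = basic_jdg Y x (act f x u)"
proof (cases x)
  case (Ty n)
  then show ?thesis using x relabel_basic_ctx[OF f] by simp
next
  case (Tm n)
  then have n: "n \<ge> 1" "u \<in> omap X (Tm n)" using x by auto
  have "tm_bd X n u \<in> omap X (Ty n)" using tm_bd_in[OF _ n] psh_hom_Obj[OF f] by simp
  then show ?thesis using relabel_basic_ctx[OF f, of _ n] by (simp add: Tm act_tm_bd[OF f n])
qed

lemma relabel_derived:
  assumes f: "f \<in> hom psh_cat X Y" and J: "J \<in> derived (free_obj X)"
  shows "jdg_map (relabel f) J \<in> derived (free_obj Y)"
proof (rule jdg_map_derived[OF translation_relabel _ J])
  fix J assume "J \<in> basic (free_obj X)"
  then obtain x u where x: "x \<in> Obj H_cat" "u \<in> omap X x" and "J = basic_jdg X x u"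
    by (auto simp: free_obj_def)
  then show "jdg_map (relabel f) J \<in> derived (free_obj Y)"
    using basic_derived[OF _ x(1) act_in[OF f x]] psh_hom_Obj[OF f] by (simp add: relabel_basic[OF f x])
qed

abbreviation P :: "('u psh, 'u psh_arr, 'u psh, 'u psh_arr) fctr" where
  "P \<equiv> comp_fctr psh_cat forget free"

context
  fixes X Y :: "'u::infinite psh" and f
  assumes f: "f \<in> hom psh_cat X Y"
begin

lemma P_amap: "amap P f = lift_map X (relabel f) Y"
proof -
  have X: "X \<in> Obj psh_cat" and Y: "Y \<in> Obj psh_cat" using psh_hom_Obj[OF f] by auto
  let ?\<phi> = "\<lambda>J \<in> derived (free_obj X). jdg_map (relabel f) J"
  have "f \<in> Arr psh_cat" using f by (simp add: hom_def)
  then have "amap P f = amap forget (free_arr f)" by (simp add: comp_fctr_def compose_def free_def)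
  also have "free_arr f = gat_arrow (free_obj X) (free_obj Y) ?\<phi>"
  proof -
    obtain \<tau> where "f = (X, \<tau>, Y)" using f psh_hom by blast
    then show ?thesis by (simp add: free_arr_def map_jdg_eq_jdg_map relabel_def act_def)
  qed
  also have "amap forget \<dots> = lift_map X (relabel f) Y"
    by (rule forget_gat_arrow(2)[OF X Y translation_relabel relabel_derived[OF f]
          interpretation_jdg_map[OF X translation_relabel relabel_derived[OF f]]]) auto
  finally show ?thesis .
qed

lemma P_hom: "amap P f \<in> hom psh_cat (P_obj X) (P_obj Y)"
  unfolding P_amap using psh_hom_Obj[OF f]
  by (intro lift_map_hom translation_relabel relabel_derived[OF f]) auto

lemma norm_P:
  "x \<in> Obj H_cat \<Longrightarrow> u \<in> omap (P_obj X) x \<Longrightarrow>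
    norm_jdg Y (act (amap P f) x u) = jdg_map (relabel f) (norm_jdg X u)"
  unfolding P_amap using psh_hom_Obj[OF f]
  by (intro norm_lift_map translation_relabel relabel_derived[OF f]) auto

end

lemma P_omap: "X \<in> Obj psh_cat \<Longrightarrow> omap P X = P_obj X"
  using is_gat_free_obj[of X]
  by (simp add: comp_fctr_def compose_def free_def forget_def gat_cat_def)

text \<open>A class is determined by its normal form, which turns equations between maps into \<open>P X\<close> into equations
between judgements.\<close>

lemma P_hom_eq:
  fixes X :: "'u::infinite psh"
  assumes X: "X \<in> Obj psh_cat" and f: "f \<in> hom psh_cat Z (P_obj X)" and g: "g \<in> hom psh_cat Z (P_obj X)"
    and eq: "\<And>x u. x \<in> Obj H_cat \<Longrightarrow> u \<in> omap Z x \<Longrightarrow> norm_jdg X (act f x u) = norm_jdg X (act g x u)"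
  shows "f = g"
  by (rule psh_hom_eq[OF f g]) (rule norm_jdg_inj[OF X _ act_in[OF f] act_in[OF g] eq])

lemma functor_P: "is_functor psh_cat psh_cat (P :: ('u::infinite psh, 'u psh_arr, 'u psh, 'u psh_arr) fctr)"
proof (rule is_functorI[OF category_psh category_psh])
  show "omap P \<in> extensional (Obj psh_cat)" "amap P \<in> extensional (Arr psh_cat)"
    by (simp_all add: comp_fctr_def)
  fix X :: "'u psh" assume X: "X \<in> Obj psh_cat"
  note idX = category_id[OF category_psh X] and PX = P_obj_Obj[OF X]
  show "omap P X \<in> Obj psh_cat" by (simp add: P_omap X PX)
  have "amap P (Id psh_cat X) = Id psh_cat (P_obj X)"
  proof (rule P_hom_eq[OF X P_hom[OF idX] category_id[OF category_psh PX]])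
    fix x u assume x: "x \<in> Obj H_cat" "u \<in> omap (P_obj X) x"
    have "jdg_map (relabel (Id psh_cat X)) (norm_jdg X u) = jdg_map (\<lambda>e. e) (norm_jdg X u)"
      by (rule jdg_map_cong[OF norm_jdg_ok[OF X x]]) (simp_all add: act_id X)
    then show "norm_jdg X (act (amap P (Id psh_cat X)) x u) = norm_jdg X (act (Id psh_cat (P_obj X)) x u)"
      by (simp add: norm_P[OF idX x] act_id[OF PX x] jdg_map_ident)
  qed
  then show "amap P (Id psh_cat X) = Id psh_cat (omap P X)" by (simp add: P_omap X)
next
  fix f :: "'u psh_arr" and X Y assume f: "f \<in> hom psh_cat X Y"
  then show "amap P f \<in> hom psh_cat (omap P X) (omap P Y)"
    using P_hom[OF f] psh_hom_Obj[OF f] by (simp add: P_omap)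
next
  fix f g :: "'u psh_arr" and X Y Z assume f: "f \<in> hom psh_cat X Y" and g: "g \<in> hom psh_cat Y Z"
  have X: "X \<in> Obj psh_cat" and Z: "Z \<in> Obj psh_cat" using psh_hom_Obj f g by blast+
  note gf = psh_hom_comp[OF f g]
  show "amap P (Comp psh_cat g f) = Comp psh_cat (amap P g) (amap P f)"
  proof (rule P_hom_eq[OF Z P_hom[OF gf] psh_hom_comp[OF P_hom[OF f] P_hom[OF g]]])
    fix x u assume x: "x \<in> Obj H_cat" "u \<in> omap (P_obj X) x"
    have "jdg_map (relabel (Comp psh_cat g f)) (norm_jdg X u) =
        jdg_map (\<lambda>e. relabel g (relabel f e)) (norm_jdg X u)"
      by (rule jdg_map_cong[OF norm_jdg_ok[OF X x]]) (simp_all add: act_comp[OF f g])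
    then show "norm_jdg Z (act (amap P (Comp psh_cat g f)) x u) =
        norm_jdg Z (act (Comp psh_cat (amap P g) (amap P f)) x u)"
      by (simp add: norm_P[OF gf x] act_comp[OF P_hom[OF f] P_hom[OF g] x]
          norm_P[OF g x(1) act_in[OF P_hom[OF f] x]] norm_P[OF f x] jdg_map_comp)
  qed
qed


subsection \<open>Unit\<close>

context
  fixes X :: "'u::infinite psh"
  assumes X: "X \<in> Obj psh_cat"
begin

lemma unit_eq:
  "wp_unit X = psh_map X (\<lambda>x u. class_of (free_obj X) (basic_jdg X x u)) (P_obj X)"
  using X by (auto simp: wp_unit_def psh_map_def)

lemma unit_hom: "wp_unit X \<in> hom psh_cat X (P_obj X)"
  unfolding unit_eq
proof (rule psh_map_hom[OF X P_obj_Obj[OF X]])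
  show "class_of (free_obj X) (basic_jdg X x u) \<in> omap (P_obj X) x"
    if "x \<in> Obj H_cat" "u \<in> omap X x" for x u
    by (rule class_of_in[OF that(1) basic_jdgs_at[OF X that]])
  fix e u assume e: "e \<in> hedges" and u: "u \<in> omap X (htgt e)"
  have t: "htgt e \<in> Obj H_cat" using hedge_Obj_H[OF e] by simp
  have "hd (boundary (basic_jdg X (htgt e) u)) = basic_jdg X (hsrc e) (bd X e u)"
  proof (cases e)
    case (Next n)
    then show ?thesis using boundary_basic_Ty[OF X, of n u] e u by (simp del: basic_jdg.simps) auto
  qed (simp add: tm_bd_eq)
  then show "bd (P_obj X) e (class_of (free_obj X) (basic_jdg X (htgt e) u)) =
      class_of (free_obj X) (basic_jdg X (hsrc e) (bd X e u))"
    using bd_P_obj[OF X e basic_jdgs_at[OF X t u]] by simp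
qed

lemma norm_unit:
  "x \<in> Obj H_cat \<Longrightarrow> u \<in> omap X x \<Longrightarrow> norm_jdg X (act (wp_unit X) x u) = basic_jdg X x u"
  unfolding unit_eq
  using norm_class_of(3)[OF X basic_derived[OF X] ty_or_tm_basic normal_basic] by simp

end

lemma unit_natural:
  fixes f :: "'u::infinite psh_arr"
  assumes f: "f \<in> hom psh_cat X Y"
  shows "Comp psh_cat (amap P f) (wp_unit X) = Comp psh_cat (wp_unit Y) f"
proof -
  have X: "X \<in> Obj psh_cat" and Y: "Y \<in> Obj psh_cat" using psh_hom_Obj[OF f] by auto
  note \<eta>X = unit_hom[OF X] and \<eta>Y = unit_hom[OF Y]
  show ?thesis
  proof (rule P_hom_eq[OF Y psh_hom_comp[OF \<eta>X P_hom[OF f]] psh_hom_comp[OF f \<eta>Y]])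
    fix x u assume x: "x \<in> Obj H_cat" "u \<in> omap X x"
    show "norm_jdg Y (act (Comp psh_cat (amap P f) (wp_unit X)) x u) =
        norm_jdg Y (act (Comp psh_cat (wp_unit Y) f) x u)"
      by (simp add: act_comp[OF \<eta>X P_hom[OF f] x] act_comp[OF f \<eta>Y x] norm_P[OF f x(1) act_in[OF \<eta>X x]]
          norm_unit[OF X x] norm_unit[OF Y x(1) act_in[OF f x]] relabel_basic[OF f x])
  qed
qed


subsection \<open>Multiplication\<close>

text \<open>Substitution for the variables \<open>1, \<dots>, length es\<close>.  The remaining variables are sent to a closed
expression, so that a substitution instance has no variables other than those of \<open>es\<close>.\<close>

definition plug :: "'w expr list \<Rightarrow> nat \<Rightarrow> 'w expr" where
  "plug es v = (if 1 \<le> v \<and> v \<le> length es then es ! (v - 1) else App undefined [])"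

primrec label :: "(nat \<times> 'u) + (nat \<times> 'u) \<Rightarrow> 'u" where
  "label (Inl p) = snd p"
| "label (Inr p) = snd p"

text \<open>A head over \<open>P X\<close> is the class of a judgement; applied to arguments it stands for the subject of that
judgement, with the arguments substituted for the variables of the normal form.\<close>

primrec counit_expr :: "'u psh \<Rightarrow> 'u uexpr \<Rightarrow> 'u uexpr" where
  "counit_expr X (Var x) = Var x"
| "counit_expr X (App w es) = subst (plug es) (subject (rhs (norm_jdg X (label w))))"

lemma translation_counit: "translation (counit_expr X)"
  unfolding translation_def
proof (intro conjI allI)
  have plug: "fv (plug es v) \<subseteq> fv (App w es) \<and> ren \<sigma> (plug es v) = plug (map (ren \<sigma>) es) v"
    for es v w \<sigma>
  proof (cases "1 \<le> v \<and> v \<le> length es")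
    case True
    then have "v - 1 < length es" by linarith
    then have "es ! (v - 1) \<in> set es" by (rule nth_mem)
    then have "fv (es ! (v - 1)) \<subseteq> fv (App w es)" by auto
    then show ?thesis using True \<open>v - 1 < length es\<close> by (simp add: plug_def)
  qed (auto simp: plug_def)
  show "counit_expr X (Var x) = Var x" for x by simp
  show "fv (counit_expr X e) \<subseteq> fv e" for e
  proof (cases e)
    case (App w es)
    show ?thesis unfolding App counit_expr.simps fv_subst by (rule UN_least) (rule plug[THEN conjunct1])
  qed simp
  show "counit_expr X (ren \<sigma> e) = ren \<sigma> (counit_expr X e)" for \<sigma> e
  proof (cases e)
    case (App w es)
    show ?thesis unfolding App by (simp add: subst_subst plug[THEN conjunct2])
  qed simp
qed

lemma counit_ren: "counit_expr X (ren \<sigma> e) = ren \<sigma> (counit_expr X e)"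
  using translation_counit[of X] by (simp add: translation_def)

lemma fv_subject:
  assumes "ok_jdg X J" shows "fv (subject (rhs J)) \<subseteq> fst ` set (ctx J)"
proof (cases J)
  case (Jdg \<Gamma> R)
  have "fv t \<subseteq> fst ` set \<Gamma>" if "ok_term X \<Gamma> t T" for t T
    using ok_term_fv[OF _ that] assms by (simp add: Jdg)
  then show ?thesis using assms ok_type_fv[of X \<Gamma>] by (cases R) (auto simp: Jdg)
qed

lemma degree_jdgs_at: "J \<in> jdgs_at T x \<Longrightarrow> degree J = hdeg x"
  by (cases x) auto

lemma subst_plug:
  assumes "\<And>v. v \<in> fv e \<Longrightarrow> 1 \<le> v \<and> v \<le> length ys"
  shows "subst (plug (map Var ys)) e = ren (\<lambda>v. ys ! (v - 1)) e"
proof (rule subst_cong)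
  fix v assume "v \<in> fv e"
  then have "1 \<le> v" "v \<le> length ys" "v - 1 < length ys" using assms[of v] by linarith+
  then show "plug (map Var ys) v = Var (ys ! (v - 1))" by (simp add: plug_def)
qed

context
  fixes X :: "'u::infinite psh"
  assumes X: "X \<in> Obj psh_cat"
begin

lemma fv_subject_norm:
  assumes x: "x \<in> Obj H_cat" "u \<in> omap (P_obj X) x"
  shows "fv (subject (rhs (norm_jdg X u))) \<subseteq> {1..<hdeg x}"
proof -
  have "set (map fst (ctx (norm_jdg X u))) = set [1..<hdeg x]"
    using norm_jdg(2)[OF X x] degree_jdgs_at[OF norm_jdg(1)[OF X x]] by (simp add: normal_def)
  then show ?thesis using fv_subject[OF norm_jdg_ok(1)[OF X x]] by simp
qed

lemma counit_app:
  assumes x: "x \<in> Obj H_cat" "u \<in> omap (P_obj X) x" and ys: "length ys = hdeg x - 1"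
  shows "counit_expr X (app x u ys) = ren (\<lambda>v. ys ! (v - 1)) (subject (rhs (norm_jdg X u)))"
proof -
  have "1 \<le> v \<and> v \<le> length ys" if "v \<in> fv (subject (rhs (norm_jdg X u)))" for v
  proof -
    have "v \<in> {1..<hdeg x}" using fv_subject_norm[OF x] that by blast
    then show ?thesis using ys by auto
  qed
  then show ?thesis by (cases x) (simp_all add: subst_plug)
qed

lemma counit_app_upt:
  assumes x: "x \<in> Obj H_cat" "u \<in> omap (P_obj X) x"
  shows "counit_expr X (app x u [1..<hdeg x]) = subject (rhs (norm_jdg X u))"
proof -
  have "[1..<hdeg x] ! (v - 1) = v" if "v \<in> fv (subject (rhs (norm_jdg X u)))" for v
  proof -
    have "v \<in> {1..<hdeg x}" using fv_subject_norm[OF x] that by blast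
    then show ?thesis by (simp add: nth_upt)
  qed
  then show ?thesis by (subst counit_app[OF x]) (auto intro!: ren_ident)
qed

text \<open>The context of the normal form consists of the subjects of its iterated boundaries, and these are what
the heads in the basic judgement of \<open>u\<close> stand for.\<close>

lemma counit_basic:
  assumes x: "x \<in> Obj H_cat" "u \<in> omap (P_obj X) x"
  shows "jdg_map (counit_expr X) (basic_jdg (P_obj X) x u) = norm_jdg X u"
proof -
  note PX = P_obj_Obj[OF X]
  have ty: "jdg_map (counit_expr X) (basic_jdg (P_obj X) (Ty n) u) = norm_jdg X u"
    if "n \<ge> 1" "u \<in> omap (P_obj X) (Ty n)" for n u
    using that
  proof (induction n arbitrary: u rule: nat_induct_at_least)
    case base
    have "norm_jdg X u \<in> jdgs_at (free_obj X) (Ty 1)" using norm_jdg(1)[OF X _ base] by simp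
    then obtain T where "norm_jdg X u = ([] \<turnstile> IsType T)" by (auto simp: is_type_jdg_def degree_def)
    then show ?case using counit_app_upt[of "Ty 1" u] base by (simp add: basic_ctx_def)
  next
    case (Suc n)
    let ?v = "bd (P_obj X) (Next n) u"
    have v: "?v \<in> omap (P_obj X) (Ty n)" by (rule ty_bd_step_in[OF PX Suc.hyps Suc.prems])
    have u: "Ty (Suc n) \<in> Obj H_cat" "u \<in> omap (P_obj X) (Ty (Suc n))" using Suc.prems by auto
    obtain \<Gamma> T where N: "norm_jdg X u = (\<Gamma> \<turnstile> IsType T)" and len: "length \<Gamma> = n"
      using norm_jdg(1)[OF X u] by (auto simp: is_type_jdg_def degree_def)
    have ne: "\<Gamma> \<noteq> []" using len Suc.hyps by auto
    have "map fst \<Gamma> = [1..<Suc n]" using norm_jdg(2)[OF X u] by (simp add: N normal_def degree_def len)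
    then have fst: "fst (last \<Gamma>) = n" using ne Suc.hyps by (simp flip: last_map)
    have "Next n \<in> hedges" using Suc.hyps by simp
    from norm_jdg_bd[OF X this, of u] Suc.prems ne
    have Nv: "norm_jdg X ?v = (butlast \<Gamma> \<turnstile> IsType (snd (last \<Gamma>)))" by (simp add: N)
    have c: "map (apsnd (counit_expr X)) (basic_ctx (P_obj X) n ?v) = butlast \<Gamma>"
      using Suc.IH[OF v] by (simp add: Nv)
    have "counit_expr X (ty_app n ?v [1..<n]) = snd (last \<Gamma>)"
      using counit_app_upt[of "Ty n" ?v] v Suc.hyps by (simp add: Nv)
    moreover have "counit_expr X (ty_app (Suc n) u [1..<Suc n]) = T"
      using counit_app_upt[OF u] by (simp add: N del: upt_Suc)
    moreover have "butlast \<Gamma> @ [(n, snd (last \<Gamma>))] = \<Gamma>" using append_butlast_last_id[OF ne] fst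
      by (metis prod.collapse)
    ultimately show ?case
      using basic_ctx_Suc[OF PX Suc.hyps Suc.prems] c by (simp add: N del: upt_Suc counit_expr.simps)
  qed
  show ?thesis
  proof (cases x)
    case (Tm n)
    then have n: "n \<ge> 1" and u: "u \<in> omap (P_obj X) (Tm n)" using x by auto
    obtain \<Gamma> t T where N: "norm_jdg X u = (\<Gamma> \<turnstile> HasType t T)"
      using norm_jdg(1)[OF X x] by (auto simp: Tm is_term_jdg_def)
    have "Term n \<in> hedges" using n by simp
    from norm_jdg_bd[OF X this, of u] u
    have "norm_jdg X (tm_bd (P_obj X) n u) = (\<Gamma> \<turnstile> IsType T)" by (simp add: N tm_bd_eq)
    moreover note ty[OF n tm_bd_in[OF PX n u]]
    moreover have "counit_expr X (tm_app n u [1..<n]) = t" using counit_app_upt[OF x] by (simp add: Tm N)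
    ultimately show ?thesis by (simp add: Tm N del: counit_expr.simps)
  qed (use ty x in auto)
qed

lemma counit_derived:
  assumes J: "J \<in> derived (free_obj (P_obj X))"
  shows "jdg_map (counit_expr X) J \<in> derived (free_obj X)"
proof (rule jdg_map_derived[OF translation_counit _ J])
  fix J assume "J \<in> basic (free_obj (P_obj X))"
  then obtain x u where x: "x \<in> Obj H_cat" "u \<in> omap (P_obj X) x" and "J = basic_jdg (P_obj X) x u"
    by (auto simp: free_obj_def)
  then show "jdg_map (counit_expr X) J \<in> derived (free_obj X)"
    using counit_basic[OF x] jdgs_atD[OF norm_jdg(1)[OF X x]] by simp
qed

abbreviation mult :: "'u psh_arr" where
  "mult \<equiv> lift_map (P_obj X) (counit_expr X) X"

lemma mult_hom: "mult \<in> hom psh_cat (P_obj (P_obj X)) (P_obj X)"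
  by (rule lift_map_hom[OF P_obj_Obj[OF X] X translation_counit counit_derived])

lemma norm_mult:
  "x \<in> Obj H_cat \<Longrightarrow> u \<in> omap (P_obj (P_obj X)) x \<Longrightarrow>
    norm_jdg X (act mult x u) = jdg_map (counit_expr X) (norm_jdg (P_obj X) u)"
  by (rule norm_lift_map[OF P_obj_Obj[OF X] X translation_counit counit_derived])

text \<open>The translation is an interpretation as required of the counit, and by uniqueness of interpretations
the chosen one agrees with it.\<close>

lemma forget_counit: "amap forget (wp_counit (free_obj X)) = mult"
proof -
  let ?T = "free_obj X" and ?GP = "free_obj (P_obj X)"
  note PX = P_obj_Obj[OF X]
  define spec where "spec \<phi> \<longleftrightarrow> interpretation_of ?GP ?T \<phi> \<and>
    (\<forall>x \<in> Obj H_cat. \<forall>J \<in> jdgs_at ?T x.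
      same_class ?T (\<phi> (basic_jdg (P_obj X) x (class_of ?T J))) J)" for \<phi>
  let ?\<phi> = "SOME \<phi>. spec \<phi>"
  have norm_alpha: "alpha (norm_jdg X (class_of ?T J)) J" if "J \<in> jdgs_at ?T x" for x J
    using norm_class_of(1)[OF X, of J] jdgs_atD[OF that] alpha_sym by blast
  have "spec (\<lambda>J \<in> derived ?GP. jdg_map (counit_expr X) J)"
    unfolding spec_def
  proof (intro conjI ballI)
    fix x J assume x: "x \<in> Obj H_cat" and J: "J \<in> jdgs_at ?T x"
    note u = class_of_in[OF x J]
    let ?N = "norm_jdg X (class_of ?T J)"
    have "same_class ?T ?N J"
      using same_class_iff_alpha[OF X, of ?N J] jdgs_atD[OF norm_jdg(1)[OF X x u]] norm_alpha[OF J] by simp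
    then show "same_class ?T ((\<lambda>J \<in> derived ?GP. jdg_map (counit_expr X) J)
        (basic_jdg (P_obj X) x (class_of ?T J))) J"
      using basic_derived[OF PX x u] by (simp add: counit_basic[OF x u])
  qed (rule interpretation_jdg_map[OF PX translation_counit counit_derived])
  then have "spec ?\<phi>" by (rule someI[of spec])
  then have \<phi>: "interpretation_of ?GP ?T ?\<phi>"
    and cls: "\<And>x J. x \<in> Obj H_cat \<Longrightarrow> J \<in> jdgs_at ?T x \<Longrightarrow>
      same_class ?T (?\<phi> (basic_jdg (P_obj X) x (class_of ?T J))) J"
    by (simp_all add: spec_def)
  have "?\<phi> J = jdg_map (counit_expr X) J" if "J \<in> derived ?GP" for J
  proof (rule interpretation_unique[OF X PX \<phi> translation_counit _ that])
    fix x u assume x: "x \<in> Obj H_cat" "u \<in> omap (P_obj X) x"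
    let ?N = "norm_jdg X u"
    note N = norm_jdg[OF X x]
    have "same_class ?T (?\<phi> (basic_jdg (P_obj X) x u)) ?N" using cls[OF x(1) N(1)] N(3) by simp
    then have "same_class ?T ?N (?\<phi> (basic_jdg (P_obj X) x u))"
      unfolding same_class_def by (rule equivclp_sym)
    then have "alpha ?N (?\<phi> (basic_jdg (P_obj X) x u))"
      using same_class_iff_alpha[OF X] jdgs_atD[OF N(1)] by blast
    then show "alpha (?\<phi> (basic_jdg (P_obj X) x u)) (jdg_map (counit_expr X) (basic_jdg (P_obj X) x u))"
      unfolding counit_basic[OF x] by (rule alpha_sym)
  qed
  from forget_gat_arrow(2)[OF PX X translation_counit counit_derived \<phi> this]
  have "amap forget (gat_arrow ?GP ?T ?\<phi>) = mult" .
  moreover have "wp_counit ?T = gat_arrow ?GP ?T ?\<phi>"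
    using is_gat_free_obj[OF X] by (simp add: wp_counit_def gat_cat_def spec_def[abs_def])
  ultimately show ?thesis by simp
qed

end


subsection \<open>Monad laws\<close>

lemma ren_app: "ren \<sigma> (app x u ys) = app x u (map \<sigma> ys)"
  by (cases x) (simp_all add: comp_def)

text \<open>Naturality of the multiplication: relabelling the expression that a head stands for is the same as
relabelling the head.\<close>

lemma counit_relabel:
  fixes f :: "'u::infinite psh_arr"
  assumes f: "f \<in> hom psh_cat X Y" and J: "ok_jdg (P_obj X) J" "ty_or_tm J"
  shows "jdg_map (counit_expr Y) (jdg_map (relabel (amap P f)) J) =
    jdg_map (relabel f) (jdg_map (counit_expr X) J)"
  unfolding jdg_map_comp
proof (rule jdg_map_cong[OF J])
  have X: "X \<in> Obj psh_cat" and Y: "Y \<in> Obj psh_cat" using psh_hom_Obj[OF f] by auto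
  fix x u and ys :: "nat list"
  assume x: "x \<in> Obj H_cat" "u \<in> omap (P_obj X) x" and ys: "length ys = hdeg x - 1"
  show "counit_expr Y (relabel (amap P f) (app x u ys)) = relabel f (counit_expr X (app x u ys))"
    by (simp add: counit_app[OF X x ys] counit_app[OF Y x(1) act_in[OF P_hom[OF f] x] ys]
        norm_P[OF f x] relabel_ren jdg_map_def)
qed simp

lemma mult_natural:
  fixes f :: "'u::infinite psh_arr"
  assumes f: "f \<in> hom psh_cat X Y"
  shows "Comp psh_cat (amap P f) (mult X) = Comp psh_cat (mult Y) (amap P (amap P f))"
proof -
  have X: "X \<in> Obj psh_cat" and Y: "Y \<in> Obj psh_cat" using psh_hom_Obj[OF f] by auto
  note \<mu>X = mult_hom[OF X] and \<mu>Y = mult_hom[OF Y] and Pf = P_hom[OF f] and PPf = P_hom[OF P_hom[OF f]]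
  show ?thesis
  proof (rule P_hom_eq[OF Y psh_hom_comp[OF \<mu>X Pf] psh_hom_comp[OF PPf \<mu>Y]])
    fix x u assume x: "x \<in> Obj H_cat" "u \<in> omap (P_obj (P_obj X)) x"
    show "norm_jdg Y (act (Comp psh_cat (amap P f) (mult X)) x u) =
        norm_jdg Y (act (Comp psh_cat (mult Y) (amap P (amap P f))) x u)"
      by (simp add: act_comp[OF \<mu>X Pf x] act_comp[OF PPf \<mu>Y x] norm_P[OF f x(1) act_in[OF \<mu>X x]]
          norm_mult[OF X x] norm_mult[OF Y x(1) act_in[OF PPf x]] norm_P[OF Pf x]
          counit_relabel[OF f norm_jdg_ok[OF P_obj_Obj[OF X] x]])
  qed
qed

context
  fixes X :: "'u::infinite psh"
  assumes X: "X \<in> Obj psh_cat"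
begin

private lemma P1: "P_obj X \<in> Obj psh_cat" by (rule P_obj_Obj[OF X])
private lemma P2: "P_obj (P_obj X) \<in> Obj psh_cat" by (rule P_obj_Obj[OF P1])

lemma mult_unit: "Comp psh_cat (mult X) (wp_unit (P_obj X)) = Id psh_cat (P_obj X)"
proof (rule P_hom_eq[OF X psh_hom_comp[OF unit_hom[OF P1] mult_hom[OF X]] category_id[OF category_psh P1]])
  fix x u assume x: "x \<in> Obj H_cat" "u \<in> omap (P_obj X) x"
  show "norm_jdg X (act (Comp psh_cat (mult X) (wp_unit (P_obj X))) x u) =
      norm_jdg X (act (Id psh_cat (P_obj X)) x u)"
    by (simp add: act_comp[OF unit_hom[OF P1] mult_hom[OF X] x] act_id[OF P1 x]
        norm_mult[OF X x(1) act_in[OF unit_hom[OF P1] x]] norm_unit[OF P1 x] counit_basic[OF X x])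
qed

lemma mult_P_unit: "Comp psh_cat (mult X) (amap P (wp_unit X)) = Id psh_cat (P_obj X)"
proof (rule P_hom_eq[OF X psh_hom_comp[OF P_hom[OF unit_hom[OF X]] mult_hom[OF X]]
      category_id[OF category_psh P1]])
  note \<eta> = unit_hom[OF X] and \<mu> = mult_hom[OF X]
  fix x u assume x: "x \<in> Obj H_cat" "u \<in> omap (P_obj X) x"
  have "jdg_map (counit_expr X) (jdg_map (relabel (wp_unit X)) (norm_jdg X u)) =
      jdg_map (\<lambda>e. e) (norm_jdg X u)"
    unfolding jdg_map_comp
  proof (rule jdg_map_cong[OF norm_jdg_ok[OF X x]])
    fix x u and ys :: "nat list"
    assume x: "x \<in> Obj H_cat" "u \<in> omap X x" and ys: "length ys = hdeg x - 1"
    have "map (\<lambda>v. ys ! (v - 1)) [1..<hdeg x] = ys" using ys by (auto intro: nth_equalityI)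
    then have "ren (\<lambda>v. ys ! (v - 1)) (app x u [1..<hdeg x]) = app x u ys"
      by (simp only: ren_app)
    then show "counit_expr X (relabel (wp_unit X) (app x u ys)) = app x u ys"
      by (simp add: counit_app[OF X x(1) act_in[OF \<eta> x] ys] norm_unit[OF X x] subject_basic)
  qed simp
  then show "norm_jdg X (act (Comp psh_cat (mult X) (amap P (wp_unit X))) x u) =
      norm_jdg X (act (Id psh_cat (P_obj X)) x u)"
    by (simp add: act_comp[OF P_hom[OF \<eta>] \<mu> x] act_id[OF P1 x]
        norm_mult[OF X x(1) act_in[OF P_hom[OF \<eta>] x]] norm_P[OF \<eta> x] jdg_map_ident)
qed

lemma mult_assoc:
  "Comp psh_cat (mult X) (mult (P_obj X)) = Comp psh_cat (mult X) (amap P (mult X))"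
proof -
  note \<mu> = mult_hom[OF X] and \<mu>P = mult_hom[OF P1] and P\<mu> = P_hom[OF mult_hom[OF X]]
  show ?thesis
  proof (rule P_hom_eq[OF X psh_hom_comp[OF \<mu>P \<mu>] psh_hom_comp[OF P\<mu> \<mu>]])
    fix x u assume x: "x \<in> Obj H_cat" "u \<in> omap (P_obj (P_obj (P_obj X))) x"
    have "jdg_map (counit_expr X) (jdg_map (counit_expr (P_obj X)) (norm_jdg (P_obj (P_obj X)) u)) =
        jdg_map (counit_expr X) (jdg_map (relabel (mult X)) (norm_jdg (P_obj (P_obj X)) u))"
      unfolding jdg_map_comp
    proof (rule jdg_map_cong[OF norm_jdg_ok[OF P2 x]])
      fix x u and ys :: "nat list"
      assume x: "x \<in> Obj H_cat" "u \<in> omap (P_obj (P_obj X)) x" and ys: "length ys = hdeg x - 1"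
      show "counit_expr X (counit_expr (P_obj X) (app x u ys)) =
          counit_expr X (relabel (mult X) (app x u ys))"
        by (simp add: counit_app[OF P1 x ys] counit_app[OF X x(1) act_in[OF \<mu> x] ys]
            norm_mult[OF X x] counit_ren jdg_map_def)
    qed simp
    then show "norm_jdg X (act (Comp psh_cat (mult X) (mult (P_obj X))) x u) =
        norm_jdg X (act (Comp psh_cat (mult X) (amap P (mult X))) x u)"
      by (simp add: act_comp[OF \<mu>P \<mu> x] act_comp[OF P\<mu> \<mu> x] norm_mult[OF X x(1) act_in[OF \<mu>P x]]
          norm_mult[OF X x(1) act_in[OF P\<mu> x]] norm_mult[OF P1 x] norm_P[OF \<mu> x])
  qed
qed

end


section \<open>Cartesianness of the unit and the multiplication\<close>

lemma app_inject: "app x u ys = app x v zs \<longleftrightarrow> u = v \<and> ys = zs"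
  by (cases x) auto

lemma basic_jdg_inject: "basic_jdg X x u = basic_jdg X x v \<Longrightarrow> u = v"
  by (cases x) auto

lemma relabel_eq_Var: "relabel f e = Var x \<longleftrightarrow> e = Var x"
  by (cases e) (auto simp: relabel_def)

text \<open>The context of a type contains that of the renamed basic judgement of its head, and here the arguments
leave room for nothing else.\<close>

lemma ok_full_context:
  assumes X: "X \<in> Obj psh_cat" and \<Gamma>: "ok_ctx X \<Gamma>" "map fst \<Gamma> = [1..<n]"
    and T: "ok_type X \<Gamma> (ty_app m A [1..<n])"
  shows "\<Gamma> = basic_ctx X m A"
proof -
  have "filter (\<lambda>p. fst p \<in> set [1..<n]) \<Gamma> = \<Gamma>"
    unfolding \<Gamma>(2)[symmetric] by (auto simp: filter_id_conv)
  moreover have "[1..<n] = [1..<m]"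
  proof (cases "n \<le> 1")
    case False
    then have "n = m" using ok_type_app(1,3)[OF \<Gamma>(1) T] by simp
    then show ?thesis by simp
  qed (use ok_type_app(1,3)[OF \<Gamma>(1) T] in auto)
  ultimately show ?thesis using filter_ok_ctx[OF X \<Gamma>(1) T] by (simp only: basic_ctx_eq_inst)
qed

lemma unit_cartesian:
  fixes f :: "'u::infinite psh_arr"
  assumes f: "f \<in> hom psh_cat X Y"
  shows "is_pullback psh_cat (wp_unit X) f (amap P f) (wp_unit Y)"
proof -
  have X: "X \<in> Obj psh_cat" and Y: "Y \<in> Obj psh_cat" using psh_hom_Obj[OF f] by auto
  note \<eta>X = unit_hom[OF X] and \<eta>Y = unit_hom[OF Y]
  show ?thesis
  proof (rule psh_pullbackI[OF \<eta>X f P_hom[OF f] \<eta>Y])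
    fix x v assume x: "x \<in> Obj H_cat" "v \<in> omap X x"
    show "act (amap P f) x (act (wp_unit X) x v) = act (wp_unit Y) x (act f x v)"
      using unit_natural[OF f] act_comp[OF \<eta>X P_hom[OF f] x] act_comp[OF f \<eta>Y x] by simp
  next
    fix x a b
    assume x: "x \<in> Obj H_cat" and a: "a \<in> omap (P_obj X) x" and b: "b \<in> omap Y x"
      and eq: "act (amap P f) x a = act (wp_unit Y) x b"
    let ?N = "norm_jdg X a"
    have N: "?N \<in> jdgs_at (free_obj X) x" "normal ?N" "ok_jdg X ?N"
      using norm_jdg[OF X x a] norm_jdg_ok[OF X x a] by auto
    have eqN: "jdg_map (relabel f) ?N = basic_jdg Y x b"
      using norm_P[OF f x a] norm_unit[OF Y x b] eq by simp
    have "\<exists>v \<in> omap X x. ?N = basic_jdg X x v"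
    proof (cases x)
      case (Ty n)
      then obtain \<Gamma> T where J: "?N = (\<Gamma> \<turnstile> IsType T)" and n: "n = length \<Gamma> + 1"
        using N(1) by (auto simp: is_type_jdg_def degree_def)
      have ok: "ok_ctx X \<Gamma>" "ok_type X \<Gamma> T" and vars: "map fst \<Gamma> = [1..<n]"
        using N(2,3) unfolding J by (simp_all add: normal_def degree_def n)
      obtain m A ys where T: "T = ty_app m A ys" using ok_type_head[OF ok(2)] .
      have "m = n" "ys = [1..<n]" using eqN by (auto simp: J Ty T)
      then have "?N = basic_jdg X x A" "A \<in> omap X x"
        using ok_full_context[OF X ok(1) vars, of m A] ok_type_app(2)[OF ok[unfolded T]] ok(2)
        by (simp_all add: J Ty T)
      then show ?thesis by blast
    next
      case (Tm n)
      then obtain \<Gamma> t T where J: "?N = (\<Gamma> \<turnstile> HasType t T)" and n: "n = length \<Gamma> + 1"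
        using N(1) by (auto simp: is_term_jdg_def degree_def)
      have ok: "ok_ctx X \<Gamma>" "ok_term X \<Gamma> t T" and vars: "map fst \<Gamma> = [1..<n]"
        using N(2,3) unfolding J by (simp_all add: normal_def degree_def n)
      have rt: "relabel f t = tm_app n b [1..<n]" using eqN by (simp add: J Tm)
      from ok(2) show ?thesis
      proof cases
        case (const m c ys)
        then have "m = n" "ys = [1..<n]" using rt by auto
        then show ?thesis
          using const ok_full_context[OF X ok(1) vars, of m "tm_bd X m c"]
          by (intro bexI[of _ c]) (simp_all add: J Tm)
      qed (use rt in simp)
    qed
    then obtain v where v: "v \<in> omap X x" "?N = basic_jdg X x v" by blast
    show "\<exists>!v. v \<in> omap X x \<and> act (wp_unit X) x v = a \<and> act f x v = b"
    proof (rule ex1I[of _ v], intro conjI)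
      show "act (wp_unit X) x v = a"
        by (rule norm_jdg_inj[OF X x act_in[OF \<eta>X x v(1)] a]) (simp add: norm_unit[OF X x v(1)] v(2))
      show "act f x v = b"
        using eqN relabel_basic[OF f x v(1)] v(2) by (auto intro: basic_jdg_inject)
      fix w assume w: "w \<in> omap X x \<and> act (wp_unit X) x w = a \<and> act f x w = b"
      then show "w = v" using norm_unit[OF X x, of w] v(2) by (intro basic_jdg_inject[of X x w v]) simp
    qed (rule v(1))
  qed
qed

lemma act_lift_class_of:
  fixes X Y :: "'u::infinite psh"
  assumes X: "X \<in> Obj psh_cat" and Y: "Y \<in> Obj psh_cat" and \<tau>: "translation \<tau>"
    and der: "\<And>J. J \<in> derived (free_obj X) \<Longrightarrow> jdg_map \<tau> J \<in> derived (free_obj Y)"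
    and x: "x \<in> Obj H_cat" and J: "J \<in> jdgs_at (free_obj X) x"
  shows "act (lift_map X \<tau> Y) x (class_of (free_obj X) J) = class_of (free_obj Y) (jdg_map \<tau> J)"
proof -
  let ?N = "norm_jdg X (class_of (free_obj X) J)"
  have u: "class_of (free_obj X) J \<in> omap (P_obj X) x" by (rule class_of_in[OF x J])
  have "alpha (jdg_map \<tau> ?N) (jdg_map \<tau> J)"
    using norm_class_of(1)[OF X, of J] jdgs_atD[OF J] alpha_sym alpha_jdg_map[OF \<tau>] by blast
  then show ?thesis
    using class_of_eq_iff[OF Y, of "jdg_map \<tau> ?N" "jdg_map \<tau> J"]
      jdgs_atD[OF jdg_map_jdgs_at[OF X Y \<tau> der norm_jdg(1)[OF X x u]]]
      jdgs_atD[OF jdg_map_jdgs_at[OF X Y \<tau> der J]] act_lift_map[OF X Y \<tau> der x u] by simp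
qed

abbreviation restrict_ctx :: "nat set \<Rightarrow> 'w ctx \<Rightarrow> 'w ctx" where
  "restrict_ctx V \<equiv> filter (\<lambda>p. fst p \<in> V)"

lemma restrict_ctx_map [simp]:
  "restrict_ctx V (map (apsnd \<tau>) \<Gamma>) = map (apsnd \<tau>) (restrict_ctx V \<Gamma>)"
  by (simp add: filter_map comp_def)

lemma map_fst_restrict_ctx: "map fst (restrict_ctx V \<Gamma>) = filter (\<lambda>v. v \<in> V) (map fst \<Gamma>)"
  by (simp add: filter_map comp_def)

text \<open>Strengthening: by well-formedness a judgement refers to variables only through the arguments of its
types, so variables outside a set that is closed under taking arguments can be omitted.\<close>

lemma ok_type_restrict:
  assumes "ok_type X \<Gamma> T" "fv T \<subseteq> V" shows "ok_type X (restrict_ctx V \<Gamma>) T"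
  using assms(1)
proof cases
  case (dependent n A y ys)
  have "y \<in> V" using assms(2) by (simp add: dependent)
  then show ?thesis unfolding dependent(1) using dependent by (intro ok_type.dependent) auto
qed (use closed in auto)

lemma ok_term_restrict:
  assumes "ok_term X \<Gamma> t T" "fv t \<subseteq> V" shows "ok_term X (restrict_ctx V \<Gamma>) t T"
  using assms(1)
proof cases
  case (const n a ys)
  then have "ok_type X (restrict_ctx V \<Gamma>) T" using assms(2) by (intro ok_type_restrict) auto
  then show ?thesis using const ok_term.const by metis
qed (use assms(2) in \<open>auto intro: ok_term.var\<close>)

lemma ok_ctx_restrict:
  assumes "ok_ctx X \<Gamma>" "\<And>y T. (y, T) \<in> set \<Gamma> \<Longrightarrow> y \<in> V \<Longrightarrow> fv T \<subseteq> V"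
  shows "ok_ctx X (restrict_ctx V \<Gamma>)"
  using assms
proof (induction rule: ok_ctx.induct)
  case (Snoc \<Gamma> T x)
  have "ok_ctx X (restrict_ctx V \<Gamma>)" using Snoc.IH Snoc.prems by auto
  moreover have "ok_type X (restrict_ctx V \<Gamma>) T" if "x \<in> V"
    using ok_type_restrict[OF Snoc.hyps(2)] Snoc.prems[of x T] that by simp
  ultimately show ?case using Snoc.hyps(3) by auto
qed (simp add: ok_ctx.Nil)

context
  fixes Z :: "'u::infinite psh"
  assumes Z: "Z \<in> Obj psh_cat"
begin

lemma class_of_instance:
  assumes x: "x \<in> Obj H_cat" "u \<in> omap (P_obj Z) x" and \<sigma>: "bij \<sigma>"
  shows "class_of (free_obj Z) (jdg_map (counit_expr Z) (perm_jdg \<sigma> (basic_jdg (P_obj Z) x u))) = u"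
proof -
  have "jdg_map (counit_expr Z) (perm_jdg \<sigma> (basic_jdg (P_obj Z) x u)) = perm_jdg \<sigma> (norm_jdg Z u)"
    using counit_basic[OF Z x] by (simp add: jdg_map_perm[OF translation_counit])
  moreover have "alpha (norm_jdg Z u) (perm_jdg \<sigma> (norm_jdg Z u))" using \<sigma> by (auto simp: alpha_def)
  moreover note N = norm_jdg[OF Z x]
  moreover note alpha_jdgs_at[OF \<open>alpha (norm_jdg Z u) (perm_jdg \<sigma> (norm_jdg Z u))\<close> N(1)]
  ultimately show ?thesis
    using class_of_eq_iff[OF Z, of "norm_jdg Z u" "perm_jdg \<sigma> (norm_jdg Z u)"]
    by (simp add: jdgs_atD)
qed

text \<open>Over its arguments, \<open>B(ys)\<close> is a renaming of the basic judgement of \<open>B\<close>, which the counit sends to the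
normal form of \<open>B\<close>.  So the head can be recovered from the expression that it stands for, together with
the context of that expression.\<close>

lemma recover_type_head:
  assumes \<Theta>: "ok_ctx (P_obj Z) \<Theta>" and S: "ok_type (P_obj Z) \<Theta> (ty_app k B ys)"
  shows "class_of (free_obj Z) (restrict_ctx (set ys) (map (apsnd (counit_expr Z)) \<Theta>) \<turnstile>
    IsType (counit_expr Z (ty_app k B ys))) = B"
proof -
  note PZ = P_obj_Obj[OF Z]
  note app = ok_type_app[OF \<Theta> S]
  obtain \<sigma> where \<sigma>: "bij \<sigma>" "map \<sigma> [1..<k] = ys"
    using ex_perm_upt[OF ok_type_distinct[OF PZ \<Theta> S] app(3)] by blast
  have "jdg_map (counit_expr Z) (perm_jdg \<sigma> (basic_jdg (P_obj Z) (Ty k) B)) =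
      (restrict_ctx (set ys) (map (apsnd (counit_expr Z)) \<Theta>) \<turnstile> IsType (counit_expr Z (ty_app k B ys)))"
    unfolding perm_basic(1)[OF \<sigma>(2)] filter_ok_ctx[OF PZ \<Theta> S, symmetric] by simp
  then show ?thesis using class_of_instance[OF _ _ \<sigma>(1), of "Ty k" B] app by simp
qed

lemma recover_term_head:
  assumes \<Theta>: "ok_ctx (P_obj Z) \<Theta>" and k: "k \<ge> 1" "b \<in> omap (P_obj Z) (Tm k)"
    and S: "ok_type (P_obj Z) \<Theta> (ty_app k (tm_bd (P_obj Z) k b) ys)"
  shows "class_of (free_obj Z) (restrict_ctx (set ys) (map (apsnd (counit_expr Z)) \<Theta>) \<turnstile>
    HasType (counit_expr Z (tm_app k b ys)) (counit_expr Z (ty_app k (tm_bd (P_obj Z) k b) ys))) = b"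
proof -
  note PZ = P_obj_Obj[OF Z]
  note app = ok_type_app[OF \<Theta> S]
  obtain \<sigma> where \<sigma>: "bij \<sigma>" "map \<sigma> [1..<k] = ys"
    using ex_perm_upt[OF ok_type_distinct[OF PZ \<Theta> S] app(3)] by blast
  have "jdg_map (counit_expr Z) (perm_jdg \<sigma> (basic_jdg (P_obj Z) (Tm k) b)) =
      (restrict_ctx (set ys) (map (apsnd (counit_expr Z)) \<Theta>) \<turnstile>
       HasType (counit_expr Z (tm_app k b ys)) (counit_expr Z (ty_app k (tm_bd (P_obj Z) k b) ys)))"
    unfolding perm_basic(2)[OF \<sigma>(2)] filter_ok_ctx[OF PZ \<Theta> S, symmetric] by simp
  then show ?thesis using class_of_instance[OF _ _ \<sigma>(1), of "Tm k" b] k by simp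
qed

text \<open>The variables of \<open>J\<close> are renamed to those of the normal form when passing to the class, and back when the
arguments are substituted.\<close>

lemma counit_class_of:
  assumes x: "x \<in> Obj H_cat" and J: "J \<in> jdgs_at (free_obj Z) x" and ys: "map fst (ctx J) = ys"
  shows "counit_expr Z (app x (class_of (free_obj Z) J) ys) = subject (rhs J)"
proof -
  let ?N = "norm_jdg Z (class_of (free_obj Z) J)"
  have d: "J \<in> derived (free_obj Z)" "ty_or_tm J" using jdgs_atD[OF J] by auto
  have ok: "ok_jdg Z J" using d derived_iff_ok[OF Z] by simp
  have len: "length ys = hdeg x - 1" using degree_jdgs_at[OF J] ys by (auto simp: degree_def)
  obtain \<sigma> where \<sigma>: "bij \<sigma>" "?N = perm_jdg \<sigma> J"
    using norm_class_of(1)[OF Z d] by (auto simp: alpha_def)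
  have "degree ?N = hdeg x"
    using degree_jdgs_at[OF norm_jdg(1)[OF Z x class_of_in[OF x J]]] .
  then have "map \<sigma> ys = [1..<hdeg x]"
    using norm_class_of(2)[OF Z d] ys by (simp add: normal_def \<sigma>(2) perm_jdg_def comp_def split_beta
        flip: ys del: upt_Suc)
  then have pos: "ys ! (\<sigma> v - 1) = v" if "v \<in> set ys" for v
  proof -
    obtain i where i: "i < length ys" "v = ys ! i" using \<open>v \<in> set ys\<close> by (metis in_set_conv_nth)
    then have "\<sigma> v = map \<sigma> ys ! i" by simp
    also have "\<dots> = i + 1" using i(1) len by (simp add: \<open>map \<sigma> ys = _\<close> nth_upt)
    finally show ?thesis using i by simp
  qed
  have "subject (rhs ?N) = ren \<sigma> (subject (rhs J))"
    unfolding \<sigma>(2) by (cases J; cases "rhs J") auto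
  then have "counit_expr Z (app x (class_of (free_obj Z) J) ys) = ren (\<lambda>v. ys ! (\<sigma> v - 1)) (subject (rhs J))"
    by (simp add: counit_app[OF Z x class_of_in[OF x J] len] ren_ren comp_def)
  also have "\<dots> = subject (rhs J)"
  proof (rule ren_ident, rule pos)
    fix v assume "v \<in> fv (subject (rhs J))"
    then show "v \<in> set ys" using fv_subject[OF ok] by (auto simp flip: ys)
  qed
  finally show ?thesis .
qed

end


definition rehead :: "'u \<Rightarrow> 'u uexpr \<Rightarrow> 'u uexpr" where
  "rehead u e = (case e of Var x \<Rightarrow> Var x
     | App w es \<Rightarrow> App (map_sum (\<lambda>(k, _). (k, u)) (\<lambda>(k, _). (k, u)) w) es)"

lemma rehead_Var [simp]: "rehead u (Var y) = Var y"
  and rehead_app [simp]: "rehead u (app x v ys) = app x u ys"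
  and rehead_ty_app [simp]: "rehead u (ty_app k v ys) = ty_app k u ys"
  and rehead_tm_app [simp]: "rehead u (tm_app k v ys) = tm_app k u ys"
  by (cases x; simp add: rehead_def)+

text \<open>Given an expression \<open>S\<close> over heads and a judgement over \<open>\<Gamma>\<close> that it stands for, the head of \<open>S\<close> is replaced
by the class of the judgement, strengthened to the arguments of \<open>S\<close>.\<close>

definition relift :: "'u psh \<Rightarrow> 'u uctx \<Rightarrow> 'u urhs \<Rightarrow>
    'u uexpr \<Rightarrow> 'u uexpr" where
  "relift X \<Gamma> R S = rehead (class_of (free_obj X) (restrict_ctx (fv S) \<Gamma> \<turnstile> R)) S"

lemma relift_Var [simp]: "relift X \<Gamma> R (Var x) = Var x"
  and relift_ty_app [simp]: "relift X \<Gamma> R (ty_app k B ys) =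
    ty_app k (class_of (free_obj X) (restrict_ctx (set ys) \<Gamma> \<turnstile> R)) ys"
  and relift_tm_app [simp]: "relift X \<Gamma> R (tm_app k B ys) =
    tm_app k (class_of (free_obj X) (restrict_ctx (set ys) \<Gamma> \<turnstile> R)) ys"
  by (simp_all add: relift_def)

abbreviation type_in :: "'w ctx \<Rightarrow> nat \<Rightarrow> 'w expr" where
  "type_in \<Gamma> y \<equiv> the (map_of \<Gamma> y)"

definition relift_ctx :: "'u psh \<Rightarrow> 'u uctx \<Rightarrow>
    'u uctx \<Rightarrow> 'u uctx" where
  "relift_ctx X \<Gamma> = map (\<lambda>(y, S). (y, relift X \<Gamma> (IsType (type_in \<Gamma> y)) S))"

primrec relift_rhs :: "'u psh \<Rightarrow> 'u uctx \<Rightarrow> 'u urhs \<Rightarrow>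
    'u urhs \<Rightarrow> 'u urhs" where
  "relift_rhs X \<Gamma> (IsType T) = rhs_map (relift X \<Gamma> (IsType T))"
| "relift_rhs X \<Gamma> (HasType t T) = (\<lambda>R.
     case R of HasType s S \<Rightarrow> HasType (relift X \<Gamma> (HasType t T) s) (relift X \<Gamma> (IsType T) S) | _ \<Rightarrow> R)"
| "relift_rhs X \<Gamma> (TypeEq T T') = (\<lambda>R. R)"
| "relift_rhs X \<Gamma> (TermEq t t' T) = (\<lambda>R. R)"

definition relift_jdg :: "'u psh \<Rightarrow> 'u ujdg \<Rightarrow> 'u ujdg \<Rightarrow> 'u ujdg" where
  "relift_jdg X J K = (relift_ctx X (ctx J) (ctx K) \<turnstile> relift_rhs X (ctx J) (rhs J) (rhs K))"

lemma type_in_eq: "distinct (map fst \<Gamma>) \<Longrightarrow> (y, T) \<in> set \<Gamma> \<Longrightarrow> type_in \<Gamma> y = T"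
  by simp

text \<open>By \<open>recover_type_head\<close> and \<open>recover_term_head\<close> all heads of a judgement over \<open>P X\<close> are determined by the
shape of the judgement, for which it is enough to know some relabelling, and by the judgement over \<open>X\<close>
that it stands for.\<close>

lemma relift_unique:
  fixes X :: "'u::infinite psh"
  assumes X: "X \<in> Obj psh_cat" and K: "ok_jdg (P_obj X) K" "ty_or_tm K"
  shows "K = relift_jdg X (jdg_map (counit_expr X) K) (jdg_map (relabel g) K)"
proof -
  obtain \<Theta> R where K': "K = (\<Theta> \<turnstile> R)" by (cases K)
  let ?c = "counit_expr X" and ?\<Gamma> = "map (apsnd (counit_expr X)) \<Theta>"
  have \<Theta>: "ok_ctx (P_obj X) \<Theta>" and R: "ok_rhs (P_obj X) \<Theta> R" using K by (simp_all add: K')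
  have ty: "relift X ?\<Gamma> (IsType (?c S)) (relabel g S) = S" if S: "ok_type (P_obj X) \<Theta> S" for S
  proof -
    obtain k B ys where S': "S = ty_app k B ys" using ok_type_head[OF S] .
    show ?thesis unfolding S' relabel_ty_app relift_ty_app recover_type_head[OF X \<Theta> S[unfolded S']] ..
  qed
  have "distinct (map fst ?\<Gamma>)" using ok_ctx_distinct[OF \<Theta>] by (simp add: comp_def)
  then have "type_in ?\<Gamma> y = ?c S" if "(y, S) \<in> set \<Theta>" for y S
    by (rule type_in_eq) (use that in force)
  then have "relift_ctx X ?\<Gamma> (map (apsnd (relabel g)) \<Theta>) = \<Theta>"
    using ty ok_ctx_type[OF \<Theta>] by (auto simp: relift_ctx_def apsnd_def comp_def intro!: map_idI)
  moreover have "relift_rhs X ?\<Gamma> (rhs_map ?c R) (rhs_map (relabel g) R) = R"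
    using K(2) unfolding K'
  proof (cases rule: ty_or_tm_cases)
    case (tm \<Delta> s S)
    then have s: "ok_term (P_obj X) \<Theta> s S" using R by simp
    note ty' = ty[OF ok_term_type[OF \<Theta> s]]
    from s show ?thesis
    proof cases
      case (const k b ys)
      show ?thesis
        using tm ty' recover_term_head[OF X \<Theta> const(3-5)] unfolding const(1,2)
        by (simp del: counit_expr.simps)
    qed (use tm ty' in simp)
  qed (use R ty in simp)
  ultimately show ?thesis by (simp add: relift_jdg_def K')
qed

text \<open>Existence of lifts: a context \<open>\<Theta>\<close> of heads over \<open>P Y\<close> stands for the relabelling along \<open>f\<close> of a context
\<open>\<Gamma>\<close> over \<open>X\<close>.  The parts of \<open>\<Gamma>\<close> over the arguments of the types in \<open>\<Theta>\<close> are well-formed, since relabelling does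
not affect variables, and their classes are the required heads.\<close>

context
  fixes f :: "'u::infinite psh_arr" and X Y :: "'u psh"
    and \<Gamma> \<Theta> :: "'u uctx"
  assumes f: "f \<in> hom psh_cat X Y" and \<Gamma>: "ok_ctx X \<Gamma>" and \<Theta>: "ok_ctx (P_obj Y) \<Theta>"
    and eq: "map (apsnd (relabel f)) \<Gamma> = map (apsnd (counit_expr Y)) \<Theta>"
begin

private lemma X: "X \<in> Obj psh_cat" and Y: "Y \<in> Obj psh_cat" using psh_hom_Obj[OF f] by auto
private lemma PX: "P_obj X \<in> Obj psh_cat" and PY: "P_obj Y \<in> Obj psh_cat"
  using P_obj_Obj X Y by auto

private lemma vars: "map fst \<Gamma> = map fst \<Theta>"
  using arg_cong[OF eq, of "map fst"] by (simp add: comp_def)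

private lemma parallel:
  assumes "(y, S) \<in> set \<Theta>"
  shows "(y, type_in \<Gamma> y) \<in> set \<Gamma>" "relabel f (type_in \<Gamma> y) = counit_expr Y S"
proof -
  have "(y, counit_expr Y S) \<in> set (map (apsnd (counit_expr Y)) \<Theta>)" using assms by force
  then obtain T where T: "(y, T) \<in> set \<Gamma>" "relabel f T = counit_expr Y S"
    unfolding eq[symmetric] by auto
  then show "(y, type_in \<Gamma> y) \<in> set \<Gamma>" "relabel f (type_in \<Gamma> y) = counit_expr Y S"
    using type_in_eq[OF ok_ctx_distinct[OF \<Gamma>] T(1)] by simp_all
qed

private lemma fv_eq:
  assumes "relabel f T = counit_expr Y S" shows "fv T \<subseteq> fv S"
proof -
  have "fv T = fv (counit_expr Y S)" using arg_cong[OF assms, of fv] by (simp add: relabel_def)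
  then show ?thesis using translation_counit[of Y] unfolding translation_def by blast
qed

private lemma vars_restrict:
  assumes S: "ok_type (P_obj Y) \<Theta> (ty_app k B ys)"
  shows "map fst (restrict_ctx (set ys) \<Gamma>) = ys"
proof -
  have "map fst (restrict_ctx (set ys) \<Gamma>) = map fst (restrict_ctx (set ys) \<Theta>)"
    unfolding map_fst_restrict_ctx vars ..
  also have "\<dots> = ys"
    unfolding filter_ok_ctx[OF PY \<Theta> S] by (rule map_fst_inst_ctx[OF ok_type_app(3)[OF \<Theta> S]])
  finally show ?thesis .
qed

private lemma ok_restricted:
  assumes S: "ok_type (P_obj Y) \<Theta> (ty_app k B ys)"
  shows "ok_ctx X (restrict_ctx (set ys) \<Gamma>)"
proof (rule ok_ctx_restrict[OF \<Gamma>])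
  fix y T assume y: "(y, T) \<in> set \<Gamma>" "y \<in> set ys"
  have "(y, relabel f T) \<in> set (map (apsnd (relabel f)) \<Gamma>)" using y by force
  then obtain S' where S': "(y, S') \<in> set \<Theta>" "relabel f T = counit_expr Y S'"
    unfolding eq by auto
  have "(y, S') \<in> set (restrict_ctx (set ys) \<Theta>)" using S'(1) y(2) by simp
  then have "fv S' \<subseteq> set ys"
    unfolding filter_ok_ctx[OF PY \<Theta> S] by (auto simp: inst_ctx_def dest: in_set_takeD)
  then show "fv T \<subseteq> set ys" using fv_eq[OF S'(2)] by blast
qed

private lemma type_part:
  assumes S: "ok_type (P_obj Y) \<Theta> (ty_app k B ys)" and T: "ok_type X \<Gamma> T"
    and TS: "relabel f T = counit_expr Y (ty_app k B ys)"
  shows "(restrict_ctx (set ys) \<Gamma> \<turnstile> IsType T) \<in> jdgs_at (free_obj X) (Ty k)"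
proof -
  have "fv T \<subseteq> set ys" using fv_eq[OF TS] by simp
  then have "(restrict_ctx (set ys) \<Gamma> \<turnstile> IsType T) \<in> derived (free_obj X)"
    using ok_restricted[OF S] ok_type_restrict[OF T] by (simp add: derived_iff_ok[OF X])
  moreover have "length (restrict_ctx (set ys) \<Gamma>) + 1 = k"
    using ok_type_app(1,3)[OF \<Theta> S] arg_cong[OF vars_restrict[OF S], of length] by simp
  ultimately show ?thesis by (simp add: degree_def)
qed

private lemma term_part:
  assumes S: "ok_type (P_obj Y) \<Theta> (ty_app k B ys)" and t: "ok_term X \<Gamma> t T"
    and ts: "relabel f t = counit_expr Y (tm_app k b ys)"
  shows "(restrict_ctx (set ys) \<Gamma> \<turnstile> HasType t T) \<in> jdgs_at (free_obj X) (Tm k)"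
proof -
  have "fv t \<subseteq> set ys" using fv_eq[OF ts] by simp
  then have "(restrict_ctx (set ys) \<Gamma> \<turnstile> HasType t T) \<in> derived (free_obj X)"
    using ok_restricted[OF S] ok_term_restrict[OF t] by (simp add: derived_iff_ok[OF X])
  moreover have "length (restrict_ctx (set ys) \<Gamma>) + 1 = k"
    using ok_type_app(1,3)[OF \<Theta> S] arg_cong[OF vars_restrict[OF S], of length] by simp
  ultimately show ?thesis by (simp add: degree_def)
qed

private lemma P_class_of:
  "x \<in> Obj H_cat \<Longrightarrow> J \<in> jdgs_at (free_obj X) x \<Longrightarrow>
    act (amap P f) x (class_of (free_obj X) J) = class_of (free_obj Y) (jdg_map (relabel f) J)"
  unfolding P_amap[OF f] by (rule act_lift_class_of[OF X Y translation_relabel relabel_derived[OF f]])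

private lemma relift_type:
  assumes S: "ok_type (P_obj Y) \<Theta> S" and T: "ok_type X \<Gamma> T" and TS: "relabel f T = counit_expr Y S"
  shows "relabel (amap P f) (relift X \<Gamma> (IsType T) S) = S"
    and "counit_expr X (relift X \<Gamma> (IsType T) S) = T"
    and "ok_type (P_obj X) (relift_ctx X \<Gamma> \<Theta>) (relift X \<Gamma> (IsType T) S)"
    and "\<And>\<Theta>1. set \<Theta>1 \<subseteq> set \<Theta> \<Longrightarrow> ok_type (P_obj Y) \<Theta>1 S \<Longrightarrow>
      ok_type (P_obj X) (relift_ctx X \<Gamma> \<Theta>1) (relift X \<Gamma> (IsType T) S)"
proof -
  obtain k B ys where S': "S = ty_app k B ys" using ok_type_head[OF S] .
  let ?J = "restrict_ctx (set ys) \<Gamma> \<turnstile> IsType T"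
  note S1 = S[unfolded S'] and TS1 = TS[unfolded S']
  note k = ok_type_app[OF \<Theta> S1]
  then have kO: "Ty k \<in> Obj H_cat" by simp
  note J = type_part[OF S1 T TS1]
  have "jdg_map (relabel f) ?J =
      (restrict_ctx (set ys) (map (apsnd (counit_expr Y)) \<Theta>) \<turnstile> IsType (counit_expr Y (ty_app k B ys)))"
    unfolding eq[symmetric] TS1[symmetric] by simp
  then show "relabel (amap P f) (relift X \<Gamma> (IsType T) S) = S"
    unfolding S' relift_ty_app relabel_ty_app P_class_of[OF kO J]
    using recover_type_head[OF Y \<Theta> S1] by simp
  show "counit_expr X (relift X \<Gamma> (IsType T) S) = T"
    using counit_class_of[OF X kO J] vars_restrict[OF S1] unfolding S' relift_ty_app by simp
  show *: "ok_type (P_obj X) (relift_ctx X \<Gamma> \<Theta>1) (relift X \<Gamma> (IsType T) S)"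
    if sub: "set \<Theta>1 \<subseteq> set \<Theta>" and S2: "ok_type (P_obj Y) \<Theta>1 S" for \<Theta>1
    using S2
  proof cases
    case (closed A)
    then have "k = 1" "ys = []" by (auto simp: S')
    then show ?thesis
      unfolding S' relift_ty_app using class_of_in[OF kO J] ok_type.closed[of _ "P_obj X"] by simp
  next
    case (dependent m A y zs)
    then have km: "k = Suc m" and ys: "ys = zs @ [y]" and B: "B = A" by (auto simp: S')
    have y: "(y, ty_app m (bd (P_obj Y) (Next m) A) zs) \<in> set \<Theta>" using dependent sub by blast
    let ?Ty = "type_in \<Gamma> y"
    have yT: "(y, ?Ty) \<in> set \<Gamma>" using parallel[OF y] by blast
    \<comment> \<open>The strengthened context ends in \<open>y\<close>, so the boundary of the new head is the class of the
       type of \<open>y\<close> over the remaining arguments \<open>zs\<close>, which is the new head of that type.\<close>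
    have "map fst (restrict_ctx (set ys) \<Gamma>) = zs @ [y]" using vars_restrict[OF S1] ys by simp
    then obtain \<Delta> T' where \<Delta>: "restrict_ctx (set ys) \<Gamma> = \<Delta> @ [(y, T')]" "map fst \<Delta> = zs"
      by (auto simp: map_eq_append_conv)
    have "(y, T') \<in> set (restrict_ctx (set ys) \<Gamma>)" unfolding \<Delta>(1) by simp
    then have T': "?Ty = T'" using type_in_eq[OF ok_ctx_distinct[OF \<Gamma>]] by simp
    have "distinct ys" by (rule ok_type_distinct[OF PY \<Theta> S1])
    then have "y \<notin> set zs" by (simp add: ys)
    have "restrict_ctx (set zs) \<Gamma> = restrict_ctx (set zs) (restrict_ctx (set ys) \<Gamma>)"
      unfolding ys by (auto intro: filter_cong)
    also have "\<dots> = restrict_ctx (set zs) \<Delta>" unfolding \<Delta>(1) using \<open>y \<notin> set zs\<close> by simp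
    also have "\<dots> = \<Delta>" by (simp add: filter_id_conv imageI flip: \<Delta>(2))
    finally have rz: "restrict_ctx (set zs) \<Gamma> = \<Delta>" .
    have J': "?J \<in> jdgs_at (free_obj X) (htgt (Next m))" using J km by simp
    have "Next m \<in> hedges" using dependent by simp
    from bd_P_obj[OF X this J']
    have "bd (P_obj X) (Next m) (class_of (free_obj X) ?J) =
        class_of (free_obj X) (restrict_ctx (set zs) \<Gamma> \<turnstile> IsType ?Ty)"
      by (simp add: \<Delta>(1) rz T')
    then have "(y, ty_app m (bd (P_obj X) (Next m) (class_of (free_obj X) ?J)) zs)
        = (y, relift X \<Gamma> (IsType ?Ty) (ty_app m (bd (P_obj Y) (Next m) A) zs))" by simp
    moreover have "\<dots> \<in> set (relift_ctx X \<Gamma> \<Theta>1)"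
      using dependent(4) unfolding relift_ctx_def by (force simp del: relift_ty_app)
    ultimately show ?thesis
      unfolding S' relift_ty_app km ys
      using dependent(2) class_of_in[OF kO J] unfolding km ys
      by (intro ok_type.dependent) auto
  qed
  show "ok_type (P_obj X) (relift_ctx X \<Gamma> \<Theta>) (relift X \<Gamma> (IsType T) S)"
    by (rule *[OF subset_refl S])
qed

private lemma relift_entry:
  assumes "(y, S) \<in> set \<Theta>"
  shows "ok_type (P_obj Y) \<Theta> S" "ok_type X \<Gamma> (type_in \<Gamma> y)" "relabel f (type_in \<Gamma> y) = counit_expr Y S"
  using ok_ctx_type[OF \<Theta> assms] ok_ctx_type[OF \<Gamma> parallel(1)[OF assms]] parallel(2)[OF assms] by auto

lemma relift_ctx:
  shows "map (apsnd (relabel (amap P f))) (relift_ctx X \<Gamma> \<Theta>) = \<Theta>"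
    and "map (apsnd (counit_expr X)) (relift_ctx X \<Gamma> \<Theta>) = \<Gamma>"
    and "ok_ctx (P_obj X) (relift_ctx X \<Gamma> \<Theta>)"
proof -
  show "map (apsnd (relabel (amap P f))) (relift_ctx X \<Gamma> \<Theta>) = \<Theta>"
    using relift_type(1)[OF relift_entry] by (auto simp: relift_ctx_def intro!: map_idI)
  have "map (apsnd (counit_expr X)) (relift_ctx X \<Gamma> \<Theta>) = map (\<lambda>y. (y, type_in \<Gamma> y)) (map fst \<Theta>)"
    using relift_type(2)[OF relift_entry] by (auto simp: relift_ctx_def)
  also have "\<dots> = \<Gamma>"
    unfolding vars[symmetric] using type_in_eq[OF ok_ctx_distinct[OF \<Gamma>]] by (auto intro!: map_idI)
  finally show "map (apsnd (counit_expr X)) (relift_ctx X \<Gamma> \<Theta>) = \<Gamma>" .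
  have "ok_ctx (P_obj X) (relift_ctx X \<Gamma> \<Theta>1)" if "\<Theta> = \<Theta>1 @ \<Theta>2" for \<Theta>1 \<Theta>2
    using that
  proof (induction \<Theta>1 arbitrary: \<Theta>2 rule: rev_induct)
    case Nil
    then show ?case by (simp add: relift_ctx_def ok_ctx.Nil)
  next
    case (snoc p \<Theta>1)
    obtain y S where p: "p = (y, S)" by (cases p)
    have split: "\<Theta> = \<Theta>1 @ (y, S) # \<Theta>2" using snoc.prems by (simp add: p)
    note pre = ok_ctx_prefix[OF \<Theta>[unfolded split]]
    have y: "(y, S) \<in> set \<Theta>" and sub: "set \<Theta>1 \<subseteq> set \<Theta>" by (auto simp: split)
    have "fst ` set (relift_ctx X \<Gamma> \<Theta>1) = fst ` set \<Theta>1"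
      by (force simp: relift_ctx_def)
    then have "ok_ctx (P_obj X) (relift_ctx X \<Gamma> \<Theta>1 @ [(y, relift X \<Gamma> (IsType (type_in \<Gamma> y)) S)])"
      using snoc.IH[OF split] relift_type(4)[OF relift_entry[OF y] sub pre(2)] pre(3)
      unfolding ok_ctx_snoc by simp
    then show ?case by (simp add: relift_ctx_def p)
  qed
  from this[of \<Theta> "[]"] show "ok_ctx (P_obj X) (relift_ctx X \<Gamma> \<Theta>)" by simp
qed

lemma relift_rhs:
  assumes R: "ok_rhs X \<Gamma> R" and Q: "ok_rhs (P_obj Y) \<Theta> Q" "ty_or_tm (\<Theta> \<turnstile> Q)"
    and RQ: "rhs_map (relabel f) R = rhs_map (counit_expr Y) Q"
  shows "rhs_map (relabel (amap P f)) (relift_rhs X \<Gamma> R Q) = Q"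
    and "rhs_map (counit_expr X) (relift_rhs X \<Gamma> R Q) = R"
    and "ok_rhs (P_obj X) (relift_ctx X \<Gamma> \<Theta>) (relift_rhs X \<Gamma> R Q)"
proof -
  have "rhs_map (relabel (amap P f)) (relift_rhs X \<Gamma> R Q) = Q \<and>
    rhs_map (counit_expr X) (relift_rhs X \<Gamma> R Q) = R \<and>
    ok_rhs (P_obj X) (relift_ctx X \<Gamma> \<Theta>) (relift_rhs X \<Gamma> R Q)"
    using Q(2)
  proof (cases rule: ty_or_tm_cases)
    case (ty \<Delta> S)
    then have Q': "Q = IsType S" by simp
    then obtain T where T: "R = IsType T" "relabel f T = counit_expr Y S" using RQ by (cases R) auto
    have "ok_type (P_obj Y) \<Theta> S" "ok_type X \<Gamma> T" using Q(1) R by (simp_all add: Q' T)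
    from relift_type(1-3)[OF this T(2)] show ?thesis by (simp add: Q' T)
  next
    case (tm \<Delta> s S)
    then have Q': "Q = HasType s S" by simp
    then obtain t T where tT: "R = HasType t T" and ts: "relabel f t = counit_expr Y s"
      and TS: "relabel f T = counit_expr Y S" using RQ by (cases R) auto
    have t: "ok_term X \<Gamma> t T" and s: "ok_term (P_obj Y) \<Theta> s S" using R Q(1) by (simp_all add: tT Q')
    note type = relift_type(1-3)[OF ok_term_type[OF \<Theta> s] ok_term_type[OF \<Gamma> t] TS]
    let ?s = "relift X \<Gamma> (HasType t T) s" and ?S = "relift X \<Gamma> (IsType T) S"
    have "relabel (amap P f) ?s = s \<and> counit_expr X ?s = t \<and> ok_term (P_obj X) (relift_ctx X \<Gamma> \<Theta>) ?s ?S"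
      using s
    proof cases
      case (var x)
      then have tx: "t = Var x" using ts by (simp add: relabel_eq_Var)
      have "(x, T) \<in> set \<Gamma>" using t unfolding tx by cases auto
      then have "type_in \<Gamma> x = T" using type_in_eq[OF ok_ctx_distinct[OF \<Gamma>]] by blast
      then have "(x, ?S) \<in> set (relift_ctx X \<Gamma> \<Theta>)" using var by (force simp: relift_ctx_def)
      then show ?thesis using var tx by (simp add: ok_term.var)
    next
      case (const k b ys)
      let ?J = "restrict_ctx (set ys) \<Gamma> \<turnstile> HasType t T"
      have kO: "Tm k \<in> Obj H_cat" using const by simp
      note J = term_part[OF const(5) t ts[unfolded const(1)]]
      have "jdg_map (relabel f) ?J = (restrict_ctx (set ys) (map (apsnd (counit_expr Y)) \<Theta>) \<turnstile>
          HasType (counit_expr Y (tm_app k b ys)) (counit_expr Y (ty_app k (tm_bd (P_obj Y) k b) ys)))"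
        unfolding eq[symmetric] ts[unfolded const(1), symmetric] TS[unfolded const(2), symmetric] by simp
      then have 1: "relabel (amap P f) ?s = s"
        unfolding const(1) relift_tm_app relabel_tm_app P_class_of[OF kO J]
        using recover_term_head[OF Y \<Theta> const(3-5)] by simp
      have 2: "counit_expr X ?s = t"
        using counit_class_of[OF X kO J] vars_restrict[OF const(5)] unfolding const(1) relift_tm_app
        by simp
      have "Term k \<in> hedges" "?J \<in> jdgs_at (free_obj X) (htgt (Term k))" using const J by simp_all
      from bd_P_obj[OF X this]
      have "tm_bd (P_obj X) k (class_of (free_obj X) ?J) =
          class_of (free_obj X) (restrict_ctx (set ys) \<Gamma> \<turnstile> IsType T)"
        by (simp add: tm_bd_eq)
      then have S: "?S = ty_app k (tm_bd (P_obj X) k (class_of (free_obj X) ?J)) ys"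
        by (simp add: const(2))
      have "ok_term (P_obj X) (relift_ctx X \<Gamma> \<Theta>) ?s ?S"
        using type(3) class_of_in[OF kO J] const(3) unfolding S const(1) relift_tm_app
        by (intro ok_term.const) auto
      then show ?thesis using 1 2 by simp
    qed
    then show ?thesis using type by (simp add: tT Q')
  qed
  then show "rhs_map (relabel (amap P f)) (relift_rhs X \<Gamma> R Q) = Q"
    "rhs_map (counit_expr X) (relift_rhs X \<Gamma> R Q) = R"
    "ok_rhs (P_obj X) (relift_ctx X \<Gamma> \<Theta>) (relift_rhs X \<Gamma> R Q)" by auto
qed

end

text \<open>The relifted judgement is an element over the given pair by \<open>relift_ctx\<close> and \<open>relift_rhs\<close>, and the only
one by \<open>relift_unique\<close>.\<close>

lemma mult_cartesian:
  fixes f :: "'u::infinite psh_arr"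
  assumes f: "f \<in> hom psh_cat X Y"
  shows "is_pullback psh_cat (mult X) (amap P (amap P f)) (amap P f) (mult Y)"
proof -
  have X: "X \<in> Obj psh_cat" and Y: "Y \<in> Obj psh_cat" using psh_hom_Obj[OF f] by auto
  note PX = P_obj_Obj[OF X] and PY = P_obj_Obj[OF Y]
  note \<mu>X = mult_hom[OF X] and \<mu>Y = mult_hom[OF Y] and Pf = P_hom[OF f] and PPf = P_hom[OF P_hom[OF f]]
  show ?thesis
  proof (rule psh_pullbackI[OF \<mu>X PPf Pf \<mu>Y])
    fix x v assume x: "x \<in> Obj H_cat" "v \<in> omap (P_obj (P_obj X)) x"
    show "act (amap P f) x (act (mult X) x v) = act (mult Y) x (act (amap P (amap P f)) x v)"
      using mult_natural[OF f] act_comp[OF \<mu>X Pf x] act_comp[OF PPf \<mu>Y x] by simp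
  next
    fix x a b
    assume x: "x \<in> Obj H_cat" and a: "a \<in> omap (P_obj X) x" and b: "b \<in> omap (P_obj (P_obj Y)) x"
      and eq: "act (amap P f) x a = act (mult Y) x b"
    define J K where "J = norm_jdg X a" and "K = norm_jdg (P_obj Y) b"
    have J: "J \<in> jdgs_at (free_obj X) x" "normal J" "ok_jdg X J" "ty_or_tm J"
      using norm_jdg[OF X x a] norm_jdg_ok[OF X x a] by (auto simp: J_def)
    have K: "K \<in> jdgs_at (free_obj (P_obj Y)) x" "normal K" "ok_jdg (P_obj Y) K" "ty_or_tm K"
      using norm_jdg[OF PY x b] norm_jdg_ok[OF PY x b] by (auto simp: K_def)
    have JK: "jdg_map (relabel f) J = jdg_map (counit_expr Y) K"
      using norm_P[OF f x a] norm_mult[OF Y x b] eq by (simp add: J_def K_def)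
    have ctx: "ok_ctx X (ctx J)" "ok_ctx (P_obj Y) (ctx K)"
      "map (apsnd (relabel f)) (ctx J) = map (apsnd (counit_expr Y)) (ctx K)"
      using J(3) K(3) JK by (simp_all add: ok_jdg_def jdg_map_def)
    have rhs: "ok_rhs X (ctx J) (rhs J)" "ok_rhs (P_obj Y) (ctx K) (rhs K)" "ty_or_tm (ctx K \<turnstile> rhs K)"
      "rhs_map (relabel f) (rhs J) = rhs_map (counit_expr Y) (rhs K)"
      using J(3) K(3,4) JK by (simp_all add: ok_jdg_def jdg_map_def)
    let ?L = "relift_jdg X J K"
    note rc = relift_ctx[OF f ctx] and rr = relift_rhs[OF f ctx rhs]
    have ok: "ok_jdg (P_obj X) ?L" using rc(3) rr(3) by (simp add: relift_jdg_def)
    have LJ: "jdg_map (counit_expr X) ?L = J" and LK: "jdg_map (relabel (amap P f)) ?L = K"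
      using rc(1,2) rr(1,2) by (simp_all add: relift_jdg_def)
    have L: "?L \<in> jdgs_at (free_obj (P_obj X)) x" "normal ?L" "ty_or_tm ?L"
    proof -
      have "normal (jdg_map (counit_expr X) ?L)" "ty_or_tm (jdg_map (counit_expr X) ?L)"
        unfolding LJ by (rule J(2), rule J(4))
      then show "normal ?L" "ty_or_tm ?L" unfolding jdg_map_preserves .
      have "jdg_map (counit_expr X) ?L \<in> jdgs_at (free_obj X) x" unfolding LJ by (rule J(1))
      moreover have "?L \<in> derived (free_obj (P_obj X))" using ok by (simp add: derived_iff_ok[OF PX])
      ultimately show "?L \<in> jdgs_at (free_obj (P_obj X)) x" by (cases x) simp_all
    qed
    define w where "w = class_of (free_obj (P_obj X)) ?L"
    have w: "w \<in> omap (P_obj (P_obj X)) x" unfolding w_def by (rule class_of_in[OF x L(1)])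
    have Nw: "norm_jdg (P_obj X) w = ?L"
      unfolding w_def using norm_class_of(3)[OF PX, of ?L] jdgs_atD[OF L(1)] L(2) by blast
    show "\<exists>!v. v \<in> omap (P_obj (P_obj X)) x \<and> act (mult X) x v = a \<and> act (amap P (amap P f)) x v = b"
    proof (rule ex1I[of _ w], intro conjI)
      show "act (mult X) x w = a"
        by (rule norm_jdg_inj[OF X x act_in[OF \<mu>X x w] a]) (unfold norm_mult[OF X x w] Nw LJ, rule J_def)
      show "act (amap P (amap P f)) x w = b"
        by (rule norm_jdg_inj[OF PY x act_in[OF PPf x w] b]) (unfold norm_P[OF Pf x w] Nw LK, rule K_def)
      fix v assume v: "v \<in> omap (P_obj (P_obj X)) x \<and> act (mult X) x v = a \<and> act (amap P (amap P f)) x v = b"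
      then have vP: "v \<in> omap (P_obj (P_obj X)) x" by simp
      have "jdg_map (counit_expr X) (norm_jdg (P_obj X) v) = J"
        "jdg_map (relabel (amap P f)) (norm_jdg (P_obj X) v) = K"
        using norm_mult[OF X x vP] norm_P[OF Pf x vP] v by (simp_all add: J_def K_def)
      then have "norm_jdg (P_obj X) v = norm_jdg (P_obj X) w"
        using relift_unique[OF X norm_jdg_ok[OF PX x vP], of "amap P f"] Nw by simp
      then show "v = w" by (rule norm_jdg_inj[OF PX x vP w])
    qed (rule w)
  qed
qed


section \<open>Generic factorisations of maps into P X\<close>

text \<open>A map into \<open>P X\<close> is a family of judgements in normal form that is compatible with boundaries.  The
subjects determine the family, as the type of the \<open>i\<close>-th variable is the subject of the boundary of
degree \<open>i\<close>.\<close>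

definition subj :: "'u psh \<Rightarrow> 'u psh_arr \<Rightarrow> hob \<Rightarrow> 'u \<Rightarrow> 'u uexpr" where
  "subj X g x z = subject (rhs (norm_jdg X (act g x z)))"

definition fam_ctx :: "(hob \<Rightarrow> 'u \<Rightarrow> 'u uexpr) \<Rightarrow> 'u psh \<Rightarrow> nat \<Rightarrow> 'u \<Rightarrow>
    'u uctx" where
  "fam_ctx \<sigma> Z n z = map (\<lambda>i. (i, \<sigma> (Ty i) (ty_bd Z i n z))) [1..<n]"

fun fam_jdg :: "(hob \<Rightarrow> 'u \<Rightarrow> 'u uexpr) \<Rightarrow> 'u psh \<Rightarrow> hob \<Rightarrow> 'u \<Rightarrow> 'u ujdg" where
  "fam_jdg \<sigma> Z (Ty n) z = (fam_ctx \<sigma> Z n z \<turnstile> IsType (\<sigma> (Ty n) z))"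
| "fam_jdg \<sigma> Z (Tm n) z =
    (fam_ctx \<sigma> Z n (tm_bd Z n z) \<turnstile> HasType (\<sigma> (Tm n) z) (\<sigma> (Ty n) (tm_bd Z n z)))"

lemma fam_ctx_mem: "(y, T) \<in> set (fam_ctx \<sigma> Z n z) \<longleftrightarrow> 1 \<le> y \<and> y < n \<and> T = \<sigma> (Ty y) (ty_bd Z y n z)"
  by (auto simp: fam_ctx_def)

lemma fam_ctx_Suc:
  assumes "Z \<in> Obj psh_cat" "n \<ge> 1" "z \<in> omap Z (Ty (Suc n))"
  shows "fam_ctx \<sigma> Z (Suc n) z =
    fam_ctx \<sigma> Z n (bd Z (Next n) z) @ [(n, \<sigma> (Ty n) (bd Z (Next n) z))]"
  using assms by (auto simp: fam_ctx_def ty_bd_Suc ty_bd_step)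

lemma fam_jdg_cong:
  assumes Z: "Z \<in> Obj psh_cat" and x: "x \<in> Obj H_cat" "z \<in> omap Z x"
    and eq: "\<And>x z. x \<in> Obj H_cat \<Longrightarrow> z \<in> omap Z x \<Longrightarrow> \<sigma> x z = \<sigma>' x z"
  shows "fam_jdg \<sigma> Z x z = fam_jdg \<sigma>' Z x z"
proof -
  have "fam_ctx \<sigma> Z n w = fam_ctx \<sigma>' Z n w" if "w \<in> omap Z (Ty n)" for n w
    using that eq ty_bd_in[OF Z] by (auto simp: fam_ctx_def)
  then show ?thesis using x eq tm_bd_in[OF Z] by (cases x) auto
qed

lemma jdg_map_fam: "jdg_map \<tau> (fam_jdg \<sigma> Z x z) = fam_jdg (\<lambda>x z. \<tau> (\<sigma> x z)) Z x z"
  by (cases x) (auto simp: fam_ctx_def)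

lemma boundary_fam:
  assumes Z: "Z \<in> Obj psh_cat" and e: "e \<in> hedges" and z: "z \<in> omap Z (htgt e)"
  shows "boundary (fam_jdg \<sigma> Z (htgt e) z) = [fam_jdg \<sigma> Z (hsrc e) (bd Z e z)]"
proof (cases e)
  case (Next n)
  then show ?thesis using fam_ctx_Suc[OF Z, of n z] e z by auto
qed (simp add: tm_bd_eq)

lemma norm_family:
  fixes X :: "'u::infinite psh"
  assumes X: "X \<in> Obj psh_cat" and g: "g \<in> hom psh_cat Z (P_obj X)"
    and x: "x \<in> Obj H_cat" "z \<in> omap Z x"
  shows "norm_jdg X (act g x z) = fam_jdg (subj X g) Z x z"
proof -
  have Z: "Z \<in> Obj psh_cat" using psh_hom_Obj[OF g] by simp
  have bdy: "boundary (norm_jdg X (act g (htgt e) z)) = [norm_jdg X (act g (hsrc e) (bd Z e z))]"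
    if e: "e \<in> hedges" and z: "z \<in> omap Z (htgt e)" for e z
    using norm_jdg_bd[OF X e act_in[OF g _ z]] hedge_Obj_H[OF e] by (simp add: act_bd[OF g e z])
  have ty: "norm_jdg X (act g (Ty n) z) = fam_jdg (subj X g) Z (Ty n) z"
    if "n \<ge> 1" "z \<in> omap Z (Ty n)" for n z
    using that
  proof (induction n arbitrary: z rule: nat_induct_at_least)
    case base
    have "norm_jdg X (act g (Ty 1) z) \<in> jdgs_at (free_obj X) (Ty 1)"
      using norm_jdg(1)[OF X _ act_in[OF g _ base]] by simp
    then obtain T where "norm_jdg X (act g (Ty 1) z) = ([] \<turnstile> IsType T)"
      by (auto simp: is_type_jdg_def degree_def)
    then show ?case by (simp add: fam_ctx_def subj_def)
  next
    case (Suc n)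
    have u: "Ty (Suc n) \<in> Obj H_cat" "act g (Ty (Suc n)) z \<in> omap (P_obj X) (Ty (Suc n))"
      using act_in[OF g _ Suc.prems] by auto
    obtain \<Gamma> T where N: "norm_jdg X (act g (Ty (Suc n)) z) = (\<Gamma> \<turnstile> IsType T)" and len: "length \<Gamma> = n"
      using norm_jdg(1)[OF X u] by (auto simp: is_type_jdg_def degree_def)
    have ne: "\<Gamma> \<noteq> []" using len Suc.hyps by auto
    have "map fst \<Gamma> = [1..<Suc n]" using norm_jdg(2)[OF X u] by (simp add: N normal_def degree_def len)
    then have fst: "fst (last \<Gamma>) = n" using ne Suc.hyps by (simp flip: last_map)
    have "Next n \<in> hedges" using Suc.hyps by simp
    from bdy[OF this, of z] Suc.prems ne Suc.IH[OF ty_bd_step_in[OF Z Suc.hyps Suc.prems]]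
    have "butlast \<Gamma> = fam_ctx (subj X g) Z n (bd Z (Next n) z)"
      "snd (last \<Gamma>) = subj X g (Ty n) (bd Z (Next n) z)" by (simp_all add: N)
    then have "\<Gamma> = fam_ctx (subj X g) Z (Suc n) z"
      using append_butlast_last_id[OF ne] fst fam_ctx_Suc[OF Z Suc.hyps Suc.prems]
      by (metis prod.collapse)
    moreover have "subj X g (Ty (Suc n)) z = T" by (simp add: subj_def N)
    ultimately show ?case by (simp add: N)
  qed
  show ?thesis
  proof (cases x)
    case (Tm n)
    then have n: "n \<ge> 1" and z: "z \<in> omap Z (Tm n)" using x by auto
    obtain \<Gamma> t T where N: "norm_jdg X (act g (Tm n) z) = (\<Gamma> \<turnstile> HasType t T)"
      using norm_jdg(1)[OF X x(1) act_in[OF g x]] by (auto simp: Tm is_term_jdg_def)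
    have "Term n \<in> hedges" using n by simp
    from bdy[OF this, of z] z
    have "(\<Gamma> \<turnstile> IsType T) = norm_jdg X (act g (Ty n) (tm_bd Z n z))" by (simp add: N tm_bd_eq)
    then have "\<Gamma> = fam_ctx (subj X g) Z n (tm_bd Z n z)" "T = subj X g (Ty n) (tm_bd Z n z)"
      unfolding ty[OF n tm_bd_in[OF Z n z]] by simp_all
    moreover have "t = subj X g (Tm n) z" by (simp add: subj_def N)
    ultimately show ?thesis unfolding Tm fam_jdg.simps N by simp
  qed (use ty x in auto)
qed

lemma family_map:
  fixes W :: "'u::infinite psh"
  assumes W: "W \<in> Obj psh_cat" and Z: "Z \<in> Obj psh_cat"
    and ok: "\<And>x z. x \<in> Obj H_cat \<Longrightarrow> z \<in> omap Z x \<Longrightarrow> ok_jdg W (fam_jdg \<sigma> Z x z)"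
  obtains e where "e \<in> hom psh_cat Z (P_obj W)"
    and "\<And>x z. x \<in> Obj H_cat \<Longrightarrow> z \<in> omap Z x \<Longrightarrow> norm_jdg W (act e x z) = fam_jdg \<sigma> Z x z"
proof -
  let ?e = "psh_map Z (\<lambda>x z. class_of (free_obj W) (fam_jdg \<sigma> Z x z)) (P_obj W)"
  have J: "fam_jdg \<sigma> Z x z \<in> jdgs_at (free_obj W) x" if "x \<in> Obj H_cat" "z \<in> omap Z x" for x z
    using ok[OF that] that(1) by (cases x) (auto simp: derived_iff_ok[OF W] degree_def fam_ctx_def)
  have normal: "normal (fam_jdg \<sigma> Z x z)" if "x \<in> Obj H_cat" for x z
    using that by (cases x) (simp_all add: normal_def degree_def fam_ctx_def comp_def)
  have e: "?e \<in> hom psh_cat Z (P_obj W)"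
  proof (rule psh_map_hom[OF Z P_obj_Obj[OF W]])
    show "class_of (free_obj W) (fam_jdg \<sigma> Z x z) \<in> omap (P_obj W) x"
      if "x \<in> Obj H_cat" "z \<in> omap Z x" for x z
      by (rule class_of_in[OF that(1) J[OF that]])
    show "bd (P_obj W) e (class_of (free_obj W) (fam_jdg \<sigma> Z (htgt e) z)) =
        class_of (free_obj W) (fam_jdg \<sigma> Z (hsrc e) (bd Z e z))"
      if e: "e \<in> hedges" and z: "z \<in> omap Z (htgt e)" for e z
      using bd_P_obj[OF W e J[OF _ z]] hedge_Obj_H[OF e] boundary_fam[OF Z e z] by simp
  qed
  have "norm_jdg W (act ?e x z) = fam_jdg \<sigma> Z x z" if "x \<in> Obj H_cat" "z \<in> omap Z x" for x z
    using norm_class_of(3)[OF W _ _ normal[OF that(1)]] jdgs_atD[OF J[OF that]] that by simp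
  with e show thesis by (rule that)
qed

primrec expr_head :: "'u uexpr \<Rightarrow> 'u" where
  "expr_head (Var x) = undefined"
| "expr_head (App w es) = label w"

lemma expr_head_app [simp]: "expr_head (app x u ys) = u"
  by (cases x) auto

definition last_arg :: "'w expr \<Rightarrow> nat" where
  "last_arg e = (case e of App w es \<Rightarrow> (case last es of Var y \<Rightarrow> y | _ \<Rightarrow> 0) | _ \<Rightarrow> 0)"

lemma last_arg_ty_app [simp]: "last_arg (App w (map Var ys @ [Var y])) = y"
  by (simp add: last_arg_def)

lemma app_inj: "app x u ys = app x' u' ys' \<Longrightarrow> x = x' \<and> u = u' \<and> ys = ys'"
  by (cases x; cases x') auto

text \<open>The middle object of the factorisation of a family with subjects \<open>\<sigma>\<close> consists of the heads of the
subjects.  Distinct elements of \<open>Z\<close> have distinct heads, except that a variable judgement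
\<open>x\<^sub>j : T\<close> identifies \<open>T\<close> with the type of \<open>x\<^sub>j\<close> in the context.\<close>

definition var_glue :: "'u psh \<Rightarrow> (hob \<Rightarrow> 'u \<Rightarrow> 'u uexpr) \<Rightarrow>
    hob \<times> 'u \<Rightarrow> hob \<times> 'u \<Rightarrow> bool" where
  "var_glue Z \<sigma> q q' \<longleftrightarrow> (\<exists>n z j. n \<ge> 1 \<and> z \<in> omap Z (Tm n) \<and> \<sigma> (Tm n) z = Var j \<and>
     q = (Ty n, tm_bd Z n z) \<and> q' = (Ty j, ty_bd Z j n (tm_bd Z n z)))"

text \<open>The elements of the middle object have to be taken from \<open>'u\<close>, into which all judgements can be coded.\<close>

definition element_code :: "hob \<times> 'u \<Rightarrow> 'u" where
  "element_code q = code ([] \<turnstile> IsType (app (fst q) (snd q) []))"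

lemma element_code_inject: "element_code (q :: hob \<times> 'u::infinite) = element_code q' \<longleftrightarrow> q = q'"
  using injD[OF inj_code] app_inj by (fastforce simp: element_code_def prod_eq_iff)

definition glue_class :: "'u psh \<Rightarrow> (hob \<Rightarrow> 'u \<Rightarrow> 'u uexpr) \<Rightarrow> hob \<times> 'u \<Rightarrow> 'u" where
  "glue_class Z \<sigma> q = element_code (SOME q'. equivclp (var_glue Z \<sigma>) q q')"

definition elements :: "'u psh \<Rightarrow> (hob \<times> 'u) set" where
  "elements Z = {(x, z). x \<in> Obj H_cat \<and> z \<in> omap Z x}"

definition unglue :: "'u psh \<Rightarrow> (hob \<Rightarrow> 'u \<Rightarrow> 'u uexpr) \<Rightarrow> 'u \<Rightarrow> hob \<times> 'u" where
  "unglue Z \<sigma> u = (SOME q. q \<in> elements Z \<and> glue_class Z \<sigma> q = u)"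

text \<open>The element whose head is the boundary of the head of the given one: the parent of a type in the forest
is its last argument, and that of a term is its type.\<close>

fun parent :: "'u psh \<Rightarrow> (hob \<Rightarrow> 'u \<Rightarrow> 'u uexpr) \<Rightarrow> hob \<times> 'u \<Rightarrow> hob \<times> 'u" where
  "parent Z \<sigma> (Ty n, z) = (let y = last_arg (\<sigma> (Ty n) z) in (Ty y, ty_bd Z y n z))"
| "parent Z \<sigma> (Tm n, z) = (Ty n, tm_bd Z n z)"

definition middle :: "'u psh \<Rightarrow> (hob \<Rightarrow> 'u \<Rightarrow> 'u uexpr) \<Rightarrow> 'u psh" where
  "middle Z \<sigma> = psh_of
     (\<lambda>x. {glue_class Z \<sigma> (x', z) | x' z. (x', z) \<in> elements Z \<and> (\<exists>u ys. \<sigma> x' z = app x u ys)})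
     (\<lambda>e u. glue_class Z \<sigma> (parent Z \<sigma> (unglue Z \<sigma> u)))"

lemma glue_class_eq_iff:
  fixes Z :: "'u::infinite psh"
  shows "glue_class Z \<sigma> q = glue_class Z \<sigma> q' \<longleftrightarrow> equivclp (var_glue Z \<sigma>) q q'"
proof
  let ?E = "equivclp (var_glue Z \<sigma>)"
  assume "glue_class Z \<sigma> q = glue_class Z \<sigma> q'"
  then have "(SOME p. ?E q p) = (SOME p. ?E q' p)"
    by (simp add: glue_class_def element_code_inject)
  moreover have "?E q (SOME p. ?E q p)" by (rule someI[of "?E q" q]) simp
  moreover have "?E q' (SOME p. ?E q' p)" by (rule someI[of "?E q'" q']) simp
  ultimately show "?E q q'" using equivclp_sym equivclp_trans by metis
next
  let ?E = "equivclp (var_glue Z \<sigma>)"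
  assume "?E q q'"
  then have "?E q p \<longleftrightarrow> ?E q' p" for p using equivclp_sym equivclp_trans by metis
  then show "glue_class Z \<sigma> q = glue_class Z \<sigma> q'" by (simp add: glue_class_def)
qed

lemma unglue:
  fixes Z :: "'u::infinite psh"
  assumes "q \<in> elements Z"
  shows "unglue Z \<sigma> (glue_class Z \<sigma> q) \<in> elements Z"
    and "equivclp (var_glue Z \<sigma>) q (unglue Z \<sigma> (glue_class Z \<sigma> q))"
proof -
  have "unglue Z \<sigma> (glue_class Z \<sigma> q) \<in> elements Z \<and>
      glue_class Z \<sigma> (unglue Z \<sigma> (glue_class Z \<sigma> q)) = glue_class Z \<sigma> q"
    unfolding unglue_def by (rule someI[of _ q]) (simp add: assms)
  then show "unglue Z \<sigma> (glue_class Z \<sigma> q) \<in> elements Z"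
    "equivclp (var_glue Z \<sigma>) q (unglue Z \<sigma> (glue_class Z \<sigma> q))"
    by (simp_all flip: glue_class_eq_iff)
qed

context
  fixes W Z :: "'u::infinite psh" and g
  assumes W: "W \<in> Obj psh_cat" and g: "g \<in> hom psh_cat Z (P_obj W)"
begin

private lemma dom_Obj: "Z \<in> Obj psh_cat" using psh_hom_Obj[OF g] by simp

lemma family_ok:
  "(x, z) \<in> elements Z \<Longrightarrow> ok_jdg W (fam_jdg (subj W g) Z x z)"
  using norm_jdg_ok(1)[OF W _ act_in[OF g]] norm_family[OF W g] by (auto simp: elements_def)

lemma family_type_ok:
  assumes "(Ty n, z) \<in> elements Z"
  shows "ok_ctx W (fam_ctx (subj W g) Z n z)" "ok_type W (fam_ctx (subj W g) Z n z) (subj W g (Ty n) z)"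
  using family_ok[OF assms] by auto

lemma family_term_ok:
  assumes "(Tm n, z) \<in> elements Z"
  shows "ok_ctx W (fam_ctx (subj W g) Z n (tm_bd Z n z))"
    "ok_term W (fam_ctx (subj W g) Z n (tm_bd Z n z)) (subj W g (Tm n) z) (subj W g (Ty n) (tm_bd Z n z))"
  using family_ok[OF assms] by auto

lemma subj_cases:
  assumes "(x, z) \<in> elements Z"
  obtains (var) n y where "x = Tm n" "subj W g x z = Var y"
  | (app) x' u ys where "subj W g x z = app x' u ys"
proof (cases x)
  case (Ty n)
  obtain k A ys where "subj W g (Ty n) z = ty_app k A ys"
    using ok_type_head[OF family_type_ok(2)] assms Ty by blast
  then show ?thesis using app[of "Ty k" A ys] Ty by simp
next
  case (Tm n)
  from family_term_ok(2)[of n z] assms Tm have "ok_term W (fam_ctx (subj W g) Z n (tm_bd Z n z))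
    (subj W g (Tm n) z) (subj W g (Ty n) (tm_bd Z n z))" by simp
  then show ?thesis
  proof cases
    case (const k a ys)
    then show ?thesis using app[of "Tm k" a ys] Tm by simp
  qed (use var Tm in simp)
qed

lemma subj_head:
  assumes q: "(x, z) \<in> elements Z" and s: "subj W g x z = app x' u ys"
  shows "x' \<in> Obj H_cat" "u \<in> omap W x'"
proof -
  have "x' \<in> Obj H_cat \<and> u \<in> omap W x'"
  proof (cases x)
    case (Ty n)
    from family_type_ok[of n z] q have ok: "ok_ctx W (fam_ctx (subj W g) Z n z)"
      "ok_type W (fam_ctx (subj W g) Z n z) (subj W g (Ty n) z)" by (auto simp: Ty)
    obtain k A zs where t: "subj W g (Ty n) z = ty_app k A zs" using ok_type_head[OF ok(2)] .
    have "app x' u ys = app (Ty k) A zs" using s[symmetric] t by (simp add: Ty)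
    from app_inj[OF this] have "x' = Ty k" "u = A" by auto
    then show ?thesis using ok_type_app(1,2)[OF ok(1) ok(2)[unfolded t]] by simp
  next
    case (Tm n)
    from family_term_ok(2)[of n z] q have "ok_term W (fam_ctx (subj W g) Z n (tm_bd Z n z))
      (subj W g (Tm n) z) (subj W g (Ty n) (tm_bd Z n z))" by (simp add: Tm)
    then show ?thesis
    proof cases
      case (const k a zs)
      have "app x' u ys = app (Tm k) a zs" using s[symmetric] const(1) by (simp add: Tm)
      from app_inj[OF this] have "x' = Tm k" "u = a" by auto
      then show ?thesis using const by simp
    qed (use s Tm in \<open>cases x'; simp\<close>)
  qed
  then show "x' \<in> Obj H_cat" "u \<in> omap W x'" by auto
qed

text \<open>By well-formedness the last argument \<open>y\<close> of a type has in the context a type headed by the boundary, and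
the type of the \<open>y\<close>-th variable is the subject at the boundary of degree \<open>y\<close>.\<close>

lemma subj_parent:
  assumes q: "(x, z) \<in> elements Z" and e: "e \<in> hedges" and s: "subj W g x z = app (htgt e) u ys"
  shows "\<exists>x' z' zs. parent Z (subj W g) (x, z) = (x', z') \<and> (x', z') \<in> elements Z \<and>
    subj W g x' z' = app (hsrc e) (bd W e u) zs \<and>
    (\<forall>k. e = Next k \<longrightarrow> ys = zs @ [last_arg (subj W g x z)])"
proof (cases e)
  case (Next k)
  have "\<exists>n. x = Ty n"
  proof (cases x)
    case (Tm n)
    from family_term_ok(2)[of n z] q have "ok_term W (fam_ctx (subj W g) Z n (tm_bd Z n z))
      (subj W g (Tm n) z) (subj W g (Ty n) (tm_bd Z n z))" by (simp add: Tm)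
    then show ?thesis using s Next Tm by cases auto
  qed simp
  then obtain n where x: "x = Ty n" by blast
  then have z: "n \<ge> 1" "z \<in> omap Z (Ty n)" using q by (auto simp: elements_def)
  have s': "subj W g (Ty n) z = ty_app (Suc k) u ys" using s Next x by simp
  from family_type_ok(2)[of n z] q have "ok_type W (fam_ctx (subj W g) Z n z) (ty_app (Suc k) u ys)"
    by (simp add: x s')
  then show ?thesis
  proof cases
    case (dependent y zs)
    then have eqs: "ys = zs @ [y]" by auto
    then have "(y, ty_app k (bd W (Next k) u) zs) \<in> set (fam_ctx (subj W g) Z n z)"
      using dependent by simp
    then have y: "1 \<le> y" "y < n" "subj W g (Ty y) (ty_bd Z y n z) = ty_app k (bd W (Next k) u) zs"
      unfolding fam_ctx_mem by auto
    have last: "last_arg (subj W g x z) = y" using s' by (simp add: x eqs)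
    show ?thesis
    proof (intro exI conjI allI impI)
      show "parent Z (subj W g) (x, z) = (Ty y, ty_bd Z y n z)"
        using last by (simp add: x)
      show "(Ty y, ty_bd Z y n z) \<in> elements Z"
        using y ty_bd_in[OF dom_Obj y(1) _ z(2)] by (simp add: elements_def)
      show "subj W g (Ty y) (ty_bd Z y n z) = app (hsrc e) (bd W e u) zs" using y by (simp add: Next)
      show "ys = zs @ [last_arg (subj W g x z)]" by (simp add: last eqs)
    qed
  qed (use e Next in auto)
next
  case (Term k)
  have "\<exists>n. x = Tm n"
  proof (cases x)
    case (Ty n)
    obtain m A zs where "subj W g (Ty n) z = ty_app m A zs"
      using ok_type_head[OF family_type_ok(2)] q Ty by blast
    then show ?thesis using s Term Ty by simp
  qed simp
  then obtain n where x: "x = Tm n" by blast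
  then have z: "n \<ge> 1" "z \<in> omap Z (Tm n)" using q by (auto simp: elements_def)
  from family_term_ok(2)[of n z] q have t: "ok_term W (fam_ctx (subj W g) Z n (tm_bd Z n z))
      (subj W g (Tm n) z) (subj W g (Ty n) (tm_bd Z n z))" by (simp add: x)
  show ?thesis
  proof (intro exI conjI allI impI)
    show "parent Z (subj W g) (x, z) = (Ty n, tm_bd Z n z)" by (simp add: x)
    show "(Ty n, tm_bd Z n z) \<in> elements Z" using z tm_bd_in[OF dom_Obj] by (simp add: elements_def)
    show "subj W g (Ty n) (tm_bd Z n z) = app (hsrc e) (bd W e u) ys"
      using t s by cases (auto simp: x Term tm_bd_eq)
  qed (simp add: Term)
qed

text \<open>A variable has in the context the type that is asserted for it, so glued elements have the same subject,
not only the same head.\<close>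

lemma var_glue_subj:
  assumes "var_glue Z (subj W g) (x, z) (x', z')"
  shows "(x, z) \<in> elements Z" "(x', z') \<in> elements Z" "subj W g x z = subj W g x' z'"
proof -
  obtain n w j where n: "n \<ge> 1" and w: "w \<in> omap Z (Tm n)" and v: "subj W g (Tm n) w = Var j"
    and q: "x = Ty n" "z = tm_bd Z n w" "x' = Ty j" "z' = ty_bd Z j n (tm_bd Z n w)"
    using assms by (auto simp: var_glue_def)
  have "(Tm n, w) \<in> elements Z" using n w by (simp add: elements_def)
  from family_term_ok(2)[OF this]
  have "(j, subj W g (Ty n) (tm_bd Z n w)) \<in> set (fam_ctx (subj W g) Z n (tm_bd Z n w))"
    unfolding v by cases auto
  then have j: "1 \<le> j" "j < n" and eq: "subj W g (Ty n) (tm_bd Z n w) = subj W g (Ty j) (ty_bd Z j n (tm_bd Z n w))"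
    unfolding fam_ctx_mem by auto
  show "(x, z) \<in> elements Z" "(x', z') \<in> elements Z"
    using n j tm_bd_in[OF dom_Obj n w] ty_bd_in[OF dom_Obj j(1)] by (auto simp: q elements_def)
  show "subj W g x z = subj W g x' z'" using eq by (simp add: q)
qed

lemma subj_args:
  assumes "(Ty n, z) \<in> elements Z" "v \<in> fv (subj W g (Ty n) z)" shows "1 \<le> v" "v < n"
  using ok_type_fv[OF family_type_ok[OF assms(1)]] assms(2) by (auto simp: fam_ctx_def)

text \<open>Glued elements have the same last argument, and it precedes both.\<close>

lemma parent_glue:
  assumes glue: "var_glue Z (subj W g) (x, z) (x', z')"
    and e: "e \<in> hedges" and s: "subj W g x z = app (htgt e) u ys"
  shows "parent Z (subj W g) (x, z) = parent Z (subj W g) (x', z')"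
proof -
  note q = var_glue_subj[OF glue]
  obtain n w j where n: "n \<ge> 1" "w \<in> omap Z (Tm n)"
    and v: "subj W g (Tm n) w = Var j"
    and eqs: "x = Ty n" "z = tm_bd Z n w" "x' = Ty j" "z' = ty_bd Z j n (tm_bd Z n w)"
    using glue by (auto simp: var_glue_def)
  have j: "j \<ge> 1" using q(2) by (simp add: eqs elements_def)
  obtain m A zs where t: "subj W g (Ty n) z = ty_app m A zs"
    using ok_type_head[OF family_type_ok(2)] q(1) eqs by blast
  have "app (htgt e) u ys = app (Ty m) A zs" using s t by (simp add: eqs(1))
  from app_inj[OF this] obtain k where k: "e = Next k" by (cases e) auto
  define y where "y = last_arg (subj W g x z)"
  have "\<exists>zs'. ys = zs' @ [y]" using subj_parent[OF q(1) e s] k unfolding y_def by blast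
  then have "y \<in> set ys" by auto
  moreover have "fv (subj W g x z) = set ys" using s k by simp
  ultimately have "y \<in> fv (subj W g x z)" by simp
  then have "y \<in> fv (subj W g (Ty j) z')" using q(3) by (simp add: eqs)
  note y = subj_args[OF q(2)[unfolded eqs(3)] this]
  have "(Tm n, w) \<in> elements Z" using n by (simp add: elements_def)
  from family_term_ok(2)[OF this] have "\<exists>T. (j, T) \<in> set (fam_ctx (subj W g) Z n z)"
    unfolding v eqs by cases auto
  then have "j < n" by (auto simp: fam_ctx_mem)
  then have "ty_bd Z y j z' = ty_bd Z y n z"
    using ty_bd_trans[OF dom_Obj y(1), of j n z] y q(1) by (simp add: eqs elements_def)
  moreover have "last_arg (subj W g x' z') = y" using q(3) by (simp add: y_def)
  ultimately show ?thesis by (simp add: eqs Let_def y_def)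
qed

end

text \<open>Satisfied by the subjects of two families, one of which is a relabelling of the other.\<close>

definition same_shape :: "'u psh \<Rightarrow> (hob \<Rightarrow> 'u \<Rightarrow> 'u uexpr) \<Rightarrow>
    (hob \<Rightarrow> 'u \<Rightarrow> 'u uexpr) \<Rightarrow> bool" where
  "same_shape Z \<sigma> \<sigma>' \<longleftrightarrow> (\<forall>(x, z) \<in> elements Z.
     (\<exists>y. \<sigma> x z = Var y \<and> \<sigma>' x z = Var y) \<or>
     (\<exists>x' u v ys. \<sigma> x z = app x' u ys \<and> \<sigma>' x z = app x' v ys))"

lemma same_shape_cases:
  assumes "same_shape Z \<sigma> \<sigma>'" "(x, z) \<in> elements Z"
  obtains (var) y where "\<sigma> x z = Var y" "\<sigma>' x z = Var y"
  | (app) x' u v ys where "\<sigma> x z = app x' u ys" "\<sigma>' x z = app x' v ys"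
  using assms unfolding same_shape_def by blast

lemma app_neq_Var [simp]: "app x u ys \<noteq> Var y" "Var y \<noteq> app x u ys"
  by (cases x; simp)+

lemma same_shape_app:
  assumes "same_shape Z \<sigma> \<sigma>'" "(x, z) \<in> elements Z" "\<sigma> x z = app x' u ys"
  obtains v where "\<sigma>' x z = app x' v ys"
  using assms(1,2)
proof (cases rule: same_shape_cases)
  case (app x'' u' v ys')
  then have "app x' u ys = app x'' u' ys'" using assms(3) by simp
  from app_inj[OF this] show ?thesis using that app(2) by blast
qed (use assms(3) in simp)

context
  fixes X Z :: "'u::infinite psh" and \<alpha>
  assumes X: "X \<in> Obj psh_cat" and \<alpha>: "\<alpha> \<in> hom psh_cat Z (P_obj X)"
begin

private lemma Z: "Z \<in> Obj psh_cat" using psh_hom_Obj[OF \<alpha>] by simp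

private abbreviation "\<sigma> \<equiv> subj X \<alpha>"
private abbreviation "c \<equiv> glue_class Z \<sigma>"
private abbreviation "L \<equiv> middle Z \<sigma>"

text \<open>The gluing depends on the shape only, hence identifies nothing that another family of the same shape
distinguishes.\<close>

lemma glue_invariant:
  assumes W: "W \<in> Obj psh_cat" and g: "g \<in> hom psh_cat Z (P_obj W)" and sh: "same_shape Z \<sigma> (subj W g)"
    and eq: "equivclp (var_glue Z \<sigma>) q q'" and q: "q \<in> elements Z"
  shows "q' \<in> elements Z \<and> case_prod (subj W g) q = case_prod (subj W g) q'"
  using eq
proof (induction rule: equivclp_induct)
  case base
  show ?case using q by simp
next
  case (step p p')
  \<comment> \<open>A variable judgement of the first family is one of the second, so the second family has
     the same gluing, and glued elements have the same subject.\<close>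
  have step: "a \<in> elements Z \<and> b \<in> elements Z \<and> case_prod (subj W g) a = case_prod (subj W g) b"
    if ab0: "var_glue Z \<sigma> a b" for a b
  proof -
    obtain n z j where z: "n \<ge> 1" "z \<in> omap Z (Tm n)" "\<sigma> (Tm n) z = Var j"
      and ab: "a = (Ty n, tm_bd Z n z)" "b = (Ty j, ty_bd Z j n (tm_bd Z n z))"
      using ab0 by (auto simp: var_glue_def)
    have "(Tm n, z) \<in> elements Z" using z by (simp add: elements_def)
    from sh this have "subj W g (Tm n) z = Var j" by (cases rule: same_shape_cases) (use z in auto)
    then have "var_glue Z (subj W g) (Ty n, tm_bd Z n z) (Ty j, ty_bd Z j n (tm_bd Z n z))"
      using z unfolding var_glue_def by blast
    from var_glue_subj[OF W g this] show ?thesis by (simp add: ab)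
  qed
  show ?case using step[of p p'] step[of p' p] step.IH step.hyps by auto
qed

lemma same_shape_refl: "same_shape Z \<sigma> \<sigma>"
  unfolding same_shape_def
proof clarify
  fix x z assume "(x, z) \<in> elements Z" and "\<nexists>x' u v ys. \<sigma> x z = app x' u ys \<and> \<sigma> x z = app x' v ys"
  then show "\<exists>y. \<sigma> x z = Var y \<and> \<sigma> x z = Var y" using subj_cases[OF X \<alpha>] by metis
qed

lemma parent_invariant:
  assumes eq: "equivclp (var_glue Z \<sigma>) q q'" and q: "q \<in> elements Z" and e: "e \<in> hedges"
    and s: "case_prod \<sigma> q = app (htgt e) u ys"
  shows "parent Z \<sigma> q' = parent Z \<sigma> q"
  using eq
proof (induction rule: equivclp_induct)
  case (step p p')
  have p: "case_prod \<sigma> p = app (htgt e) u ys"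
    using glue_invariant[OF X \<alpha> same_shape_refl step.hyps(1) q] s by simp
  have "equivclp (var_glue Z \<sigma>) q p'" by (rule equivclp_into_equivclp[OF step.hyps])
  then have p': "case_prod \<sigma> p' = app (htgt e) u ys"
    using glue_invariant[OF X \<alpha> same_shape_refl _ q] s by simp
  obtain x z x' z' where xz: "p = (x, z)" "p' = (x', z')" by (cases p; cases p')
  from step.hyps(2) have "parent Z \<sigma> p = parent Z \<sigma> p'"
  proof
    assume "var_glue Z \<sigma> p p'"
    from parent_glue[OF X \<alpha> this[unfolded xz] e] p show ?thesis by (simp add: xz)
  next
    assume "var_glue Z \<sigma> p' p"
    from parent_glue[OF X \<alpha> this[unfolded xz] e] p' show ?thesis by (simp add: xz)
  qed
  then show ?case using step.IH by simp
qed simp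

lemma middle_elements:
  "x \<in> Obj H_cat \<Longrightarrow> w \<in> omap L x \<longleftrightarrow>
    (\<exists>x' z u ys. w = c (x', z) \<and> (x', z) \<in> elements Z \<and> \<sigma> x' z = app x u ys)"
  by (auto simp: middle_def)

lemma middle_in:
  assumes q: "(x', z) \<in> elements Z" and s: "\<sigma> x' z = app x u ys"
  shows "c (x', z) \<in> omap L x"
  unfolding middle_elements[OF subj_head(1)[OF X \<alpha> q s]] using q s by blast

lemma middle_edge:
  assumes q: "(x, z) \<in> elements Z" and e: "e \<in> hedges" and s: "\<sigma> x z = app (htgt e) u ys"
  shows "c (parent Z \<sigma> (unglue Z \<sigma> (c (x, z)))) = c (parent Z \<sigma> (x, z))"
  using parent_invariant[OF unglue(2)[OF q] q e] s by simp

lemma middle_Obj: "L \<in> Obj psh_cat"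
  unfolding middle_def
proof (rule psh_of_Obj, clarify)
  fix e x z u ys assume e: "e \<in> hedges" and q: "(x, z) \<in> elements Z" and s: "\<sigma> x z = app (htgt e) u ys"
  obtain x' z' zs where p: "parent Z \<sigma> (x, z) = (x', z')" "(x', z') \<in> elements Z"
    "\<sigma> x' z' = app (hsrc e) (bd X e u) zs"
    using subj_parent[OF X \<alpha> q e s] by blast
  then show "\<exists>x' z'. c (parent Z \<sigma> (unglue Z \<sigma> (c (x, z)))) = c (x', z') \<and> (x', z') \<in> elements Z \<and>
      (\<exists>u ys. \<sigma> x' z' = app (hsrc e) u ys)"
    unfolding middle_edge[OF q e s] by metis
qed

lemma bd_middle:
  assumes q: "(x, z) \<in> elements Z" and e: "e \<in> hedges" and s: "\<sigma> x z = app (htgt e) u ys"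
  shows "bd L e (c (x, z)) = c (parent Z \<sigma> (x, z))"
  unfolding middle_edge[OF q e s, symmetric] unfolding middle_def
  by (rule bd_psh_of[OF e]) (use q s in blast)

text \<open>Replaces the heads of the given family by those of a family \<open>g\<close> of the same shape.\<close>

definition head_map :: "'u psh \<Rightarrow> 'u psh_arr \<Rightarrow> 'u psh_arr" where
  "head_map W g = psh_map L (\<lambda>x w. expr_head (case_prod (subj W g) (unglue Z \<sigma> w))) W"

lemma head_map_value:
  assumes W: "W \<in> Obj psh_cat" and g: "g \<in> hom psh_cat Z (P_obj W)" and sh: "same_shape Z \<sigma> (subj W g)"
    and q: "(x', z) \<in> elements Z"
  shows "expr_head (case_prod (subj W g) (unglue Z \<sigma> (c (x', z)))) = expr_head (subj W g x' z)"
  using glue_invariant[OF W g sh unglue(2)[OF q] q] by simp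

lemma head_map_hom:
  assumes W: "W \<in> Obj psh_cat" and g: "g \<in> hom psh_cat Z (P_obj W)" and sh: "same_shape Z \<sigma> (subj W g)"
  shows "head_map W g \<in> hom psh_cat L W"
  unfolding head_map_def
proof (rule psh_map_hom[OF middle_Obj W])
  fix x w assume x: "x \<in> Obj H_cat" and "w \<in> omap L x"
  then obtain x' z u ys where w: "w = c (x', z)" and q: "(x', z) \<in> elements Z" and s: "\<sigma> x' z = app x u ys"
    using middle_elements[OF x] by blast
  obtain v where "subj W g x' z = app x v ys" using same_shape_app[OF sh q s] .
  then show "expr_head (case_prod (subj W g) (unglue Z \<sigma> w)) \<in> omap W x"
    using subj_head(2)[OF W g q] unfolding w head_map_value[OF W g sh q] by simp
next
  fix e w assume e: "e \<in> hedges" and w0: "w \<in> omap L (htgt e)"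
  have "htgt e \<in> Obj H_cat" using hedge_Obj_H[OF e] by simp
  from w0[unfolded middle_elements[OF this]] obtain x' z u ys
    where w: "w = c (x', z)" and q: "(x', z) \<in> elements Z" and s: "\<sigma> x' z = app (htgt e) u ys" by blast
  obtain x'' z'' zs where p: "parent Z \<sigma> (x', z) = (x'', z'')" "(x'', z'') \<in> elements Z"
    using subj_parent[OF X \<alpha> q e s] by blast
  obtain v where v: "subj W g x' z = app (htgt e) v ys" using same_shape_app[OF sh q s] .
  obtain x3 z3 zs3 where p3: "parent Z (subj W g) (x', z) = (x3, z3)"
    "subj W g x3 z3 = app (hsrc e) (bd W e v) zs3" using subj_parent[OF W g q e v] by blast
  \<comment> \<open>The parent depends on the last argument only, which the two families share.\<close>
  have "parent Z (subj W g) (x', z) = parent Z \<sigma> (x', z)"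
  proof (cases e)
    case (Next k)
    from subj_parent[OF X \<alpha> q e s] Next obtain ys' where "ys = ys' @ [last_arg (\<sigma> x' z)]" by blast
    then have "last_arg (subj W g x' z) = last_arg (\<sigma> x' z)" using v Next by simp
    then show ?thesis by (cases x') simp_all
  next
    case (Term k)
    have "\<exists>n. x' = Tm n"
    proof (cases x')
      case (Ty n)
      obtain m A zs where "\<sigma> (Ty n) z = ty_app m A zs"
        using ok_type_head[OF family_type_ok(2)[OF X \<alpha>]] q Ty by blast
      then show ?thesis using s Term Ty by simp
    qed simp
    then show ?thesis by auto
  qed
  then have "subj W g x'' z'' = app (hsrc e) (bd W e v) zs3" using p(1) p3 by simp
  then show "bd W e (expr_head (case_prod (subj W g) (unglue Z \<sigma> w))) =
      expr_head (case_prod (subj W g) (unglue Z \<sigma> (bd L e w)))"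
    unfolding w bd_middle[OF q e s] p(1) head_map_value[OF W g sh q] head_map_value[OF W g sh p(2)]
    by (simp add: v)
qed

lemma act_head_map:
  assumes W: "W \<in> Obj psh_cat" and g: "g \<in> hom psh_cat Z (P_obj W)" and sh: "same_shape Z \<sigma> (subj W g)"
    and q: "(x', z) \<in> elements Z" and s: "\<sigma> x' z = app x u ys"
  shows "act (head_map W g) x (c (x', z)) = expr_head (subj W g x' z)"
proof -
  have x: "x \<in> Obj H_cat" by (rule subj_head(1)[OF X \<alpha> q s])
  from middle_in[OF q s] show ?thesis by (simp add: head_map_def x head_map_value[OF W g sh q])
qed

lemma relabel_head_map:
  assumes W: "W \<in> Obj psh_cat" and g: "g \<in> hom psh_cat Z (P_obj W)" and sh: "same_shape Z \<sigma> (subj W g)"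
    and q: "(x, z) \<in> elements Z"
  shows "relabel (head_map W g) (rehead (c (x, z)) (\<sigma> x z)) = subj W g x z"
  using sh q
proof (cases rule: same_shape_cases)
  case (app x' u v ys)
  then show ?thesis using act_head_map[OF W g sh q app(1)] by simp
qed simp

lemma heads_ok_type:
  assumes q: "(Ty n, z) \<in> elements Z" and T: "ok_type X (fam_ctx \<sigma> Z n z) (\<sigma> (Ty n) z)"
  shows "ok_type L (fam_ctx (\<lambda>x z. rehead (c (x, z)) (\<sigma> x z)) Z n z) (rehead (c (Ty n, z)) (\<sigma> (Ty n) z))"
  using T
proof cases
  case (closed A)
  have s: "\<sigma> (Ty n) z = app (Ty 1) A []" using closed by simp
  have "c (Ty n, z) \<in> omap L (Ty 1)" by (rule middle_in[OF q s])
  then show ?thesis unfolding s rehead_app using ok_type.closed[of "c (Ty n, z)" L] by simp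
next
  case (dependent k A y ys)
  have e: "Next k \<in> hedges" using dependent by simp
  have s: "\<sigma> (Ty n) z = app (htgt (Next k)) A (ys @ [y])" using dependent by simp
  have y: "1 \<le> y" "y < n" "\<sigma> (Ty y) (ty_bd Z y n z) = ty_app k (bd X (Next k) A) ys"
    using dependent(4) by (auto simp: fam_ctx_mem)
  have "last_arg (\<sigma> (Ty n) z) = y" using dependent(1) by simp
  then have bd: "bd L (Next k) (c (Ty n, z)) = c (Ty y, ty_bd Z y n z)"
    using bd_middle[OF q e s] by simp
  have "c (Ty n, z) \<in> omap L (Ty (Suc k))" using middle_in[OF q s] by simp
  moreover have "(y, ty_app k (bd L (Next k) (c (Ty n, z))) ys) \<in>
      set (fam_ctx (\<lambda>x z. rehead (c (x, z)) (\<sigma> x z)) Z n z)"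
    unfolding fam_ctx_mem bd y(3) using y by simp
  ultimately have "ok_type L (fam_ctx (\<lambda>x z. rehead (c (x, z)) (\<sigma> x z)) Z n z)
      (ty_app (Suc k) (c (Ty n, z)) (ys @ [y]))"
    by (rule ok_type.dependent[OF dependent(2)])
  then show ?thesis unfolding dependent(1) rehead_ty_app .
qed

lemma heads_ok_ctx:
  assumes "n \<ge> 1" "z \<in> omap Z (Ty n)"
  shows "ok_ctx L (fam_ctx (\<lambda>x z. rehead (c (x, z)) (\<sigma> x z)) Z n z)"
  using assms
proof (induction n arbitrary: z rule: nat_induct_at_least)
  case base
  then show ?case by (simp add: fam_ctx_def ok_ctx.Nil)
next
  case (Suc n)
  let ?w = "bd Z (Next n) z" and ?\<tau> = "\<lambda>x z. rehead (c (x, z)) (\<sigma> x z)"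
  have w: "?w \<in> omap Z (Ty n)" by (rule ty_bd_step_in[OF Z Suc.hyps Suc.prems])
  then have q: "(Ty n, ?w) \<in> elements Z" using Suc.hyps by (simp add: elements_def)
  have "n \<notin> fst ` set (fam_ctx ?\<tau> Z n ?w)" by (force simp: fam_ctx_def)
  then show ?case
    unfolding fam_ctx_Suc[OF Z Suc.hyps Suc.prems] ok_ctx_snoc
    using Suc.IH[OF w] heads_ok_type[OF q family_type_ok(2)[OF X \<alpha> q]] by simp
qed

text \<open>The universal family, whose heads are the elements of the middle object themselves.  Its variable
judgements are well-typed because of the gluing.\<close>

lemma heads_ok:
  assumes x: "x \<in> Obj H_cat" "z \<in> omap Z x"
  shows "ok_jdg L (fam_jdg (\<lambda>x z. rehead (c (x, z)) (\<sigma> x z)) Z x z)"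
proof (cases x)
  case (Ty n)
  then have q: "(Ty n, z) \<in> elements Z" using x by (simp add: elements_def)
  show ?thesis using heads_ok_ctx[of n z] heads_ok_type[OF q family_type_ok(2)[OF X \<alpha> q]] x by (simp add: Ty)
next
  case (Tm n)
  let ?\<tau> = "\<lambda>x z. rehead (c (x, z)) (\<sigma> x z)" and ?w = "tm_bd Z n z"
  have n: "n \<ge> 1" and z: "z \<in> omap Z (Tm n)" using x by (auto simp: Tm)
  have w: "?w \<in> omap Z (Ty n)" by (rule tm_bd_in[OF Z n z])
  have q: "(Tm n, z) \<in> elements Z" "(Ty n, ?w) \<in> elements Z" using n z w by (auto simp: elements_def)
  note T = heads_ok_type[OF q(2) family_type_ok(2)[OF X \<alpha> q(2)]]
  from family_term_ok(2)[OF X \<alpha> q(1)]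
  have "ok_term L (fam_ctx ?\<tau> Z n ?w) (?\<tau> (Tm n) z) (?\<tau> (Ty n) ?w)"
  proof cases
    case (var j)
    then have j: "1 \<le> j" "j < n" and eq: "\<sigma> (Ty n) ?w = \<sigma> (Ty j) (ty_bd Z j n ?w)"
      by (auto simp: fam_ctx_mem)
    have "var_glue Z \<sigma> (Ty n, ?w) (Ty j, ty_bd Z j n ?w)"
      using n z var(1) unfolding var_glue_def by blast
    then have "c (Ty n, ?w) = c (Ty j, ty_bd Z j n ?w)" unfolding glue_class_eq_iff by (rule r_into_equivclp)
    then have "(j, ?\<tau> (Ty n) ?w) \<in> set (fam_ctx ?\<tau> Z n ?w)" unfolding fam_ctx_mem using j eq by simp
    then show ?thesis unfolding var(1) rehead_Var by (rule ok_term.var)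
  next
    case (const k a ys)
    have e: "Term k \<in> hedges" using const by simp
    have s: "\<sigma> (Tm n) z = app (htgt (Term k)) a ys" using const(1) by simp
    have "tm_bd L k (c (Tm n, z)) = c (Ty n, ?w)" using bd_middle[OF q(1) e s] by (simp add: tm_bd_eq)
    then have T': "?\<tau> (Ty n) ?w = ty_app k (tm_bd L k (c (Tm n, z))) ys" unfolding const(2) by simp
    have "c (Tm n, z) \<in> omap L (Tm k)" using middle_in[OF q(1) s] by simp
    from ok_term.const[OF const(3) this] T show ?thesis
      unfolding const(1) rehead_tm_app T' by blast
  qed
  then show ?thesis using heads_ok_ctx[OF n w] by (simp add: Tm)
qed

text \<open>Any factorisation of \<open>\<alpha>\<close> over \<open>X\<close> is a family of the same shape as \<open>\<alpha>\<close>.  A map out of the middle object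
relabels the universal family to it exactly if it sends each head to the corresponding head, and every
element of the middle object is a head.\<close>

lemma generic_factorisation_exists: "\<exists>\<beta> e. generic_factorisation psh_cat psh_cat P X \<alpha> \<beta> e"
proof -
  let ?\<tau> = "\<lambda>x z. rehead (c (x, z)) (\<sigma> x z)"
  obtain e where e: "e \<in> hom psh_cat Z (P_obj L)"
    and Ne: "\<And>x z. x \<in> Obj H_cat \<Longrightarrow> z \<in> omap Z x \<Longrightarrow> norm_jdg L (act e x z) = fam_jdg ?\<tau> Z x z"
    using family_map[OF middle_Obj Z heads_ok] by blast
  define \<beta> where "\<beta> = head_map X \<alpha>"
  have \<beta>: "\<beta> \<in> hom psh_cat L X" unfolding \<beta>_def by (rule head_map_hom[OF X \<alpha> same_shape_refl])
  have factor: "Comp psh_cat (amap P (head_map W g)) e = g"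
    if W: "W \<in> Obj psh_cat" and g: "g \<in> hom psh_cat Z (P_obj W)" and sh: "same_shape Z \<sigma> (subj W g)" for W g
  proof -
    note h = head_map_hom[OF W g sh]
    show ?thesis
    proof (rule P_hom_eq[OF W psh_hom_comp[OF e P_hom[OF h]] g])
      fix x z assume x: "x \<in> Obj H_cat" "z \<in> omap Z x"
      have "fam_jdg (\<lambda>x z. relabel (head_map W g) (?\<tau> x z)) Z x z = fam_jdg (subj W g) Z x z"
        by (rule fam_jdg_cong[OF Z x]) (rule relabel_head_map[OF W g sh], simp add: elements_def)
      then show "norm_jdg W (act (Comp psh_cat (amap P (head_map W g)) e) x z) = norm_jdg W (act g x z)"
        by (simp add: act_comp[OF e P_hom[OF h] x] norm_P[OF h x(1) act_in[OF e x]] Ne[OF x]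
            jdg_map_fam norm_family[OF W g x])
    qed
  qed
  have "\<exists>!h. h \<in> hom psh_cat L W \<and> Comp psh_cat \<gamma> h = \<beta> \<and> Comp psh_cat (amap P h) e = g"
    if \<gamma>: "\<gamma> \<in> hom psh_cat W X" and g: "g \<in> hom psh_cat Z (P_obj W)"
      and fac: "Comp psh_cat (amap P \<gamma>) g = \<alpha>" for W \<gamma> g
  proof -
    have W: "W \<in> Obj psh_cat" using psh_hom_Obj[OF \<gamma>] by simp
    have rel: "relabel \<gamma> (subj W g x z) = \<sigma> x z" if q: "(x, z) \<in> elements Z" for x z
    proof -
      have x: "x \<in> Obj H_cat" "z \<in> omap Z x" using q by (auto simp: elements_def)
      have "act \<alpha> x z = act (amap P \<gamma>) x (act g x z)"
        using act_comp[OF g P_hom[OF \<gamma>] x] by (simp add: fac)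
      then have "norm_jdg X (act \<alpha> x z) = jdg_map (relabel \<gamma>) (norm_jdg W (act g x z))"
        using norm_P[OF \<gamma> x(1) act_in[OF g x]] by simp
      then show ?thesis by (simp add: subj_def jdg_map_def)
    qed
    have sh: "same_shape Z \<sigma> (subj W g)"
      unfolding same_shape_def
    proof (intro ballI, clarify)
      fix x z assume q: "(x, z) \<in> elements Z"
        and no: "\<nexists>x' u v ys. \<sigma> x z = app x' u ys \<and> subj W g x z = app x' v ys"
      from W g q show "\<exists>y. \<sigma> x z = Var y \<and> subj W g x z = Var y"
      proof (cases rule: subj_cases)
        case (app x' u ys)
        then have "\<sigma> x z = app x' (act \<gamma> x' u) ys" using rel[OF q] by simp
        with no app show ?thesis by blast
      next
        case (var n y)
        then have "\<sigma> x z = Var y" using rel[OF q] by simp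
        with var(2) show ?thesis by blast
      qed
    qed
    let ?h = "head_map W g"
    note h = head_map_hom[OF W g sh]
    show ?thesis
    proof (intro ex1I[of _ ?h] conjI h)
      show "Comp psh_cat (amap P ?h) e = g" by (rule factor[OF W g sh])
      show "Comp psh_cat \<gamma> ?h = \<beta>"
      proof (rule psh_hom_eq[OF psh_hom_comp[OF h \<gamma>] \<beta>])
        fix x w assume x: "x \<in> Obj H_cat" and w0: "w \<in> omap L x"
        then obtain x' z u ys where w: "w = c (x', z)" and q: "(x', z) \<in> elements Z"
          and s: "\<sigma> x' z = app x u ys" using middle_elements[OF x] by blast
        obtain v where v: "subj W g x' z = app x v ys" using same_shape_app[OF sh q s] .
        have "act \<gamma> x v = u" using rel[OF q] s v by (simp add: app_inject)
        then show "act (Comp psh_cat \<gamma> ?h) x w = act \<beta> x w"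
          unfolding act_comp[OF h \<gamma> x w0] unfolding w act_head_map[OF W g sh q s] \<beta>_def
            act_head_map[OF X \<alpha> same_shape_refl q s] by (simp add: s v)
      qed
      fix h' assume h'0: "h' \<in> hom psh_cat L W \<and> Comp psh_cat \<gamma> h' = \<beta> \<and> Comp psh_cat (amap P h') e = g"
      then have h': "h' \<in> hom psh_cat L W" by simp
      show "h' = ?h"
      proof (rule psh_hom_eq[OF h' h])
        fix x w assume x: "x \<in> Obj H_cat" and w0: "w \<in> omap L x"
        then obtain x' z u ys where w: "w = c (x', z)" and q: "(x', z) \<in> elements Z"
          and s: "\<sigma> x' z = app x u ys" using middle_elements[OF x] by blast
        have x': "x' \<in> Obj H_cat" "z \<in> omap Z x'" using q by (auto simp: elements_def)
        have "norm_jdg W (act g x' z) = fam_jdg (\<lambda>x z. relabel h' (?\<tau> x z)) Z x' z"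
          using h'0 act_comp[OF e P_hom[OF h'] x'] norm_P[OF h' x'(1) act_in[OF e x']]
          by (auto simp: Ne[OF x'] jdg_map_fam)
        then have "subj W g x' z = relabel h' (?\<tau> x' z)" unfolding subj_def by (cases x') simp_all
        then have "subj W g x' z = app x (act h' x w) ys" by (simp add: s w)
        then show "act h' x w = act ?h x w"
          unfolding w act_head_map[OF W g sh q s] by simp
      qed
    qed
  qed
  note universal = this
  have doms: "Dom psh_cat \<beta> = L" "Dom psh_cat \<alpha> = Z" using \<beta> \<alpha> by (simp_all add: hom_def)
  have "generic_factorisation psh_cat psh_cat P X \<alpha> \<beta> e"
    unfolding generic_factorisation_def doms
  proof (intro conjI allI impI)
    show "\<beta> \<in> hom psh_cat L X" by (rule \<beta>)
    show "e \<in> hom psh_cat Z (omap P L)" using e by (simp add: P_omap middle_Obj)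
    show "Comp psh_cat (amap P \<beta>) e = \<alpha>" unfolding \<beta>_def by (rule factor[OF X \<alpha> same_shape_refl])
    fix W \<gamma> g assume \<gamma>: "\<gamma> \<in> hom psh_cat W X" and "g \<in> hom psh_cat Z (omap P W)"
      and fac: "Comp psh_cat (amap P \<gamma>) g = \<alpha>"
    then have "g \<in> hom psh_cat Z (P_obj W)" using psh_hom_Obj[OF \<gamma>] by (simp add: P_omap)
    from universal[OF \<gamma> this fac] show "\<exists>!h. h \<in> hom psh_cat L W \<and> Comp psh_cat \<gamma> h = \<beta> \<and>
      Comp psh_cat (amap P h) e = g" .
  qed
  then show ?thesis by blast
qed

end


section \<open>The weakening and projection monad is strongly cartesian\<close>

lemma wp_monad_eq:
  "wp_monad = (P :: ('u::infinite psh, 'u psh_arr, 'u psh, 'u psh_arr) fctr, wp_unit, \<lambda>X \<in> Obj psh_cat. mult X)"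
  unfolding wp_monad_def induced_monad_def
  by (auto simp: free_def forget_counit intro!: restrict_ext)

lemma comp_P_P:
  fixes X :: "'u::infinite psh"
  shows "X \<in> Obj psh_cat \<Longrightarrow> omap (comp_fctr psh_cat P P) X = P_obj (P_obj X)"
    and "f \<in> hom psh_cat X Y \<Longrightarrow> amap (comp_fctr psh_cat P P) f = amap P (amap P f)"
  by (auto simp: comp_fctr_def[of _ P P] compose_def P_omap P_obj_Obj hom_def)

lemma id_fctr_psh:
  "X \<in> Obj psh_cat \<Longrightarrow> omap (id_fctr psh_cat) X = X"
  "f \<in> hom psh_cat X Y \<Longrightarrow> amap (id_fctr psh_cat) f = f"
  by (auto simp: id_fctr_def hom_def)

lemma nat_trans_unit:
  "nat_trans psh_cat psh_cat (id_fctr psh_cat)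
    (P :: ('u::infinite psh, 'u psh_arr, 'u psh, 'u psh_arr) fctr) wp_unit"
proof (rule nat_transI[OF functor_id_fctr[OF category_psh] functor_P])
  show "wp_unit \<in> extensional (Obj psh_cat)" by (simp add: wp_unit_def)
  show "wp_unit X \<in> hom psh_cat (omap (id_fctr psh_cat) X) (omap P X)" if "X \<in> Obj psh_cat"
    for X :: "'u psh"
    using unit_hom[OF that] by (simp add: id_fctr_psh P_omap that)
  show "Comp psh_cat (amap P f) (wp_unit X) = Comp psh_cat (wp_unit Y) (amap (id_fctr psh_cat) f)"
    if "f \<in> hom psh_cat X Y" for f :: "'u psh_arr" and X Y
    using unit_natural[OF that] by (simp add: id_fctr_psh(2)[OF that])
qed

lemma nat_trans_mult:
  "nat_trans psh_cat psh_cat (comp_fctr psh_cat P P)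
    (P :: ('u::infinite psh, 'u psh_arr, 'u psh, 'u psh_arr) fctr) (\<lambda>X \<in> Obj psh_cat. mult X)"
proof (rule nat_transI[OF functor_comp_fctr[OF functor_P functor_P] functor_P])
  show "(\<lambda>X \<in> Obj psh_cat. mult X) X \<in> hom psh_cat (omap (comp_fctr psh_cat P P) X) (omap P X)"
    if "X \<in> Obj psh_cat" for X :: "'u psh"
    using mult_hom[OF that] by (simp add: comp_P_P(1)[OF that] P_omap that)
  show "Comp psh_cat (amap P f) ((\<lambda>X \<in> Obj psh_cat. mult X) X) =
      Comp psh_cat ((\<lambda>X \<in> Obj psh_cat. mult X) Y) (amap (comp_fctr psh_cat P P) f)"
    if "f \<in> hom psh_cat X Y" for f :: "'u psh_arr" and X Y
    using mult_natural[OF that] psh_hom_Obj[OF that] by (simp add: comp_P_P(2)[OF that])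
qed simp

lemma has_generic_factorisations_P:
  "has_generic_factorisations psh_cat psh_cat (P :: ('u::infinite psh, 'u psh_arr, 'u psh, 'u psh_arr) fctr)"
  unfolding has_generic_factorisations_def
proof (intro ballI impI)
  fix X :: "'u psh" and \<alpha> :: "'u psh_arr"
  assume X: "X \<in> Obj psh_cat" and "\<alpha> \<in> Arr psh_cat" "Cod psh_cat \<alpha> = omap P X"
  then have "\<alpha> \<in> hom psh_cat (Dom psh_cat \<alpha>) (P_obj X)" by (simp add: hom_def P_omap)
  then show "\<exists>\<beta> e. generic_factorisation psh_cat psh_cat P X \<alpha> \<beta> e"
    by (rule generic_factorisation_exists[OF X])
qed

theorem proposition47:
  shows "strongly_cartesian_monad (psh_cat :: ('u::infinite psh, 'u psh_arr) cat) wp_monad"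
proof -
  let ?C = "psh_cat :: ('u psh, 'u psh_arr) cat" and ?\<mu> = "\<lambda>X \<in> Obj psh_cat. mult (X :: 'u psh)"
  have monad: "is_monad ?C (P, wp_unit, ?\<mu>)"
    unfolding is_monad_def prod.case
    using functor_P nat_trans_unit nat_trans_mult
    by (auto simp: P_omap P_obj_Obj mult_unit mult_P_unit mult_assoc)
  have unit: "cartesian_nat_trans ?C ?C (id_fctr ?C) P wp_unit"
    unfolding cartesian_nat_trans_def
  proof (intro conjI ballI nat_trans_unit)
    fix f assume "f \<in> Arr ?C"
    then have f: "f \<in> hom ?C (Dom ?C f) (Cod ?C f)" by (simp add: hom_def)
    show "is_pullback ?C (wp_unit (Dom ?C f)) (amap (id_fctr ?C) f) (amap P f) (wp_unit (Cod ?C f))"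
      using unit_cartesian[OF f] by (simp add: id_fctr_psh(2)[OF f])
  qed
  have mult: "cartesian_nat_trans ?C ?C (comp_fctr ?C P P) P ?\<mu>"
    unfolding cartesian_nat_trans_def
  proof (intro conjI ballI nat_trans_mult)
    fix f assume "f \<in> Arr ?C"
    then have f: "f \<in> hom ?C (Dom ?C f) (Cod ?C f)" by (simp add: hom_def)
    show "is_pullback ?C (?\<mu> (Dom ?C f)) (amap (comp_fctr ?C P P) f) (amap P f) (?\<mu> (Cod ?C f))"
      using mult_cartesian[OF f] psh_hom_Obj[OF f] by (simp add: comp_P_P(2)[OF f])
  qed
  note gen = has_generic_factorisations_P
  have "preserves_pullbacks ?C ?C P" "local_right_adjoint ?C ?C P"
    using preserves_pullbacks_if_generic_factorisations[OF functor_P gen]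
      local_right_adjoint_if_generic_factorisations[OF functor_P gen] by auto
  then show ?thesis
    using monad unit mult
    unfolding strongly_cartesian_monad_def cartesian_monad_def wp_monad_eq prod.case by blast
qed

end
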